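(* Let $f\colon X\to Y$ be a map of cubical sets. If $f$ is a fibration (respectively, a trivial fibration) in the cubical Joyal model structure, then for all vertices $x_0,x_1\colon\Box^0\to X$ the induced map $f_*\colon\mathrm{Map}_X(x_0,x_1)\to\mathrm{Map}_Y(fx_0,fx_1)$ is a fibration (respectively, a trivial fibration) in the Grothendieck model structure. In particular, if $X$ is a cubical quasicategory then all mapping spaces $\mathrm{Map}_X(x_0,x_1)$ are cubical Kan complexes.
   Context: Cubical sets. $\Box$ is the category whose objects are the posets $[1]^n=\{0\le 1\}^n$, $n\ge 0$, and whose morphisms are generated (inside posets) under composition by: faces $\partial_{i,\varepsilon}\colon[1]^{n-1}\to[1]^n$ (insert $\varepsilon\in\{0,1\}$ as $i$-th coordinate); degeneracies $\sigma_i\colon[1]^n\to[1]^{n-1}$ (omit the $i$-th coordinate); negative connections $\gamma_{i,0}\colon[1]^n\to[1]^{n-1}$ (replace $x_i,x_{i+1}$ by their maximum) and positive connections $\gamma_{i,1}$ (replace them by their minimum). $\mathsf{cSet}=\mathsf{Set}^{\Box^{\mathrm{op}}}$; $\Box^n$ is the representable at $[1]^n$; operators act on the right. $\sqcap^n_{i,\varepsilon}\subset\Box^n$ is the union of all faces except $\partial_{i,\varepsilon}$; the critical edge of $\Box^n$ with respect to $\partial_{i,\varepsilon}$ is the edge $[1]\to[1]^n$ whose $i$-th component is the identity and whose other components are constant at $1-\varepsilon$. For $n\ge2$, $\widehat{\sqcap}^n_{i,\varepsilon}\hookrightarrow\widehat{\Box}^n_{i,\varepsilon}$ is the inclusion obtained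 from $\sqcap^n_{i,\varepsilon}\hookrightarrow\Box^n$ by collapsing the critical edge to a point. A cubical quasicategory is a cubical set $X$ such that $X\to\Box^0$ has the right lifting property against all these inner open box inclusions. The cubical Joyal model structure is the (unique) model structure on $\mathsf{cSet}$ whose cofibrations are the monomorphisms and whose fibrant objects are the cubical quasicategories. A Kan fibration of cubical sets is a map with the right lifting property against all open box inclusions $\sqcap^n_{i,\varepsilon}\hookrightarrow\Box^n$ ($n\ge1$); a cubical Kan complex is a cubical set $X$ with $X\to\Box^0$ a Kan fibration. The Grothendieck model structure on $\mathsf{cSet}$ has monomorphisms as cofibrations and Kan fibrations as fibrations. Mapping spaces. For vertices $x_0,x_1$ of $X$, $\mathrm{Map}_X(x_0,x_1)$ is the cubical set with $\mathrm{Map}_X(x_0,x_1)_n=\{s\colon\Box^{n+1}\to X\mid s\partial_{n+1,\varepsilon}=x_\varepsilon\text{ for }\varepsilon=0,1\}$, where $x_\varepsilon$ also denotes its degeneracy in the appropriate dimension, with operators those of $X$ acting on the first $n$ coordinates; $f_*$ is postcomposition with $f$. *)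

theory Defs
  imports "HOL-Library.FuncSet"
begin

section \<open>The box category\<close>

text \<open>The poset $[1]^n$ is the set of Boolean lists of length $n$; coordinates are numbered
  from 1. Functions out of it are extensional, so that a morphism is a single HOL function.\<close>

definition pow1 :: "nat \<Rightarrow> bool list set" where
  "pow1 n = {xs. length xs = n}"

type_synonym op = "bool list \<Rightarrow> bool list"

definition face :: "nat \<Rightarrow> nat \<Rightarrow> bool \<Rightarrow> op" where
  "face n i e = restrict (\<lambda>xs. take (i - 1) xs @ [e] @ drop (i - 1) xs) (pow1 (n - 1))"

definition degen :: "nat \<Rightarrow> nat \<Rightarrow> op" where
  "degen n i = restrict (\<lambda>xs. take (i - 1) xs @ drop i xs) (pow1 n)"

definition conn :: "nat \<Rightarrow> nat \<Rightarrow> bool \<Rightarrow> op" where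
  "conn n i e = restrict (\<lambda>xs. take (i - 1) xs @
     [if e then min (xs ! (i - 1)) (xs ! i) else max (xs ! (i - 1)) (xs ! i)] @
     drop (i + 1) xs) (pow1 n)"

definition box_id :: "nat \<Rightarrow> op" where
  "box_id n = restrict (\<lambda>xs. xs) (pow1 n)"

inductive_set box_hom3 :: "(nat \<times> nat \<times> op) set" where
  ident: "(n, n, box_id n) \<in> box_hom3"
| face: "1 \<le> i \<Longrightarrow> i \<le> n \<Longrightarrow> (n - 1, n, face n i e) \<in> box_hom3"
| degen: "1 \<le> i \<Longrightarrow> i \<le> n \<Longrightarrow> (n, n - 1, degen n i) \<in> box_hom3"
| conn: "1 \<le> i \<Longrightarrow> i < n \<Longrightarrow> (n, n - 1, conn n i e) \<in> box_hom3"
| comp: "(k, m, \<psi>) \<in> box_hom3 \<Longrightarrow> (m, n, \<phi>) \<in> box_hom3 \<Longrightarrow>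
    (k, n, compose (pow1 k) \<phi> \<psi>) \<in> box_hom3"

definition box_hom :: "nat \<Rightarrow> nat \<Rightarrow> op set" where
  "box_hom m n = {\<phi>. (m, n, \<phi>) \<in> box_hom3}"

section \<open>Cubical sets\<close>

text \<open>\<open>act X m n \<phi> x\<close> is the right action $x\phi$ of $\phi\colon[1]^m\to[1]^n$ on $x \in X_n$.
  The type variable \<open>'a\<close> plays the role of the universe of sets: all cubes of
  a cubical set are elements of \<open>'a\<close>.\<close>

record 'a cset =
  cells :: "nat \<Rightarrow> 'a set"
  act :: "nat \<Rightarrow> nat \<Rightarrow> op \<Rightarrow> 'a \<Rightarrow> 'a"

definition is_cset :: "'a cset \<Rightarrow> bool" where
  "is_cset X \<longleftrightarrow>
     (\<forall>m n. \<forall>\<phi>\<in>box_hom m n. \<forall>x\<in>cells X n. act X m n \<phi> x \<in> cells X m) \<and>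
     (\<forall>n. \<forall>x\<in>cells X n. act X n n (box_id n) x = x) \<and>
     (\<forall>k m n. \<forall>\<psi>\<in>box_hom k m. \<forall>\<phi>\<in>box_hom m n. \<forall>x\<in>cells X n.
        act X k m \<psi> (act X m n \<phi> x) = act X k n (compose (pow1 k) \<phi> \<psi>) x)"

text \<open>Maps of cubical sets carry their source and target, and each component is
  extensional, so that equality of maps is HOL equality.\<close>

record ('a, 'b) cmap =
  src :: "'a cset"
  tgt :: "'b cset"
  app :: "nat \<Rightarrow> 'a \<Rightarrow> 'b"

definition is_cmap :: "('a, 'b) cmap \<Rightarrow> bool" where
  "is_cmap f \<longleftrightarrow> is_cset (src f) \<and> is_cset (tgt f) \<and>
     (\<forall>n. app f n \<in> cells (src f) n \<rightarrow>\<^sub>E cells (tgt f) n) \<and>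
     (\<forall>m n. \<forall>\<phi>\<in>box_hom m n. \<forall>x\<in>cells (src f) n.
        app f m (act (src f) m n \<phi> x) = act (tgt f) m n \<phi> (app f n x))"

definition cmap_comp :: "('b, 'c) cmap \<Rightarrow> ('a, 'b) cmap \<Rightarrow> ('a, 'c) cmap" (infixl "\<odot>" 55) where
  "g \<odot> f = \<lparr>src = src f, tgt = tgt g,
     app = (\<lambda>n. compose (cells (src f) n) (app g n) (app f n))\<rparr>"

text \<open>Monomorphisms in a presheaf category are the levelwise injections.\<close>

definition cmono :: "('a, 'b) cmap \<Rightarrow> bool" where
  "cmono f \<longleftrightarrow> is_cmap f \<and> (\<forall>n. inj_on (app f n) (cells (src f) n))"

definition lifts :: "('a, 'b) cmap \<Rightarrow> ('c, 'd) cmap \<Rightarrow> bool" where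
  "lifts i p \<longleftrightarrow> (\<forall>u v. is_cmap u \<and> src u = src i \<and> tgt u = src p \<and>
      is_cmap v \<and> src v = tgt i \<and> tgt v = tgt p \<and> p \<odot> u = v \<odot> i \<longrightarrow>
      (\<exists>h. is_cmap h \<and> src h = tgt i \<and> tgt h = src p \<and> h \<odot> i = u \<and> p \<odot> h = v))"

text \<open>\<open>pt\<close> is a copy of $\Box^0$ that is available in every universe \<open>'a\<close>.\<close>

definition pt :: "'a cset" where
  "pt = \<lparr>cells = (\<lambda>_. {undefined}), act = (\<lambda>_ _ _ x. x)\<rparr>"

definition to_pt :: "'a cset \<Rightarrow> ('a, 'b) cmap" where
  "to_pt X = \<lparr>src = X, tgt = pt, app = (\<lambda>n. \<lambda>x\<in>cells X n. undefined)\<rparr>"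

section \<open>Open boxes and inner open boxes\<close>

definition cube :: "nat \<Rightarrow> op cset" where
  "cube n = \<lparr>cells = (\<lambda>m. box_hom m n), act = (\<lambda>k m \<psi> \<phi>. compose (pow1 k) \<phi> \<psi>)\<rparr>"

definition open_box :: "nat \<Rightarrow> nat \<Rightarrow> bool \<Rightarrow> op cset" where
  "open_box n i e = \<lparr>cells = (\<lambda>m. {compose (pow1 m) (face n j d) \<psi> | j d \<psi>.
       1 \<le> j \<and> j \<le> n \<and> (j, d) \<noteq> (i, e) \<and> \<psi> \<in> box_hom m (n - 1)}),
     act = act (cube n)\<rparr>"

definition open_box_incl :: "nat \<Rightarrow> nat \<Rightarrow> bool \<Rightarrow> (op, op) cmap" where
  "open_box_incl n i e = \<lparr>src = open_box n i e, tgt = cube n,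
     app = (\<lambda>m. \<lambda>\<phi>\<in>cells (open_box n i e) m. \<phi>)\<rparr>"

definition critical_edge :: "nat \<Rightarrow> nat \<Rightarrow> bool \<Rightarrow> op" where
  "critical_edge n i e = restrict (\<lambda>xs. (replicate n (\<not> e))[i - 1 := hd xs]) (pow1 1)"

text \<open>Collapsing an edge \<open>d\<close> of \<open>A\<close> to a point, i.e. the pushout of
  $A \leftarrow \Box^1 \to \Box^0$: in each dimension all cubes in the image of \<open>d\<close> are identified.\<close>

definition edge_rel :: "'a cset \<Rightarrow> 'a \<Rightarrow> nat \<Rightarrow> 'a rel" where
  "edge_rel A d m = {(x, y). x \<in> cells A m \<and> y \<in> cells A m \<and>
     (x = y \<or> (\<exists>\<phi>\<in>box_hom m 1. x = act A m 1 \<phi> d) \<and> (\<exists>\<phi>\<in>box_hom m 1. y = act A m 1 \<phi> d))}"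

definition collapse :: "'a cset \<Rightarrow> 'a \<Rightarrow> 'a set cset" where
  "collapse A d = \<lparr>cells = (\<lambda>m. cells A m // edge_rel A d m),
     act = (\<lambda>m n \<phi> c. \<Union>x\<in>c. edge_rel A d m `` {act A m n \<phi> x})\<rparr>"

definition inner_open_box :: "nat \<Rightarrow> nat \<Rightarrow> bool \<Rightarrow> op set cset" where
  "inner_open_box n i e = collapse (open_box n i e) (critical_edge n i e)"

definition inner_cube :: "nat \<Rightarrow> nat \<Rightarrow> bool \<Rightarrow> op set cset" where
  "inner_cube n i e = collapse (cube n) (critical_edge n i e)"

definition inner_open_box_incl :: "nat \<Rightarrow> nat \<Rightarrow> bool \<Rightarrow> (op set, op set) cmap" where
  "inner_open_box_incl n i e = \<lparr>src = inner_open_box n i e, tgt = inner_cube n i e,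
     app = (\<lambda>m. \<lambda>c\<in>cells (inner_open_box n i e) m. edge_rel (cube n) (critical_edge n i e) m `` c)\<rparr>"

definition cubical_quasicategory :: "'a cset \<Rightarrow> bool" where
  "cubical_quasicategory X \<longleftrightarrow> is_cset X \<and>
     (\<forall>n i e. 2 \<le> n \<and> 1 \<le> i \<and> i \<le> n \<longrightarrow>
        lifts (inner_open_box_incl n i e) (to_pt X :: ('a, 'a) cmap))"

definition kan_fibration :: "('a, 'b) cmap \<Rightarrow> bool" where
  "kan_fibration p \<longleftrightarrow> is_cmap p \<and>
     (\<forall>n i e. 1 \<le> n \<and> 1 \<le> i \<and> i \<le> n \<longrightarrow> lifts (open_box_incl n i e) p)"

definition cubical_kan_complex :: "'a cset \<Rightarrow> bool" where
  "cubical_kan_complex X \<longleftrightarrow> is_cset X \<and> kan_fibration (to_pt X :: ('a, 'a) cmap)"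

section \<open>Model structures on the category of cubical sets\<close>

text \<open>A model structure on the category of cubical sets in \<open>'a\<close>, presented by its three classes of
  maps: the weak equivalences satisfy 2-out-of-3, and (cofibrations, trivial fibrations) and
  (trivial cofibrations, fibrations) are weak factorisation systems.\<close>

definition wfs :: "('a, 'a) cmap set \<Rightarrow> ('a, 'a) cmap set \<Rightarrow> bool" where
  "wfs L R \<longleftrightarrow>
     L = {i. is_cmap i \<and> (\<forall>p\<in>R. lifts i p)} \<and>
     R = {p. is_cmap p \<and> (\<forall>i\<in>L. lifts i p)} \<and>
     (\<forall>f. is_cmap f \<longrightarrow> (\<exists>i\<in>L. \<exists>p\<in>R. tgt i = src p \<and> f = p \<odot> i))"

record 'a model =
  cofs :: "('a, 'a) cmap set"
  fibs :: "('a, 'a) cmap set"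
  weqs :: "('a, 'a) cmap set"

definition trivial_fibs :: "'a model \<Rightarrow> ('a, 'a) cmap set" where
  "trivial_fibs M = fibs M \<inter> weqs M"

definition model_structure :: "'a model \<Rightarrow> bool" where
  "model_structure M \<longleftrightarrow>
     weqs M \<subseteq> Collect is_cmap \<and>
     (\<forall>f g. is_cmap f \<and> is_cmap g \<and> tgt f = src g \<longrightarrow>
        (f \<in> weqs M \<and> g \<in> weqs M \<longrightarrow> g \<odot> f \<in> weqs M) \<and>
        (f \<in> weqs M \<and> g \<odot> f \<in> weqs M \<longrightarrow> g \<in> weqs M) \<and>
        (g \<in> weqs M \<and> g \<odot> f \<in> weqs M \<longrightarrow> f \<in> weqs M)) \<and>
     wfs (cofs M) (trivial_fibs M) \<and>
     wfs (cofs M \<inter> weqs M) (fibs M)"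

text \<open>A model structure is determined by its cofibrations together with its fibrant objects,
  hence also by its cofibrations and fibrations; so these predicates characterise at most one \<open>M\<close>.\<close>

definition cubical_joyal :: "'a model \<Rightarrow> bool" where
  "cubical_joyal M \<longleftrightarrow> model_structure M \<and> cofs M = Collect cmono \<and>
     (\<forall>X. is_cset X \<longrightarrow> (to_pt X \<in> fibs M \<longleftrightarrow> cubical_quasicategory X))"

definition grothendieck :: "'a model \<Rightarrow> bool" where
  "grothendieck M \<longleftrightarrow> model_structure M \<and> cofs M = Collect cmono \<and> fibs M = Collect kan_fibration"

section \<open>Mapping spaces\<close>

text \<open>Vertices $\Box^0 \to X$ and cubes $\Box^n \to X$ are identified with elements of
  \<open>cells X 0\<close> and \<open>cells X n\<close> by the Yoneda lemma.\<close>

definition const_vertex :: "'a cset \<Rightarrow> nat \<Rightarrow> 'a \<Rightarrow> 'a" where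
  "const_vertex X n x = act X n 0 (restrict (\<lambda>_. []) (pow1 n)) x"

text \<open>$\phi \times \mathrm{id} \colon [1]^{m+1} \to [1]^{n+1}$ for $\phi \colon [1]^m \to [1]^n$.\<close>

definition op_times_id :: "nat \<Rightarrow> op \<Rightarrow> op" where
  "op_times_id m \<phi> = restrict (\<lambda>xs. \<phi> (butlast xs) @ [last xs]) (pow1 (m + 1))"

definition mapping_space :: "'a cset \<Rightarrow> 'a \<Rightarrow> 'a \<Rightarrow> 'a cset" where
  "mapping_space X x0 x1 = \<lparr>cells = (\<lambda>n. {s \<in> cells X (n + 1).
       act X n (n + 1) (face (n + 1) (n + 1) False) s = const_vertex X n x0 \<and>
       act X n (n + 1) (face (n + 1) (n + 1) True) s = const_vertex X n x1}),
     act = (\<lambda>m n \<phi>. act X (m + 1) (n + 1) (op_times_id m \<phi>))\<rparr>"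

definition mapping_space_map :: "('a, 'b) cmap \<Rightarrow> 'a \<Rightarrow> 'a \<Rightarrow> ('a, 'b) cmap" where
  "mapping_space_map f x0 x1 = \<lparr>src = mapping_space (src f) x0 x1,
     tgt = mapping_space (tgt f) (app f 0 x0) (app f 0 x1),
     app = (\<lambda>n. \<lambda>s\<in>cells (mapping_space (src f) x0 x1) n. app f (n + 1) s)\<rparr>"

end

theory Submission
  imports Defs
begin

text \<open>An open box in $\mathrm{Map}_X(x_0,x_1)$ transposes to an open box in $X$, one dimension higher, with the
  additional faces constant at $x_0$ and $x_1$; its critical edge lies in one of these, so it is an inner open box.
  Hence $f_*$ is a Kan fibration as soon as $f$ lifts against inner open boxes, and boundaries are treated in the
  same way; a map with fillers for boundaries lifts against all monomorphisms since the box category has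
  Eilenberg--Zilber decompositions.

  It remains to see that the inner open box inclusions are trivial cofibrations for every model structure that
  satisfies the characterisation of the cubical Joyal one. By a retract argument it suffices to lift them
  against fibrations $p\colon X\to Y$ between cubical quasicategories. The pairs of a cube $x$ of $X$ and a path
  in $Y$ that starts at $px$ and is constant on vertices form a cubical set $Z$ over $X$. Its projection to $X$ has
  fillers for boundaries because $Y$ has inner fillers, so $X\to Z$ is a trivial cofibration and $p$ has a transport
  $Z\to X$. A filler in $X$ is then moved to the prescribed filler in $Y$ along a path relative to the open box.

  All of this takes place in a fixed universe, which has to be infinite to contain the generating inclusions and $Z$.
  In a finite universe with at least two elements the Grothendieck model structure does not exist.\<close>

text \<open>The defining data say nothing directly about fibrations whose target is not the point,
  and lifting quasicategories against an inner open box is weaker than its inclusion being a trivial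
  cofibration; the path space closes this gap. Two choices shape the construction. The path
  coordinate is the last one, as in the mapping spaces: an open box of dimension n in direction i
  becomes one of dimension n + 1 in the same direction, so the bound 1 for open boxes matches the
  bound 2 for inner ones. The paths are constant on vertices because, in a box that lacks only the
  far end of a path, the critical edge runs in the path direction over a vertex. The
  Eilenberg-Zilber input takes this form: a morphism without constant output coordinates is
  determined by its sections, so distinct such morphisms send a cell of minimal dimension outside a
  sub-cubical set to distinct cells. The only finite universe left is the one-element one, where all
  equations hold and a filling problem is solved as soon as there is a vertex.\<close>

declare One_nat_def [simp del]

section \<open>Morphisms of the box category as functions on Boolean lists\<close>

lemma pow1_iff [simp]: "xs \<in> pow1 n \<longleftrightarrow> length xs = n"
  by (simp add: pow1_def)

lemma box_id_hom [intro, simp]: "box_id n \<in> box_hom n n"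
  by (simp add: box_hom_def box_hom3.ident)

lemma face_hom [intro]: "1 \<le> i \<Longrightarrow> i \<le> n \<Longrightarrow> face n i e \<in> box_hom (n - 1) n"
  by (simp add: box_hom_def box_hom3.face)

lemma degen_hom [intro]: "1 \<le> i \<Longrightarrow> i \<le> n \<Longrightarrow> degen n i \<in> box_hom n (n - 1)"
  by (simp add: box_hom_def box_hom3.degen)

lemma conn_hom [intro]: "1 \<le> i \<Longrightarrow> i < n \<Longrightarrow> conn n i e \<in> box_hom n (n - 1)"
  by (simp add: box_hom_def box_hom3.conn)

lemma comp_hom [intro]:
  "\<phi> \<in> box_hom m n \<Longrightarrow> \<psi> \<in> box_hom k m \<Longrightarrow> compose (pow1 k) \<phi> \<psi> \<in> box_hom k n"
  by (auto simp: box_hom_def intro: box_hom3.comp)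

lemma box_hom_induct [consumes 1, case_names ident face degen conn comp]:
  assumes "\<phi> \<in> box_hom m n"
    and "\<And>n. P n n (box_id n)"
    and "\<And>i n e. 1 \<le> i \<Longrightarrow> i \<le> n \<Longrightarrow> P (n - 1) n (face n i e)"
    and "\<And>i n. 1 \<le> i \<Longrightarrow> i \<le> n \<Longrightarrow> P n (n - 1) (degen n i)"
    and "\<And>i n e. 1 \<le> i \<Longrightarrow> i < n \<Longrightarrow> P n (n - 1) (conn n i e)"
    and "\<And>k m n \<psi> \<phi>. \<psi> \<in> box_hom k m \<Longrightarrow> P k m \<psi> \<Longrightarrow> \<phi> \<in> box_hom m n \<Longrightarrow> P m n \<phi> \<Longrightarrow>
      P k n (compose (pow1 k) \<phi> \<psi>)"
  shows "P m n \<phi>"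
proof -
  have "(m, n, \<phi>) \<in> box_hom3"
    using assms(1) by (simp add: box_hom_def)
  then show ?thesis
    by (induction rule: box_hom3.induct) (use assms(2-) in \<open>auto simp: box_hom_def\<close>)
qed

lemma face_apply: "length xs = n - 1 \<Longrightarrow> face n i e xs = take (i - 1) xs @ e # drop (i - 1) xs"
  by (simp add: face_def)

lemma degen_apply: "length xs = n \<Longrightarrow> degen n i xs = take (i - 1) xs @ drop i xs"
  by (simp add: degen_def)

lemma conn_apply: "length xs = n \<Longrightarrow> conn n i e xs = take (i - 1) xs @
     (if e then min (xs ! (i - 1)) (xs ! i) else max (xs ! (i - 1)) (xs ! i)) # drop (i + 1) xs"
  by (simp add: conn_def)

lemma box_id_apply [simp]: "length xs = n \<Longrightarrow> box_id n xs = xs"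
  by (simp add: box_id_def)

lemma compose_apply [simp]: "length xs = k \<Longrightarrow> compose (pow1 k) \<phi> \<psi> xs = \<phi> (\<psi> xs)"
  by (simp add: compose_def)

lemma box_hom_length: "\<phi> \<in> box_hom m n \<Longrightarrow> length xs = m \<Longrightarrow> length (\<phi> xs) = n"
proof (induction arbitrary: xs rule: box_hom_induct)
  case (comp k m n \<psi> \<phi>) then show ?case by simp
qed (auto simp: face_apply degen_apply conn_apply)

lemma box_hom_ext: "\<phi> \<in> box_hom m n \<Longrightarrow> \<phi> \<in> extensional (pow1 m)"
  by (induction rule: box_hom_induct)
    (simp_all only: box_id_def face_def degen_def conn_def compose_def restrict_extensional)

lemma box_hom_PiE: "\<phi> \<in> box_hom m n \<Longrightarrow> \<phi> \<in> pow1 m \<rightarrow>\<^sub>E pow1 n"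
  by (auto simp: PiE_def box_hom_ext box_hom_length)

lemma finite_pow1: "finite (pow1 n)"
proof -
  have "pow1 n = {xs. set xs \<subseteq> UNIV \<and> length xs = n}" by auto
  then show ?thesis using finite_lists_length_eq[of "UNIV :: bool set" n] by simp
qed

text \<open>Finiteness of the hom sets is what later allows boxes and boundaries to be copied into
  any infinite universe.\<close>

lemma finite_box_hom: "finite (box_hom m n)"
  by (rule finite_subset[OF _ finite_PiE[OF finite_pow1, of _ "\<lambda>_. pow1 n"]])
    (use box_hom_PiE finite_pow1 in blast)+

lemma op_eqI:
  assumes "\<phi> \<in> extensional (pow1 m)" "\<psi> \<in> extensional (pow1 m)"
    and "\<And>xs. length xs = m \<Longrightarrow> \<phi> xs = \<psi> xs"
  shows "\<phi> = \<psi>"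
  by (rule extensionalityI[OF assms(1,2)]) (use assms(3) in auto)

lemma op_nth_eqI:
  assumes "\<phi> \<in> extensional (pow1 m)" "\<psi> \<in> extensional (pow1 m)"
    and "\<And>xs. length xs = m \<Longrightarrow> length (\<phi> xs) = n" "\<And>xs. length xs = m \<Longrightarrow> length (\<psi> xs) = n"
    and "\<And>xs j. length xs = m \<Longrightarrow> j < n \<Longrightarrow> \<phi> xs ! j = \<psi> xs ! j"
  shows "\<phi> = \<psi>"
  by (rule op_eqI[OF assms(1,2)]) (simp add: assms(3-) list_eq_iff_nth_eq)

lemma ext_simps [simp]:
  "compose (pow1 k) \<phi> \<psi> \<in> extensional (pow1 k)"
  "face n i e \<in> extensional (pow1 (n - 1))"
  "degen n i \<in> extensional (pow1 n)"
  "op_times_id m \<phi> \<in> extensional (pow1 (Suc m))"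
  "box_id n \<in> extensional (pow1 n)"
  "critical_edge n i e \<in> extensional (pow1 1)"
  by (simp_all only: compose_def face_def degen_def op_times_id_def box_id_def critical_edge_def
      restrict_extensional Suc_eq_plus1)

lemma face_nth: "length xs = n - 1 \<Longrightarrow> 1 \<le> i \<Longrightarrow> i \<le> n \<Longrightarrow> k < n \<Longrightarrow>
    face n i e xs ! k = (if k < i - 1 then xs ! k else if k = i - 1 then e else xs ! (k - 1))"
  by (auto simp: face_apply nth_append nth_Cons' min_def)

lemma degen_nth: "length xs = n \<Longrightarrow> 1 \<le> i \<Longrightarrow> i \<le> n \<Longrightarrow> k < n - 1 \<Longrightarrow>
    degen n i xs ! k = (if k < i - 1 then xs ! k else xs ! (k + 1))"
  by (auto simp: degen_apply nth_append min_def)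

lemma conn_nth: "length xs = n \<Longrightarrow> 1 \<le> i \<Longrightarrow> i < n \<Longrightarrow> k < n - 1 \<Longrightarrow>
    conn n i e xs ! k = (if k < i - 1 then xs ! k else if k = i - 1 then
      (if e then min (xs ! (i - 1)) (xs ! i) else max (xs ! (i - 1)) (xs ! i)) else xs ! (k + 1))"
  by (auto simp: conn_apply nth_append nth_Cons' min_def)

lemma face_length [simp]: "length xs = n - 1 \<Longrightarrow> 1 \<le> i \<Longrightarrow> i \<le> n \<Longrightarrow> length (face n i e xs) = n"
  by (auto simp: face_apply)

lemma degen_length [simp]: "length xs = n \<Longrightarrow> 1 \<le> i \<Longrightarrow> i \<le> n \<Longrightarrow> length (degen n i xs) = n - 1"
  by (auto simp: degen_apply)

lemma compose_assoc_op:
  assumes "\<psi> \<in> box_hom l k"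
  shows "compose (pow1 l) (compose (pow1 k) \<chi> \<phi>) \<psi> = compose (pow1 l) \<chi> (compose (pow1 l) \<phi> \<psi>)"
  by (rule op_eqI[where m = l]) (auto simp: box_hom_length[OF assms])

lemma compose_id_op:
  assumes "\<phi> \<in> box_hom m n"
  shows "compose (pow1 m) (box_id n) \<phi> = \<phi>" "compose (pow1 m) \<phi> (box_id m) = \<phi>"
  by (auto intro!: op_eqI[where m = m] simp: box_hom_ext[OF assms] box_hom_length[OF assms])

lemma face_hom2: "1 \<le> i \<Longrightarrow> i \<le> n - 1 \<Longrightarrow> face (n - 1) i e \<in> box_hom (n - 2) (n - 1)"
  using face_hom[of i "n - 1" e] by (metis diff_diff_left one_add_one)

lemma degen_face:
  assumes "1 \<le> j" "j \<le> n"
  shows "compose (pow1 (n - 1)) (degen n j) (face n j d) = box_id (n - 1)"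
  by (rule op_eqI[where m = "n - 1"]) (use assms in \<open>auto simp: degen_apply face_apply Suc_diff_le drop_Cons'\<close>)

text \<open>A face is a split monomorphism: the degeneracy that omits the inserted coordinate is a
  retraction.\<close>

lemma face_cancel:
  assumes "1 \<le> j" "j \<le> n" "\<psi> \<in> box_hom m (n - 1)" "\<psi>' \<in> box_hom m (n - 1)"
    and "compose (pow1 m) (face n j d) \<psi> = compose (pow1 m) (face n j d) \<psi>'"
  shows "\<psi> = \<psi>'"
  using compose_assoc_op[OF assms(3), of "degen n j" "face n j d"]
    compose_assoc_op[OF assms(4), of "degen n j" "face n j d"] assms(5)
  by (simp add: degen_face[OF assms(1,2)] compose_id_op[OF assms(3)] compose_id_op[OF assms(4)])

section \<open>Multiplication with an interval\<close>

lemma op_times_id_apply [simp]: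
  "length xs = Suc m \<Longrightarrow> op_times_id m \<phi> xs = \<phi> (butlast xs) @ [last xs]"
  by (simp add: op_times_id_def)

lemma op_times_id_id: "op_times_id n (box_id n) = box_id (Suc n)"
  by (rule op_eqI[where m = "Suc n"]) (auto simp flip: length_greater_0_conv)

lemma op_times_id_comp:
  assumes "\<psi> \<in> box_hom k m"
  shows "op_times_id k (compose (pow1 k) \<phi> \<psi>) =
    compose (pow1 (Suc k)) (op_times_id m \<phi>) (op_times_id k \<psi>)"
  by (rule op_eqI[where m = "Suc k"]) (auto simp: box_hom_length[OF assms])

text \<open>The interval is appended at the end of the list, so generators keep their index under
  the product; this is what makes mapping space operators morphisms again.\<close>

lemma op_times_id_face:
  assumes "1 \<le> i" "i \<le> n"
  shows "op_times_id (n - 1) (face n i e) = face (Suc n) i e"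
proof (rule op_eqI[where m = n])
  fix xs :: "bool list" assume l: "length xs = n"
  then obtain ys y where xs: "xs = ys @ [y]" and "length ys = n - 1"
    using assms by (metis append_butlast_last_id length_butlast list.size(3) not_one_le_zero order_trans)
  then show "op_times_id (n - 1) (face n i e) xs = face (Suc n) i e xs"
    using assms l by (auto simp: face_apply)
qed (use assms in \<open>auto simp: op_times_id_def face_def\<close>)

lemma op_times_id_degen:
  assumes "1 \<le> i" "i \<le> n"
  shows "op_times_id n (degen n i) = degen (Suc n) i"
proof (rule op_eqI[where m = "Suc n"])
  fix xs :: "bool list" assume l: "length xs = Suc n"
  then obtain ys y where xs: "xs = ys @ [y]" and "length ys = n"
    by (metis length_Suc_conv_rev)
  then show "op_times_id n (degen n i) xs = degen (Suc n) i xs"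
    using assms l by (auto simp: degen_apply)
qed auto

lemma op_times_id_conn:
  assumes "1 \<le> i" "i < n"
  shows "op_times_id n (conn n i e) = conn (Suc n) i e"
proof (rule op_eqI[where m = "Suc n"])
  fix xs :: "bool list" assume l: "length xs = Suc n"
  then obtain ys y where xs: "xs = ys @ [y]" and "length ys = n"
    by (metis length_Suc_conv_rev)
  then show "op_times_id n (conn n i e) xs = conn (Suc n) i e xs"
    using assms l by (auto simp: conn_apply nth_append)
qed (auto simp: conn_def)

lemma op_times_id_hom [intro]: "\<phi> \<in> box_hom m n \<Longrightarrow> op_times_id m \<phi> \<in> box_hom (Suc m) (Suc n)"
proof (induction rule: box_hom_induct)
  case (ident n) then show ?case by (simp add: op_times_id_id)
next
  case (face i n e)
  then show ?case using face_hom[of i "Suc n" e] by (simp add: op_times_id_face)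
next
  case (degen i n)
  then show ?case using degen_hom[of i "Suc n"] by (simp add: op_times_id_degen)
next
  case (conn i n e)
  then show ?case using conn_hom[of i "Suc n" e] by (simp add: op_times_id_conn)
next
  case (comp k m n \<psi> \<phi>)
  then show ?case by (auto simp: op_times_id_comp)
qed

text \<open>Operators on the first coordinates do not touch the last one. This naturality is why end
  points of paths are preserved by operators.\<close>

lemma face_last_natural:
  assumes "\<phi> \<in> box_hom m n"
  shows "compose (pow1 m) (op_times_id m \<phi>) (face (Suc m) (Suc m) d) =
    compose (pow1 m) (face (Suc n) (Suc n) d) \<phi>"
  by (rule op_eqI[where m = m]) (auto simp: face_apply box_hom_length[OF assms])

lemma degen_last_natural:
  assumes "\<phi> \<in> box_hom m n"
  shows "compose (pow1 (Suc m)) (degen (Suc n) (Suc n)) (op_times_id m \<phi>) =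
    compose (pow1 (Suc m)) \<phi> (degen (Suc m) (Suc m))"
  by (rule op_eqI[where m = "Suc m"]) (auto simp: degen_apply box_hom_length[OF assms] butlast_conv_take)

lemma degen_last_face:
  "compose (pow1 n) (degen (Suc n) (Suc n)) (face (Suc n) (Suc n) d) = box_id n"
  by (rule op_eqI[where m = n]) (auto simp: degen_apply face_apply)

lemma face_face:
  assumes "1 \<le> j" "j < k" "k \<le> n"
  shows "compose (pow1 (n - 2)) (face n k d') (face (n - 1) j d) =
    compose (pow1 (n - 2)) (face n j d) (face (n - 1) (k - 1) d')"
proof (rule op_eqI[where m = "n - 2"])
  fix xs :: "bool list" assume l: "length xs = n - 2"
  \<comment> \<open>The list is cut at the two places of insertion; both sides become
    \<open>as @ d # bs @ d' # cs\<close>.\<close>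
  define as bs cs where "as = take (j - 1) xs" and "bs = take (k - 1 - j) (drop (j - 1) xs)"
    and "cs = drop (k - 2) xs"
  have "xs = as @ bs @ cs" unfolding as_def bs_def cs_def
    using assms append_take_drop_id[of "k - 1 - j" "drop (j - 1) xs"] by (simp add: numeral_2_eq_2)
  moreover have "j = Suc (length as)" "k = Suc (Suc (length as + length bs))"
    "n = Suc (Suc (length as + length bs + length cs))"
    using assms l by (auto simp: as_def bs_def cs_def min_def)
  ultimately show "compose (pow1 (n - 2)) (face n k d') (face (n - 1) j d) xs =
    compose (pow1 (n - 2)) (face n j d) (face (n - 1) (k - 1) d') xs"
    by (simp add: face_apply)
qed auto

text \<open>The unique morphism to \<open>[1]^0\<close>, which is terminal; it acts by forming the
  iterated degeneracies of a vertex.\<close>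

definition const_op :: "nat \<Rightarrow> op" where
  "const_op n = restrict (\<lambda>_. []) (pow1 n)"

lemma const_op_ext [simp]: "const_op n \<in> extensional (pow1 n)"
  by (simp add: const_op_def)

lemma const_op_apply [simp]: "length xs = n \<Longrightarrow> const_op n xs = []"
  by (simp add: const_op_def)

lemma const_op_hom [intro, simp]: "const_op n \<in> box_hom n 0"
proof (induction n)
  case 0
  have "const_op 0 = box_id 0" by (rule op_eqI[where m = 0]) auto
  then show ?case by simp
next
  case (Suc n)
  have "const_op (Suc n) = compose (pow1 (Suc n)) (const_op n) (degen (Suc n) 1)"
    by (rule op_eqI[where m = "Suc n"]) auto
  moreover have "degen (Suc n) 1 \<in> box_hom (Suc n) n" using degen_hom[of 1 "Suc n"] by simp
  ultimately show ?case using comp_hom[OF Suc] by simp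
qed

lemma const_op_comp: "\<phi> \<in> box_hom m n \<Longrightarrow> compose (pow1 m) (const_op n) \<phi> = const_op m"
  by (rule op_eqI[where m = m]) (auto simp: box_hom_length)

section \<open>Essential variables of a morphism of the box category\<close>

text \<open>Essential dependence in the sense of Boolean functions. Both indices count from 0,
  unlike the indices of the generators.\<close>

definition dep :: "nat \<Rightarrow> op \<Rightarrow> nat \<Rightarrow> nat \<Rightarrow> bool" where
  "dep m \<phi> j a \<longleftrightarrow> a < m \<and> (\<exists>xs. length xs = m \<and> \<phi> (xs[a := True]) ! j \<noteq> \<phi> (xs[a := False]) ! j)"

lemma dep_flip:
  assumes "length xs = m" "\<not> dep m \<phi> j a"
  shows "\<phi> (xs[a := b]) ! j = \<phi> xs ! j"
proof (cases "a < m")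
  case True
  then have e: "\<phi> (xs[a := True]) ! j = \<phi> (xs[a := False]) ! j"
    using assms by (auto simp: dep_def)
  have "xs = xs[a := True] \<or> xs = xs[a := False]"
    by (metis (full_types) list_update_id)
  then show ?thesis using e by (metis (full_types))
next
  case False then show ?thesis using assms by (simp add: list_update_beyond)
qed

lemma dep_agree:
  assumes l: "length xs = m" "length ys = m" and ag: "\<And>a. dep m \<phi> j a \<Longrightarrow> xs ! a = ys ! a"
  shows "\<phi> xs ! j = \<phi> ys ! j"
proof -
  \<comment> \<open>Interpolation: \<open>ys\<close> overwrites \<open>xs\<close> one coordinate at
    a time, and each single change either is void or hits an inessential variable.\<close>
  have "k \<le> m \<Longrightarrow> \<phi> (take k ys @ drop k xs) ! j = \<phi> xs ! j" for k
  proof (induction k)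
    case (Suc k)
    let ?z = "take k ys @ drop k xs"
    have z: "take (Suc k) ys @ drop (Suc k) xs = ?z[k := ys ! k]"
      using Suc l by (intro nth_equalityI) (auto simp: nth_append nth_list_update min_def)
    show ?case
    proof (cases "dep m \<phi> j k")
      case True
      then have "?z[k := ys ! k] = ?z"
        using Suc l ag by (intro nth_equalityI) (auto simp: nth_append nth_list_update min_def)
      then show ?thesis using z Suc by simp
    next
      case False
      then show ?thesis unfolding z using Suc l by (subst dep_flip) auto
    qed
  qed auto
  from this[of m] show ?thesis using l by simp
qed

text \<open>If no intermediate coordinate carried the dependence, flipping \<open>a\<close> would
  change \<open>\<psi>\<close> only in places that output \<open>j\<close> of \<open>\<phi>\<close>
  does not see.\<close>

lemma dep_comp:
  assumes "\<psi> \<in> box_hom k m" "dep k (compose (pow1 k) \<phi> \<psi>) j a"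
  shows "\<exists>b. dep m \<phi> j b \<and> dep k \<psi> b a"
proof (rule ccontr)
  assume *: "\<not> ?thesis"
  obtain xs where xs: "length xs = k" and ne: "\<phi> (\<psi> (xs[a := True])) ! j \<noteq> \<phi> (\<psi> (xs[a := False])) ! j"
    using assms(2) unfolding dep_def by (metis compose_apply length_list_update)
  have "\<phi> (\<psi> (xs[a := True])) ! j = \<phi> (\<psi> (xs[a := False])) ! j"
    by (rule dep_agree[where m = m and \<phi> = \<phi>])
      (use xs * box_hom_length[OF assms(1)] dep_flip[of xs k \<psi> _ a] in auto)
  with ne show False ..
qed

text \<open>The generators contain neither symmetries nor diagonals: each output reads a block of
  inputs, and the blocks are disjoint and in order. Composition keeps this since dependence passes
  through an intermediate coordinate.\<close>

lemma dep_order: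
  assumes "\<phi> \<in> box_hom m n" "dep m \<phi> j a" "dep m \<phi> j' a'" "j < j'" "j' < n"
  shows "a < a'"
  using assms
proof (induction arbitrary: j j' a a' rule: box_hom_induct)
  case (ident n)
  have "dep n (box_id n) j a \<Longrightarrow> j < n \<Longrightarrow> a = j" for j a
    by (auto simp: dep_def nth_list_update split: if_splits)
  then show ?case using ident by (metis order.strict_trans)
next
  case (face i n e)
  have "dep (n - 1) (face n i e) j a \<Longrightarrow> j < n \<Longrightarrow>
      (j < i - 1 \<and> a = j) \<or> (j \<ge> i \<and> a = j - 1)" for j a
    using face.hyps by (auto simp: dep_def face_nth nth_list_update split: if_splits)
  from this[OF face.prems(1)] this[OF face.prems(2)] show ?case using face by auto
next
  case (degen i n)
  have "dep n (degen n i) j a \<Longrightarrow> j < n - 1 \<Longrightarrow> a = (if j < i - 1 then j else j + 1)" for j a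
    using degen.hyps by (auto simp: dep_def degen_nth nth_list_update split: if_splits)
  from this[OF degen.prems(1)] this[OF degen.prems(2)] show ?case using degen by (auto split: if_splits)
next
  case (conn i n e)
  have "dep n (conn n i e) j a \<Longrightarrow> j < n - 1 \<Longrightarrow>
      (j < i - 1 \<and> a = j) \<or> (j = i - 1 \<and> (a = i - 1 \<or> a = i)) \<or> (j > i - 1 \<and> a = j + 1)" for j a
    using conn.hyps by (auto simp: dep_def conn_nth nth_list_update split: if_splits)
  from this[OF conn.prems(1)] this[OF conn.prems(2)] show ?case using conn by auto
next
  case (comp k m n \<psi> \<phi>)
  obtain b where b: "dep m \<phi> j b" "dep k \<psi> b a" using dep_comp[OF comp.hyps(1) comp.prems(1)] by auto
  obtain b' where b': "dep m \<phi> j' b'" "dep k \<psi> b' a'" using dep_comp[OF comp.hyps(1) comp.prems(2)] by auto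
  have "b < b'" using comp.IH(2)[OF b(1) b'(1)] comp.prems by simp
  moreover have "b' < m" using b' by (simp add: dep_def)
  ultimately show ?case using comp.IH(1)[OF b(2) b'(2)] by simp
qed

lemma box_hom_mono:
  assumes "\<phi> \<in> box_hom m n" "length xs = m" "list_all2 (\<le>) xs ys"
  shows "list_all2 (\<le>) (\<phi> xs) (\<phi> ys)"
  using assms
proof (induction arbitrary: xs ys rule: box_hom_induct)
  case (ident n)
  then have "length ys = n" by (auto dest: list_all2_lengthD)
  with ident show ?case by simp
next
  case (face i n e)
  then have "length ys = n - 1" by (auto dest: list_all2_lengthD)
  then show ?case using face
    by (auto simp: face_apply intro!: list_all2_appendI list_all2_takeI list_all2_dropI)
next
  case (degen i n)
  then have "length ys = n" by (auto dest: list_all2_lengthD)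
  then show ?case using degen
    by (auto simp: degen_apply intro!: list_all2_appendI list_all2_takeI list_all2_dropI)
next
  case (conn i n e)
  then have l: "length ys = n" by (auto dest: list_all2_lengthD)
  have "xs ! (i - 1) \<le> ys ! (i - 1)" "xs ! i \<le> ys ! i"
    using conn l by (simp_all add: list_all2_conv_all_nth del: le_bool_def)
  then show ?case using conn l
    by (auto simp: conn_apply min_def max_def intro!: list_all2_appendI list_all2_takeI list_all2_dropI)
next
  case (comp k m n \<psi> \<phi>)
  then have "length ys = k" by (auto dest: list_all2_lengthD)
  with comp show ?case by (simp add: box_hom_length)
qed

text \<open>Morphisms are monotone, so an output that reacts to a flip follows it and never negates
  it.\<close>

lemma dep_witness:
  assumes "\<phi> \<in> box_hom m n" "j < n" "length xs = m" "\<phi> (xs[a := True]) ! j \<noteq> \<phi> (xs[a := False]) ! j"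
  shows "\<phi> (xs[a := b]) ! j = b"
proof -
  have "list_all2 (\<le>) (xs[a := False]) (xs[a := True])"
    unfolding list_all2_conv_all_nth using nth_list_update
    by (metis (full_types) le_boolI' length_list_update nth_list_update_neq)
  from box_hom_mono[OF assms(1) _ this] assms(1-3)
  have "\<phi> (xs[a := False]) ! j \<le> \<phi> (xs[a := True]) ! j"
    by (simp add: box_hom_length list_all2_conv_all_nth)
  then show ?thesis using assms(4) by (cases b) auto
qed

text \<open>The morphisms without constant output coordinates are the split epimorphisms of the box category.\<close>

definition nonconst :: "nat \<Rightarrow> nat \<Rightarrow> op \<Rightarrow> bool" where
  "nonconst m n \<phi> \<longleftrightarrow> (\<forall>j<n. \<exists>a. dep m \<phi> j a)"

lemma nonconstE:
  assumes "nonconst m n \<phi>" "j < n"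
  obtains a xs where "dep m \<phi> j a" "a < m" "length xs = m" "\<phi> (xs[a := True]) ! j \<noteq> \<phi> (xs[a := False]) ! j"
  using assms unfolding nonconst_def dep_def by fast

text \<open>Omitting the constant coordinate is composition with a degeneracy, so the remaining
  factor is a morphism as well.\<close>

lemma coordinate_factor:
  assumes \<phi>: "\<phi> \<in> box_hom m n" and j: "1 \<le> j" "j \<le> n"
    and d: "\<And>xs. length xs = m \<Longrightarrow> \<phi> xs ! (j - 1) = d"
  obtains \<psi> where "\<psi> \<in> box_hom m (n - 1)" "\<phi> = compose (pow1 m) (face n j d) \<psi>"
proof
  let ?\<psi> = "compose (pow1 m) (degen n j) \<phi>"
  show "?\<psi> \<in> box_hom m (n - 1)" by (rule comp_hom[OF degen_hom[OF j] \<phi>])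
  show "\<phi> = compose (pow1 m) (face n j d) ?\<psi>"
  proof (rule op_eqI[where m = m])
    fix xs :: "bool list" assume l: "length xs = m"
    then have L: "length (\<phi> xs) = n" "length (degen n j (\<phi> xs)) = n - 1"
      using box_hom_length[OF \<phi>] j by auto
    show "\<phi> xs = compose (pow1 m) (face n j d) ?\<psi> xs"
      by (rule nth_equalityI) (use l L j d[OF l] in \<open>auto simp: face_nth degen_nth\<close>)
  qed (auto simp: box_hom_ext[OF \<phi>])
qed

text \<open>An output without essential variables is constant, and a constant output splits off as a
  face.\<close>

lemma not_nonconst_factor:
  assumes "\<phi> \<in> box_hom m n" "\<not> nonconst m n \<phi>"
  obtains j d \<psi> where "1 \<le> j" "j \<le> n" "\<psi> \<in> box_hom m (n - 1)" "\<phi> = compose (pow1 m) (face n j d) \<psi>"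
proof -
  obtain j where j: "j < n" "\<And>a. \<not> dep m \<phi> j a" using assms(2) by (auto simp: nonconst_def)
  define d where "d = \<phi> (replicate m False) ! j"
  have d: "\<phi> xs ! j = d" if "length xs = m" for xs
    unfolding d_def by (rule dep_agree[where m = m and \<phi> = \<phi>]) (use that j in auto)
  obtain \<psi> where "\<psi> \<in> box_hom m (n - 1)" "\<phi> = compose (pow1 m) (face n (Suc j) d) \<psi>"
    by (rule coordinate_factor[OF assms(1), of "Suc j" d]) (use j d in auto)
  then show ?thesis using that[of "Suc j" \<psi> d] j by simp
qed

text \<open>Induction on the target dimension: the last coordinate either carries the last input,
  which gives a product with the interval, or is frozen at its value in \<open>x\<close>, which
  gives a last face.\<close>

lemma coordinate_op:
  assumes "\<And>j. j < n \<Longrightarrow> a j < m" "\<And>i j. i < j \<Longrightarrow> j < n \<Longrightarrow> a i < a j" "length x = m"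
  shows "\<exists>s\<in>box_hom n m. \<forall>ys. length ys = n \<longrightarrow>
    (\<forall>j<n. s ys ! a j = ys ! j) \<and> (\<forall>k<m. k \<notin> a ` {..<n} \<longrightarrow> s ys ! k = x ! k)"
  using assms
proof (induction m arbitrary: n x)
  case 0
  then have "n = 0" by fastforce
  then show ?case by (auto intro!: bexI[of _ "box_id 0"])
next
  case (Suc m)
  show ?case
  proof (cases "n > 0 \<and> a (n - 1) = m")
    case True
    then obtain n' where n': "n = Suc n'" "a n' = m" by (metis Suc_pred diff_Suc_1)
    have "\<exists>s\<in>box_hom n' m. \<forall>ys. length ys = n' \<longrightarrow>
      (\<forall>j<n'. s ys ! a j = ys ! j) \<and> (\<forall>k<m. k \<notin> a ` {..<n'} \<longrightarrow> s ys ! k = take m x ! k)"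
      using Suc.prems(3) n' Suc.prems(2)[of _ n'] Suc.prems(2) by (intro Suc.IH) auto
    then obtain s where s: "s \<in> box_hom n' m" and p: "\<And>ys. length ys = n' \<Longrightarrow>
      (\<forall>j<n'. s ys ! a j = ys ! j) \<and> (\<forall>k<m. k \<notin> a ` {..<n'} \<longrightarrow> s ys ! k = take m x ! k)" by blast
    have am: "a j < m" if "j < n'" for j using Suc.prems(2)[of j n'] n' that by simp
    have "(\<forall>j<n. op_times_id n' s ys ! a j = ys ! j) \<and>
        (\<forall>k<Suc m. k \<notin> a ` {..<n} \<longrightarrow> op_times_id n' s ys ! k = x ! k)" if l: "length ys = n" for ys
    proof -
      have b: "length (butlast ys) = n'" using l n' by simp
      have sl: "length (s (butlast ys)) = m" using box_hom_length[OF s b] .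
      have "op_times_id n' s ys ! a j = ys ! j" if "j < n" for j
      proof (cases "j = n'")
        case True then show ?thesis using n' l sl by (simp add: nth_append last_conv_nth flip: length_greater_0_conv)
      next
        case False
        then have "j < n'" using that n' by simp
        then show ?thesis using p[OF b] am n' l sl by (simp add: nth_append nth_butlast)
      qed
      moreover have "op_times_id n' s ys ! k = x ! k" if "k < Suc m" "k \<notin> a ` {..<n}" for k
      proof -
        have "k \<noteq> m" using that n' by auto
        then have "k < m" using that by simp
        moreover have "k \<notin> a ` {..<n'}" using that n' by auto
        ultimately show ?thesis using p[OF b] n' l sl by (simp add: nth_append)
      qed
      ultimately show ?thesis by blast
    qed
    then show ?thesis using op_times_id_hom[OF s] n' by blast
  next
    case False
    have am: "a j < m" if "j < n" for j
    proof (cases "j = n - 1")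
      case True then show ?thesis using False that Suc.prems(1)[OF that] by (auto simp: less_Suc_eq)
    next
      case F: False
      then have "a j < a (n - 1)" using Suc.prems(2) that by simp
      then show ?thesis using Suc.prems(1)[of "n - 1"] that by simp
    qed
    have "\<exists>s\<in>box_hom n m. \<forall>ys. length ys = n \<longrightarrow>
      (\<forall>j<n. s ys ! a j = ys ! j) \<and> (\<forall>k<m. k \<notin> a ` {..<n} \<longrightarrow> s ys ! k = take m x ! k)"
      using Suc.prems am by (intro Suc.IH) auto
    then obtain s where s: "s \<in> box_hom n m" and p: "\<And>ys. length ys = n \<Longrightarrow>
      (\<forall>j<n. s ys ! a j = ys ! j) \<and> (\<forall>k<m. k \<notin> a ` {..<n} \<longrightarrow> s ys ! k = take m x ! k)" by blast
    let ?s = "compose (pow1 n) (face (Suc m) (Suc m) (x ! m)) s"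
    have "(\<forall>j<n. ?s ys ! a j = ys ! j) \<and> (\<forall>k<Suc m. k \<notin> a ` {..<n} \<longrightarrow> ?s ys ! k = x ! k)"
      if l: "length ys = n" for ys
      using p[OF l] am box_hom_length[OF s l] l by (auto simp: face_nth less_Suc_eq)
    moreover have "?s \<in> box_hom n (Suc m)" using comp_hom[OF face_hom[of "Suc m" "Suc m"]] s by simp
    ultimately show ?thesis by blast
  qed
qed

text \<open>The block of essential variables of each output coordinate is fixed so that flipping
  one of them flips the output; the blocks are disjoint and ordered, so this is a morphism.\<close>

lemma section_through:
  assumes \<phi>: "\<phi> \<in> box_hom m n" and nc: "nonconst m n \<phi>"
    and j: "j < n" and a: "a < m" and xs: "length xs = m"
    and ne: "\<phi> (xs[a := True]) ! j \<noteq> \<phi> (xs[a := False]) ! j"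
  obtains s where "s \<in> box_hom n m" "compose (pow1 n) \<phi> s = box_id n"
    "\<And>ys b. length ys = n \<Longrightarrow> dep m \<phi> j b \<Longrightarrow> s ys ! b = xs[a := ys ! j] ! b"
    "\<And>ys c k. length ys = n \<Longrightarrow> k < m \<Longrightarrow> k \<noteq> a \<Longrightarrow> s (ys[j := c]) ! k = s ys ! k"
proof -
  have "\<exists>al. \<forall>i<n. dep m \<phi> i (al i)" using nc unfolding nonconst_def by metis
  then obtain al0 where al0: "\<And>i. i < n \<Longrightarrow> dep m \<phi> i (al0 i)" by blast
  \<comment> \<open>The prescribed variable \<open>a\<close>, and below the prescribed list
    \<open>xs\<close>, are forced for output \<open>j\<close>; for the other outputs any sensitive
    variable and input will do.\<close>
  define al where "al = al0(j := a)"
  have "dep m \<phi> j a" using a xs ne by (auto simp: dep_def)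
  then have al: "dep m \<phi> i (al i)" if "i < n" for i using al0 that by (simp add: al_def)
  have "\<exists>X. \<forall>i<n. length (X i) = m \<and> \<phi> ((X i)[al i := True]) ! i \<noteq> \<phi> ((X i)[al i := False]) ! i"
    using al unfolding dep_def by metis
  then obtain X0 where X0: "\<And>i. i < n \<Longrightarrow>
      length (X0 i) = m \<and> \<phi> ((X0 i)[al i := True]) ! i \<noteq> \<phi> ((X0 i)[al i := False]) ! i" by blast
  define X where "X = X0(j := xs)"
  have X: "length (X i) = m" "\<phi> ((X i)[al i := True]) ! i \<noteq> \<phi> ((X i)[al i := False]) ! i" if "i < n" for i
    using X0[OF that] xs ne by (auto simp: X_def al_def)
  have uniq: "i = i'" if "dep m \<phi> i b" "dep m \<phi> i' b" "i < n" "i' < n" for i i' b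
    using dep_order[OF \<phi>, of i b i' b] dep_order[OF \<phi>, of i' b i b] that by (metis less_irrefl nat_neq_iff)
  define x where "x = map (\<lambda>b. X (THE i. i < n \<and> dep m \<phi> i b) ! b) [0..<m]"
  have x: "x ! b = X i ! b" if "dep m \<phi> i b" "i < n" for i b
  proof -
    have "(THE i. i < n \<and> dep m \<phi> i b) = i" using that uniq by blast
    moreover have "b < m" using that by (simp add: dep_def)
    ultimately show ?thesis by (simp add: x_def)
  qed
  have "\<exists>s\<in>box_hom n m. \<forall>ys. length ys = n \<longrightarrow>
    (\<forall>j<n. s ys ! al j = ys ! j) \<and> (\<forall>k<m. k \<notin> al ` {..<n} \<longrightarrow> s ys ! k = x ! k)"
  proof (rule coordinate_op)
    show "al i < m" if "i < n" for i using al[OF that] by (simp add: dep_def)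
    show "al i < al k" if "i < k" "k < n" for i k
      using dep_order[OF \<phi> al al] that by simp
  qed (simp add: x_def)
  then obtain s where s: "s \<in> box_hom n m" and p: "\<And>ys. length ys = n \<Longrightarrow>
    (\<forall>j<n. s ys ! al j = ys ! j) \<and> (\<forall>k<m. k \<notin> al ` {..<n} \<longrightarrow> s ys ! k = x ! k)" by blast
  have ag: "s ys ! b = (X i)[al i := ys ! i] ! b" if "length ys = n" "i < n" "dep m \<phi> i b" for ys i b
  proof (cases "b = al i")
    case True
    then show ?thesis using that p X al[OF that(2)] by (simp add: dep_def)
  next
    case False
    have "b \<notin> al ` {..<n}" using False that al uniq by (metis imageE lessThan_iff)
    then show ?thesis using False that p x by (simp add: dep_def)
  qed
  have "\<phi> (s ys) ! i = ys ! i" if "length ys = n" "i < n" for ys i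
  proof -
    have "\<phi> (s ys) ! i = \<phi> ((X i)[al i := ys ! i]) ! i"
      by (rule dep_agree[where m = m and \<phi> = \<phi>]) (use ag that X box_hom_length[OF s] in auto)
    also have "\<dots> = ys ! i" by (rule dep_witness[OF \<phi>]) (use X that in auto)
    finally show ?thesis .
  qed
  then have "compose (pow1 n) \<phi> s = box_id n"
    by (intro op_nth_eqI[where m = n and n = n]) (simp_all add: box_hom_length[OF \<phi>] box_hom_length[OF s])
  moreover have "s ys ! b = xs[a := ys ! j] ! b" if "length ys = n" "dep m \<phi> j b" for ys b
    using ag[OF that(1) j that(2)] by (simp add: X_def al_def)
  moreover have "s (ys[j := c]) ! k = s ys ! k" if "length ys = n" "k < m" "k \<noteq> a" for ys c k
  proof (cases "k \<in> al ` {..<n}")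
    case True
    then obtain i where i: "i < n" "k = al i" by auto
    then have "i \<noteq> j" using that by (auto simp: al_def)
    then show ?thesis using p[of ys] p[of "ys[j := c]"] that i by simp
  next
    case False then show ?thesis using p[of ys] p[of "ys[j := c]"] that by simp
  qed
  ultimately show ?thesis using that s by blast
qed

lemma nonconst_section:
  assumes "\<phi> \<in> box_hom m n" "nonconst m n \<phi>"
  obtains s where "s \<in> box_hom n m" "compose (pow1 n) \<phi> s = box_id n"
proof (cases "n = 0")
  case True
  \<comment> \<open>There is no output to run a section through, but any vertex is a section over
    \<open>[1]^0\<close>.\<close>
  obtain s where s: "s \<in> box_hom 0 m"
    using coordinate_op[of 0 id m "replicate m False"] by auto
  have "compose (pow1 n) \<phi> s = box_id n"
    using True box_hom_length[OF assms(1)] box_hom_length[OF s]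
    by (intro op_eqI[where m = n]) auto
  then show ?thesis using that s True by blast
next
  case False
  then have n: "0 < n" by simp
  obtain a xs where ax: "a < m" "length xs = m" "\<phi> (xs[a := True]) ! 0 \<noteq> \<phi> (xs[a := False]) ! 0"
    using nonconstE[OF assms(2) n] .
  show ?thesis by (rule section_through[OF assms n ax]) (rule that)
qed

lemma critical_edge_nth: "length xs = 1 \<Longrightarrow> k < n \<Longrightarrow> critical_edge n i e xs ! k = (if k = i - 1 then hd xs else \<not> e)"
  by (simp add: critical_edge_def nth_list_update)

lemma critical_edge_hom:
  assumes "1 \<le> i" "i \<le> n"
  shows "critical_edge n i e \<in> box_hom 1 n"
proof -
  have im: "(\<lambda>_. i - 1) ` {..<1 :: nat} = {i - 1}" by auto
  have "i - 1 < n" using assms by simp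
  then have "\<exists>s\<in>box_hom 1 n. \<forall>ys. length ys = 1 \<longrightarrow>
    s ys ! (i - 1) = ys ! 0 \<and> (\<forall>k<n. k \<noteq> i - 1 \<longrightarrow> s ys ! k = (\<not> e))"
    using coordinate_op[of 1 "\<lambda>_. i - 1" n "replicate n (\<not> e)"] unfolding im by simp
  then obtain s where s: "s \<in> box_hom 1 n" and p: "\<And>ys. length ys = 1 \<Longrightarrow>
    s ys ! (i - 1) = ys ! 0 \<and> (\<forall>k<n. k \<noteq> i - 1 \<longrightarrow> s ys ! k = (\<not> e))"
    by blast
  have "critical_edge n i e = s"
  proof (rule op_nth_eqI[where m = 1 and n = n])
    show "critical_edge n i e xs ! k = s xs ! k" if "length xs = 1" "k < n" for xs k
      using p[OF that(1)] that by (cases xs) (auto simp: critical_edge_nth)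
  qed (simp_all add: box_hom_ext[OF s] box_hom_length[OF s], simp add: critical_edge_def)
  with s show ?thesis by simp
qed

text \<open>Among \<open>n\<close> inputs, \<open>n\<close> nonempty disjoint blocks in increasing
  order must be singletons, and by monotonicity each output equals its only variable.\<close>

lemma nonconst_endo:
  assumes \<phi>: "\<phi> \<in> box_hom n n" and nc: "nonconst n n \<phi>"
  shows "\<phi> = box_id n"
proof -
  have ge: "j \<le> a" if "dep n \<phi> j a" "j < n" for j a
    using that
  proof (induction j arbitrary: a)
    case (Suc j)
    obtain b where b: "dep n \<phi> j b" using nonconstE[OF nc Suc_lessD[OF Suc.prems(2)]] .
    then show ?case using dep_order[OF \<phi> b Suc.prems(1)] Suc.prems Suc.IH[OF b] by simp
  qed simp
  have le: "a \<le> j" if "dep n \<phi> j a" "j < n" for j a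
    using that
  proof (induction "n - j" arbitrary: j a)
    case 0 then show ?case by simp
  next
    case (Suc k)
    show ?case
    proof (cases "Suc j = n")
      case True then show ?thesis using Suc.prems by (auto simp: dep_def)
    next
      case False
      then have "Suc j < n" using Suc.prems by simp
      then obtain b where b: "dep n \<phi> (Suc j) b" using nonconstE[OF nc] by blast
      then have "a < b" using dep_order[OF \<phi> Suc.prems(1) b] \<open>Suc j < n\<close> by simp
      moreover have "b \<le> Suc j" using Suc.hyps(1)[of "Suc j" b] Suc.hyps(2) b \<open>Suc j < n\<close> by simp
      ultimately show ?thesis by simp
    qed
  qed
  have "\<phi> xs ! j = xs ! j" if xs: "length xs = n" and j: "j < n" for xs j
  proof -
    obtain a zs where d: "dep n \<phi> j a" and z: "length zs = n" "\<phi> (zs[a := True]) ! j \<noteq> \<phi> (zs[a := False]) ! j"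
      using nonconstE[OF nc j] .
    have "a = j" using ge[OF d j] le[OF d j] by simp
    have "\<phi> xs ! j = \<phi> (zs[j := xs ! j]) ! j"
      by (rule dep_agree[where m = n and \<phi> = \<phi>]) (simp_all add: xs z, metis ge le j xs z(1) le_antisym nth_list_update_eq)
    also have "\<dots> = xs ! j" using dep_witness[OF \<phi> j z] \<open>a = j\<close> by simp
    finally show ?thesis .
  qed
  then show ?thesis
    by (intro op_nth_eqI[where m = n and n = n]) (simp_all add: box_hom_ext[OF \<phi>] box_hom_length[OF \<phi>])
qed

text \<open>Sections detect a split epimorphism of the box category: first its essential variables,
  then its values at sensitive inputs; all other inputs are reached from a sensitive one by single
  flips.\<close>

lemma nonconst_eqI:
  assumes \<phi>: "\<phi> \<in> box_hom m n" "nonconst m n \<phi>" and \<phi>': "\<phi>' \<in> box_hom m n" "nonconst m n \<phi>'"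
    and sec: "\<And>s. s \<in> box_hom n m \<Longrightarrow> compose (pow1 n) \<phi> s = box_id n \<longleftrightarrow> compose (pow1 n) \<phi>' s = box_id n"
  shows "\<phi> = \<phi>'"
proof -
  \<comment> \<open>A section of \<open>\<phi>\<close> whose \<open>j\<close>-th input can move only
    position \<open>a\<close> is also a section of \<open>\<phi>'\<close>; if \<open>\<phi>'\<close>
    ignored \<open>a\<close>, it could not recover that input.\<close>
  have dep_le: "dep m \<phi>' j a"
    if \<phi>: "\<phi> \<in> box_hom m n" "nonconst m n \<phi>" and \<phi>': "\<phi>' \<in> box_hom m n" "nonconst m n \<phi>'"
      and sec: "\<And>s. s \<in> box_hom n m \<Longrightarrow> compose (pow1 n) \<phi> s = box_id n \<Longrightarrow> compose (pow1 n) \<phi>' s = box_id n"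
      and j: "j < n" and d: "dep m \<phi> j a" for \<phi> \<phi>' j a
  proof -
    obtain xs where xs: "a < m" "length xs = m" "\<phi> (xs[a := True]) ! j \<noteq> \<phi> (xs[a := False]) ! j"
      using d by (auto simp: dep_def)
    obtain s where s: "s \<in> box_hom n m" "compose (pow1 n) \<phi> s = box_id n"
      "\<And>ys c k. length ys = n \<Longrightarrow> k < m \<Longrightarrow> k \<noteq> a \<Longrightarrow> s (ys[j := c]) ! k = s ys ! k"
      by (rule section_through[OF \<phi> j xs]) blast
    let ?ys = "replicate n False"
    have e: "\<phi>' (s ys) = ys" if "length ys = n" for ys
      using fun_cong[OF sec[OF s(1,2)], of ys] that by simp
    show ?thesis
    proof (rule ccontr)
      assume nd: "\<not> dep m \<phi>' j a"
      have "\<phi>' (s (?ys[j := True])) ! j = \<phi>' (s ?ys) ! j"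
        by (rule dep_agree[where m = m and \<phi> = \<phi>'])
          (use nd s(3)[of ?ys] box_hom_length[OF s(1)] in \<open>auto simp: dep_def\<close>)
      then show False using j by (simp add: e)
    qed
  qed
  have dep_eq: "dep m \<phi> j a \<longleftrightarrow> dep m \<phi>' j a" if "j < n" for j a
    using dep_le[OF \<phi> \<phi>' _ that] dep_le[OF \<phi>' \<phi> _ that] sec by blast
  \<comment> \<open>The section is chosen to pass through \<open>xs[a := b]\<close> on all essential
    variables of output \<open>j\<close>, so both morphisms return \<open>b\<close> there.\<close>
  have agree: "\<phi>' (xs[a := b]) ! j = \<phi> (xs[a := b]) ! j"
    if \<phi>: "\<phi> \<in> box_hom m n" "nonconst m n \<phi>" and \<phi>': "\<phi>' \<in> box_hom m n"
      and sec: "\<And>s. s \<in> box_hom n m \<Longrightarrow> compose (pow1 n) \<phi> s = box_id n \<Longrightarrow> compose (pow1 n) \<phi>' s = box_id n"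
      and dep_eq: "\<And>a. dep m \<phi> j a \<longleftrightarrow> dep m \<phi>' j a"
      and j: "j < n" and xs: "a < m" "length xs = m" "\<phi> (xs[a := True]) ! j \<noteq> \<phi> (xs[a := False]) ! j"
    for \<phi> \<phi>' j a b xs
  proof -
    obtain s where s: "s \<in> box_hom n m" "compose (pow1 n) \<phi> s = box_id n"
      "\<And>ys b. length ys = n \<Longrightarrow> dep m \<phi> j b \<Longrightarrow> s ys ! b = xs[a := ys ! j] ! b"
      by (rule section_through[OF \<phi> j xs]) blast
    let ?ys = "replicate n b"
    have e: "\<phi>' (s ?ys) = ?ys"
      using fun_cong[OF sec[OF s(1,2)], of ?ys] by simp
    have "\<phi>' (xs[a := b]) ! j = \<phi>' (s ?ys) ! j"
      by (rule dep_agree[where m = m and \<phi> = \<phi>'])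
        (use s(3)[of ?ys] box_hom_length[OF s(1)] dep_eq xs j in auto)
    then show ?thesis using dep_witness[OF \<phi>(1) j xs(2,3)] e j by simp
  qed
  \<comment> \<open>Agreement survives a flip: if one of the two outputs is sensitive to it,
    \<open>agree\<close> applies; otherwise neither value changes.\<close>
  have step: "\<phi>' (xs[a := b]) ! j = \<phi> (xs[a := b]) ! j"
    if j: "j < n" and xs: "a < m" "length xs = m" and eq: "\<phi>' xs ! j = \<phi> xs ! j" for j a b xs
  proof (cases "\<phi> (xs[a := True]) ! j \<noteq> \<phi> (xs[a := False]) ! j")
    case True
    show ?thesis by (rule agree[OF \<phi> \<phi>'(1)]) (use sec dep_eq j xs True in auto)
  next
    case F: False
    show ?thesis
    proof (cases "\<phi>' (xs[a := True]) ! j \<noteq> \<phi>' (xs[a := False]) ! j")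
      case True
      show ?thesis by (rule agree[OF \<phi>' \<phi>(1), symmetric]) (use sec dep_eq j xs True in auto)
    next
      case False
      have "xs = xs[a := True] \<or> xs = xs[a := False]" by (metis (full_types) list_update_id)
      then show ?thesis using F False eq by (metis (full_types))
    qed
  qed
  have "\<phi>' xs ! j = \<phi> xs ! j" if j: "j < n" and xs: "length xs = m" for j xs
  proof -
    obtain a zs where z: "a < m" "length zs = m" "\<phi> (zs[a := True]) ! j \<noteq> \<phi> (zs[a := False]) ! j"
      using nonconstE[OF \<phi>(2) j] .
    have 0: "\<phi>' (zs[a := True]) ! j = \<phi> (zs[a := True]) ! j"
      by (rule agree[OF \<phi> \<phi>'(1)]) (use sec dep_eq j z in auto)
    \<comment> \<open>Starting from this input, where agreement is known, the coordinates are
      overwritten one at a time until \<open>xs\<close> is reached.\<close>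
    let ?z = "zs[a := True]"
    have "k \<le> m \<Longrightarrow> \<phi>' (take k xs @ drop k ?z) ! j = \<phi> (take k xs @ drop k ?z) ! j" for k
    proof (induction k)
      case (Suc k)
      have "take (Suc k) xs @ drop (Suc k) ?z = (take k xs @ drop k ?z)[k := xs ! k]"
        using Suc xs z(2) by (intro nth_equalityI) (auto simp: nth_append nth_list_update min_def)
      then show ?case using step[OF j, of k "take k xs @ drop k ?z" "xs ! k"] Suc xs z(2) by simp
    qed (use 0 in auto)
    from this[of m] show ?thesis using xs z by simp
  qed
  then show ?thesis
    by (intro op_nth_eqI[where m = m and n = n])
      (simp_all add: box_hom_ext[OF \<phi>(1)] box_hom_ext[OF \<phi>'(1)] box_hom_length[OF \<phi>(1)] box_hom_length[OF \<phi>'(1)])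
qed

section \<open>Cubical sets and their maps\<close>

lemma cset_act: "is_cset X \<Longrightarrow> \<phi> \<in> box_hom m n \<Longrightarrow> x \<in> cells X n \<Longrightarrow> act X m n \<phi> x \<in> cells X m"
  by (simp add: is_cset_def)

lemma cset_id [simp]: "is_cset X \<Longrightarrow> x \<in> cells X n \<Longrightarrow> act X n n (box_id n) x = x"
  by (simp add: is_cset_def)

lemma cset_comp: "is_cset X \<Longrightarrow> \<psi> \<in> box_hom k m \<Longrightarrow> \<phi> \<in> box_hom m n \<Longrightarrow> x \<in> cells X n \<Longrightarrow>
    act X k m \<psi> (act X m n \<phi> x) = act X k n (compose (pow1 k) \<phi> \<psi>) x"
  by (simp add: is_cset_def)

lemma cmap_src [simp]: "is_cmap f \<Longrightarrow> is_cset (src f)"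
  and cmap_tgt [simp]: "is_cmap f \<Longrightarrow> is_cset (tgt f)"
  by (simp_all add: is_cmap_def)

lemma cmap_PiE: "is_cmap f \<Longrightarrow> app f n \<in> cells (src f) n \<rightarrow>\<^sub>E cells (tgt f) n"
  unfolding is_cmap_def by blast

lemma cmap_app: "is_cmap f \<Longrightarrow> x \<in> cells (src f) n \<Longrightarrow> app f n x \<in> cells (tgt f) n"
  by (rule PiE_mem[OF cmap_PiE])

lemma cmap_ext: "is_cmap f \<Longrightarrow> app f n \<in> extensional (cells (src f) n)"
  using cmap_PiE[of f n] by (simp add: PiE_iff)

lemma cmap_nat: "is_cmap f \<Longrightarrow> \<phi> \<in> box_hom m n \<Longrightarrow> x \<in> cells (src f) n \<Longrightarrow>
    app f m (act (src f) m n \<phi> x) = act (tgt f) m n \<phi> (app f n x)"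
  unfolding is_cmap_def by blast

lemma cmap_eqI:
  assumes "is_cmap f" "is_cmap g" "src f = src g" "tgt f = tgt g"
    and "\<And>n x. x \<in> cells (src f) n \<Longrightarrow> app f n x = app g n x"
  shows "f = g"
proof -
  have "app f n = app g n" for n
    by (rule extensionalityI[where A = "cells (src f) n"]) (use assms cmap_ext in metis)+
  then have "app f = app g" by (rule ext)
  then show ?thesis using assms(3,4) by simp
qed

lemma comp_sel [simp]: "src (g \<odot> f) = src f" "tgt (g \<odot> f) = tgt g"
  "x \<in> cells (src f) n \<Longrightarrow> app (g \<odot> f) n x = app g n (app f n x)"
  by (simp_all add: cmap_comp_def compose_def)

lemma cmapI:
  assumes "is_cset X" "is_cset Y"
    and "\<And>n x. x \<in> cells X n \<Longrightarrow> F n x \<in> cells Y n"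
    and "\<And>m n \<phi> x. \<phi> \<in> box_hom m n \<Longrightarrow> x \<in> cells X n \<Longrightarrow> F m (act X m n \<phi> x) = act Y m n \<phi> (F n x)"
  shows "is_cmap \<lparr>src = X, tgt = Y, app = (\<lambda>n. restrict (F n) (cells X n))\<rparr>"
  unfolding is_cmap_def using assms(1,2) by (simp add: assms(3,4) cset_act[OF assms(1)])

lemma cmap_exE:
  assumes "is_cset X" "is_cset Y"
    and "\<And>n x. x \<in> cells X n \<Longrightarrow> F n x \<in> cells Y n"
    and "\<And>m n \<phi> x. \<phi> \<in> box_hom m n \<Longrightarrow> x \<in> cells X n \<Longrightarrow> F m (act X m n \<phi> x) = act Y m n \<phi> (F n x)"
  obtains f where "is_cmap f" "src f = X" "tgt f = Y" "\<And>n x. x \<in> cells X n \<Longrightarrow> app f n x = F n x"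
  using that[OF cmapI[of X Y F, OF assms]] by simp

lemma comp_cmap:
  assumes "is_cmap f" "is_cmap g" "tgt f = src g"
  shows "is_cmap (g \<odot> f)"
  unfolding cmap_comp_def compose_def
proof (intro cmapI)
  fix m n \<phi> x assume x: "\<phi> \<in> box_hom m n" "x \<in> cells (src f) n"
  then have "app f n x \<in> cells (src g) n" using cmap_app[OF assms(1)] assms(3) by metis
  with x show "app g m (app f m (act (src f) m n \<phi> x)) = act (tgt g) m n \<phi> (app g n (app f n x))"
    using cmap_nat[OF assms(1)] cmap_nat[OF assms(2)] assms(3) by metis
qed (use assms(1,2) in \<open>simp_all add: assms(3)[symmetric] cmap_app\<close>)

lemma comp_assoc:
  assumes "is_cmap f" "is_cmap g" "is_cmap h" "tgt f = src g" "tgt g = src h"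
  shows "h \<odot> (g \<odot> f) = (h \<odot> g) \<odot> f"
  using assms(1-3)
  by (intro cmap_eqI comp_cmap) (simp_all add: assms(4,5)[symmetric] cmap_app)

definition idm :: "'a cset \<Rightarrow> ('a, 'a) cmap" where
  "idm X = \<lparr>src = X, tgt = X, app = (\<lambda>n. restrict (\<lambda>x. x) (cells X n))\<rparr>"

lemma idm_sel [simp]: "src (idm X) = X" "tgt (idm X) = X" "x \<in> cells X n \<Longrightarrow> app (idm X) n x = x"
  by (simp_all add: idm_def)

lemma idm_cmap [simp]: "is_cset X \<Longrightarrow> is_cmap (idm X)"
  unfolding idm_def by (rule cmapI) auto

lemma idm_comp [simp]:
  assumes "is_cmap f"
  shows "tgt f = X \<Longrightarrow> idm X \<odot> f = f" "src f = X \<Longrightarrow> f \<odot> idm X = f"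
  using assms by (auto intro!: cmap_eqI comp_cmap simp: cmap_app)

lemma liftsE:
  assumes "lifts i p" "is_cmap u" "src u = src i" "tgt u = src p"
    "is_cmap v" "src v = tgt i" "tgt v = tgt p" "p \<odot> u = v \<odot> i"
  obtains h where "is_cmap h" "src h = tgt i" "tgt h = src p" "h \<odot> i = u" "p \<odot> h = v"
  using assms unfolding lifts_def by blast

lemma square_app:
  assumes "p \<odot> u = v \<odot> i" "src u = src i" "x \<in> cells (src i) n"
  shows "app p n (app u n x) = app v n (app i n x)"
  using fun_cong[OF fun_cong[OF arg_cong[OF assms(1), of app]], of n x] assms(2,3) by simp

section \<open>Cells that are minimal outside a sub-cubical set\<close>

text \<open>\<open>A\<close> stands for a sub-cubical set, given by closure under operators. It will
  be the domain of a partial lift and, in finite universes, the collection of constant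
  cells.\<close>

locale minimal_cell =
  fixes X :: "'a cset" and A :: "nat \<Rightarrow> 'a set" and n :: nat and b :: 'a
  assumes X: "is_cset X"
    and closed: "\<And>m n \<phi> x. \<phi> \<in> box_hom m n \<Longrightarrow> x \<in> A n \<Longrightarrow> act X m n \<phi> x \<in> A m"
    and b: "b \<in> cells X n" "b \<notin> A n"
    and faces: "\<And>j d. 1 \<le> j \<Longrightarrow> j \<le> n \<Longrightarrow> act X (n - 1) n (face n j d) b \<in> A (n - 1)"
begin

lemma degenerate_mem: "act X m n \<phi> b \<in> A m" if \<phi>: "\<phi> \<in> box_hom m n" "\<not> nonconst m n \<phi>"
proof -
  obtain j d \<psi> where j: "1 \<le> j" "j \<le> n" and \<psi>: "\<psi> \<in> box_hom m (n - 1)" "\<phi> = compose (pow1 m) (face n j d) \<psi>"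
    by (rule not_nonconst_factor[OF \<phi>])
  then have "act X m n \<phi> b = act X m (n - 1) \<psi> (act X (n - 1) n (face n j d) b)"
    using cset_comp[OF X \<psi>(1) face_hom[OF j] b(1)] by simp
  then show ?thesis using closed[OF \<psi>(1) faces[OF j]] by simp
qed

text \<open>A section recovers \<open>b\<close> from its image under \<open>\<phi>\<close>, and
  \<open>A\<close> is closed under operators.\<close>

lemma nonconst_notmem: "act X m n \<phi> b \<notin> A m" if \<phi>: "\<phi> \<in> box_hom m n" "nonconst m n \<phi>"
proof
  assume *: "act X m n \<phi> b \<in> A m"
  obtain s where s: "s \<in> box_hom n m" "compose (pow1 n) \<phi> s = box_id n" by (rule nonconst_section[OF \<phi>])
  have "act X n m s (act X m n \<phi> b) = b" using cset_comp[OF X s(1) \<phi>(1) b(1)] s(2) X b by simp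
  then show False using closed[OF s(1) *] b by simp
qed

text \<open>If both operators agree on \<open>b\<close>, a section of one composes with the other to
  an endomorphism fixing \<open>b\<close>. As \<open>b\<close> is outside \<open>A\<close>, that
  endomorphism has no constant output and is the identity; hence both have the same
  sections.\<close>

lemma nonconst_inj:
  assumes \<phi>: "\<phi> \<in> box_hom m n" "nonconst m n \<phi>" and \<phi>': "\<phi>' \<in> box_hom m n" "nonconst m n \<phi>'"
    and eq: "act X m n \<phi> b = act X m n \<phi>' b"
  shows "\<phi> = \<phi>'"
proof -
  have *: "compose (pow1 n) \<phi>' s = box_id n"
    if \<phi>: "\<phi> \<in> box_hom m n" and \<phi>': "\<phi>' \<in> box_hom m n" and eq: "act X m n \<phi> b = act X m n \<phi>' b"
      and s: "s \<in> box_hom n m" "compose (pow1 n) \<phi> s = box_id n" for \<phi> \<phi>' s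
  proof -
    have h: "compose (pow1 n) \<phi>' s \<in> box_hom n n" using \<phi>' s by blast
    have "act X n n (compose (pow1 n) \<phi>' s) b = b"
      using cset_comp[OF X s(1) \<phi> b(1)] cset_comp[OF X s(1) \<phi>' b(1)] s(2) X b eq by simp
    then have "nonconst n n (compose (pow1 n) \<phi>' s)" using degenerate_mem[OF h] b(2) by auto
    then show ?thesis using nonconst_endo h by blast
  qed
  show ?thesis by (rule nonconst_eqI[OF \<phi> \<phi>']) (use * \<phi> \<phi>' eq in metis)
qed

end

section \<open>Filling compatible families of faces\<close>

definition all_faces :: "nat \<Rightarrow> (nat \<times> bool) set" where
  "all_faces n = {1..n} \<times> UNIV"

text \<open>The cubical identity for two faces in different directions. Opposite faces are disjoint,
  so equal directions impose no condition.\<close>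

definition compat :: "'a cset \<Rightarrow> nat \<Rightarrow> (nat \<times> bool) set \<Rightarrow> (nat \<Rightarrow> bool \<Rightarrow> 'a) \<Rightarrow> bool" where
  "compat X n S x \<longleftrightarrow> (\<forall>j d. (j, d) \<in> S \<longrightarrow> x j d \<in> cells X (n - 1)) \<and>
     (\<forall>j d k d'. (j, d) \<in> S \<and> (k, d') \<in> S \<and> j < k \<longrightarrow>
        act X (n - 2) (n - 1) (face (n - 1) j d) (x k d') =
        act X (n - 2) (n - 1) (face (n - 1) (k - 1) d') (x j d))"

definition has_faces :: "'a cset \<Rightarrow> nat \<Rightarrow> (nat \<times> bool) set \<Rightarrow> (nat \<Rightarrow> bool \<Rightarrow> 'a) \<Rightarrow> 'a \<Rightarrow> bool" where
  "has_faces X n S x z \<longleftrightarrow> z \<in> cells X n \<and> (\<forall>j d. (j, d) \<in> S \<longrightarrow> act X (n - 1) n (face n j d) z = x j d)"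

text \<open>The lifting problem expressed by cells instead of maps out of a box. The side condition
  \<open>C\<close> restricts the admissible data; it serves to demand a degenerate critical
  edge.\<close>

definition fills :: "('a, 'b) cmap \<Rightarrow> nat \<Rightarrow> (nat \<times> bool) set \<Rightarrow> ((nat \<Rightarrow> bool \<Rightarrow> 'a) \<Rightarrow> bool) \<Rightarrow> bool" where
  "fills p n S C \<longleftrightarrow> (\<forall>x y. compat (src p) n S x \<and> has_faces (tgt p) n S (\<lambda>j d. app p (n - 1) (x j d)) y \<and> C x \<longrightarrow>
     (\<exists>z. has_faces (src p) n S x z \<and> app p n z = y))"

lemma compat_cells: "compat X n S x \<Longrightarrow> (j, d) \<in> S \<Longrightarrow> x j d \<in> cells X (n - 1)"
  by (simp add: compat_def)

lemma has_faces_cell: "has_faces X n S x z \<Longrightarrow> z \<in> cells X n"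
  by (simp add: has_faces_def)

lemma has_faces_face: "has_faces X n S x z \<Longrightarrow> (j, d) \<in> S \<Longrightarrow> act X (n - 1) n (face n j d) z = x j d"
  by (simp add: has_faces_def)

lemma faces_compat:
  assumes X: "is_cset X" and z: "z \<in> cells X n" and jk: "1 \<le> j" "j < k" "k \<le> n"
  shows "act X (n - 2) (n - 1) (face (n - 1) j d) (act X (n - 1) n (face n k d') z) =
        act X (n - 2) (n - 1) (face (n - 1) (k - 1) d') (act X (n - 1) n (face n j d) z)"
proof -
  have "face (n - 1) j d \<in> box_hom (n - 2) (n - 1)" "face (n - 1) (k - 1) d' \<in> box_hom (n - 2) (n - 1)"
    using jk by (auto intro!: face_hom2)
  then show ?thesis
    using face_face[OF jk, of d' d] cset_comp[OF X _ face_hom z, of _ "n - 2"] jk by simp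
qed

section \<open>Filling boundaries implies lifting against monomorphisms\<close>

text \<open>A partial lift is encoded by its graph, a sub-cubical set of the product; a maximal one exists
  by Zorn's lemma, and it is extended along a cell of minimal dimension outside its domain.\<close>

theorem lifts_mono:
  fixes p :: "('a, 'b) cmap" and i :: "('c, 'd) cmap"
  assumes p: "is_cmap p" and fill: "\<And>n. fills p n (all_faces n) (\<lambda>_. True)" and i: "cmono i"
  shows "lifts i p"
  unfolding lifts_def
proof (intro allI impI, elim conjE)
  fix u :: "('c, 'a) cmap" and v :: "('d, 'b) cmap"
  assume u: "is_cmap u" "src u = src i" "tgt u = src p"
    and v: "is_cmap v" "src v = tgt i" "tgt v = tgt p" and sq: "p \<odot> u = v \<odot> i"
  have ic: "is_cmap i" and inj: "\<And>n a a'. a \<in> cells (src i) n \<Longrightarrow> a' \<in> cells (src i) n \<Longrightarrow> app i n a = app i n a' \<Longrightarrow> a = a'"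
    using i by (auto simp: cmono_def inj_on_def)
  define good where "good R \<longleftrightarrow>
    (\<forall>n b x. (n, b, x) \<in> R \<longrightarrow> b \<in> cells (tgt i) n \<and> x \<in> cells (src p) n \<and> app p n x = app v n b) \<and>
    (\<forall>m n \<phi> b x. \<phi> \<in> box_hom m n \<and> (n, b, x) \<in> R \<longrightarrow> (m, act (tgt i) m n \<phi> b, act (src p) m n \<phi> x) \<in> R) \<and>
    (\<forall>n b x x'. (n, b, x) \<in> R \<and> (n, b, x') \<in> R \<longrightarrow> x = x') \<and>
    (\<forall>n a. a \<in> cells (src i) n \<longrightarrow> (n, app i n a, app u n a) \<in> R)" for R
  have g1: "b \<in> cells (tgt i) n" "x \<in> cells (src p) n" "app p n x = app v n b" if "good R" "(n, b, x) \<in> R" for R n b x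
    using that unfolding good_def by blast+
  have g2: "(m, act (tgt i) m n \<phi> b, act (src p) m n \<phi> x) \<in> R" if "good R" "\<phi> \<in> box_hom m n" "(n, b, x) \<in> R" for R m n \<phi> b x
    using that unfolding good_def by blast
  have g3: "x = x'" if "good R" "(n, b, x) \<in> R" "(n, b, x') \<in> R" for R n b x x'
    using that unfolding good_def by blast
  have g4: "(n, app i n a, app u n a) \<in> R" if "good R" "a \<in> cells (src i) n" for R n a
    using that unfolding good_def by blast
  \<comment> \<open>The graph of \<open>u\<close> along \<open>i\<close> is single-valued because
    \<open>i\<close> is injective.\<close>
  have "good {(n, app i n a, app u n a) | n a. a \<in> cells (src i) n}"
    unfolding good_def
  proof (intro conjI allI impI)
    fix m n \<phi> b x
    assume "\<phi> \<in> box_hom m n \<and> (n, b, x) \<in> {(n, app i n a, app u n a) | n a. a \<in> cells (src i) n}"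
    then obtain a where \<phi>: "\<phi> \<in> box_hom m n" and a: "a \<in> cells (src i) n" and bx: "b = app i n a" "x = app u n a" by blast
    have "act (tgt i) m n \<phi> b = app i m (act (src i) m n \<phi> a)"
      "act (src p) m n \<phi> x = app u m (act (src i) m n \<phi> a)"
      using cmap_nat[OF ic \<phi> a] cmap_nat[OF u(1) \<phi>] a u bx by simp_all
    moreover have "act (src i) m n \<phi> a \<in> cells (src i) m" using cset_act[OF cmap_src[OF ic] \<phi> a] .
    ultimately show "(m, act (tgt i) m n \<phi> b, act (src p) m n \<phi> x) \<in> {(n, app i n a, app u n a) | n a. a \<in> cells (src i) n}"
      by blast
  qed (use cmap_app[OF ic] cmap_app[OF u(1)] u(2,3) square_app[OF sq u(2)] in \<open>auto dest: inj\<close>)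
  then have ne: "{R. good R} \<noteq> {}" by blast
  have chain: "\<Union>C \<in> {R. good R}" if C: "C \<noteq> {}" "subset.chain {R. good R} C" for C
  proof -
    have gC: "good R" if "R \<in> C" for R using C(2) that by (auto simp: subset_chain_def)
    have dir: "\<exists>R\<in>C. r \<in> R \<and> r' \<in> R" if "r \<in> \<Union>C" "r' \<in> \<Union>C" for r r'
    proof -
      obtain R R' where R: "R \<in> C" "r \<in> R" "R' \<in> C" "r' \<in> R'" using \<open>r \<in> \<Union>C\<close> \<open>r' \<in> \<Union>C\<close> by blast
      then have "R \<subseteq> R' \<or> R' \<subseteq> R" using C(2) by (simp add: subset_chain_def)
      then show ?thesis using R by blast
    qed
    obtain R0 where R0: "R0 \<in> C" using C(1) by blast
    have "good (\<Union>C)"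
      unfolding good_def
    proof (intro conjI)
      show "\<forall>n b x. (n, b, x) \<in> \<Union>C \<longrightarrow> b \<in> cells (tgt i) n \<and> x \<in> cells (src p) n \<and> app p n x = app v n b"
        using g1 gC by (meson UnionE)
      show "\<forall>m n \<phi> b x. \<phi> \<in> box_hom m n \<and> (n, b, x) \<in> \<Union>C \<longrightarrow>
          (m, act (tgt i) m n \<phi> b, act (src p) m n \<phi> x) \<in> \<Union>C"
        using g2 gC by (meson UnionE UnionI)
      show "\<forall>n b x x'. (n, b, x) \<in> \<Union>C \<and> (n, b, x') \<in> \<Union>C \<longrightarrow> x = x'"
        using dir g3 gC by meson
      show "\<forall>n a. a \<in> cells (src i) n \<longrightarrow> (n, app i n a, app u n a) \<in> \<Union>C"
        using g4[OF gC[OF R0]] R0 by blast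
    qed
    then show ?thesis by simp
  qed
  obtain M where M: "good M" and max: "\<And>R. good R \<Longrightarrow> M \<subseteq> R \<Longrightarrow> R = M"
    using subset_Zorn_nonempty[OF ne chain] by auto
  have tot: "\<exists>x. (n, b, x) \<in> M" if "b \<in> cells (tgt i) n" for n b
    using that
  proof (induction n arbitrary: b rule: less_induct)
    case (less n)
    show ?case
    proof (rule ccontr)
      assume none: "\<not> ?thesis"
      have B: "is_cset (tgt i)" using ic by simp
      have X: "is_cset (src p)" using p by simp
      \<comment> \<open>The faces of \<open>b\<close> have smaller dimension, so the partial lift is
        already defined on them.\<close>
      define x where "x j d = (THE x. (n - 1, act (tgt i) (n - 1) n (face n j d) b, x) \<in> M)" for j d
      have x: "(n - 1, act (tgt i) (n - 1) n (face n j d) b, x j d) \<in> M" if jn: "1 \<le> j" "j \<le> n" for j d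
      proof -
        have "act (tgt i) (n - 1) n (face n j d) b \<in> cells (tgt i) (n - 1)"
          using cset_act[OF B face_hom[OF jn] less.prems] .
        then obtain x' where x': "(n - 1, act (tgt i) (n - 1) n (face n j d) b, x') \<in> M"
          using less.IH[of "n - 1"] jn by auto
        then show ?thesis unfolding x_def by (rule theI) (use g3[OF M] x' in blast)
      qed
      have "compat (src p) n (all_faces n) x"
        unfolding compat_def
      proof (intro conjI allI impI)
        fix j d k d' assume "(j, d) \<in> all_faces n \<and> (k, d') \<in> all_faces n \<and> j < k"
        then have jk: "1 \<le> j" "j < k" "k \<le> n" by (auto simp: all_faces_def)
        have f: "face (n - 1) j d \<in> box_hom (n - 2) (n - 1)" "face (n - 1) (k - 1) d' \<in> box_hom (n - 2) (n - 1)"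
          using jk by (auto intro!: face_hom2)
        show "act (src p) (n - 2) (n - 1) (face (n - 1) j d) (x k d') =
          act (src p) (n - 2) (n - 1) (face (n - 1) (k - 1) d') (x j d)"
          using g3[OF M g2[OF M f(1) x[of k d']]] g2[OF M f(2) x[of j d]] faces_compat[OF B less.prems jk, of d d'] jk by simp
      qed (auto simp: all_faces_def intro: g1(2)[OF M x])
      moreover have "has_faces (tgt p) n (all_faces n) (\<lambda>j d. app p (n - 1) (x j d)) (app v n b)"
        unfolding has_faces_def all_faces_def
        using cmap_app[OF v(1)] v(2,3) less.prems g1(3)[OF M x] cmap_nat[OF v(1) face_hom] by auto
      ultimately obtain z where z: "has_faces (src p) n (all_faces n) x z" "app p n z = app v n b"
        using fill[of n] unfolding fills_def by blast
      have zc: "z \<in> cells (src p) n" using has_faces_cell[OF z(1)] .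
      interpret mc: minimal_cell "tgt i" "\<lambda>n. {b. \<exists>x. (n, b, x) \<in> M}" n b
        by unfold_locales (use B g2[OF M] less.prems none x in blast)+
      define M' where "M' = M \<union> {(m, act (tgt i) m n \<phi> b, act (src p) m n \<phi> z) | m \<phi>. \<phi> \<in> box_hom m n}"
      \<comment> \<open>An operator with a constant output factors through a face of
        \<open>b\<close>, where \<open>z\<close> has the values already chosen; only nonconstant
        operators contribute new pairs.\<close>
      have deg: "(m, act (tgt i) m n \<phi> b, act (src p) m n \<phi> z) \<in> M" if \<phi>: "\<phi> \<in> box_hom m n" "\<not> nonconst m n \<phi>" for m \<phi>
      proof -
        obtain j d \<psi> where j: "1 \<le> j" "j \<le> n" and \<psi>: "\<psi> \<in> box_hom m (n - 1)" "\<phi> = compose (pow1 m) (face n j d) \<psi>"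
          by (rule not_nonconst_factor[OF \<phi>])
        have "act (tgt i) m n \<phi> b = act (tgt i) m (n - 1) \<psi> (act (tgt i) (n - 1) n (face n j d) b)"
          "act (src p) m n \<phi> z = act (src p) m (n - 1) \<psi> (act (src p) (n - 1) n (face n j d) z)"
          using cset_comp[OF B \<psi>(1) face_hom[OF j] less.prems] cset_comp[OF X \<psi>(1) face_hom[OF j] zc] \<psi>(2) by simp_all
        moreover have "act (src p) (n - 1) n (face n j d) z = x j d"
          using has_faces_face[OF z(1)] j by (simp add: all_faces_def)
        ultimately show ?thesis using g2[OF M \<psi>(1) x[OF j]] by simp
      qed
      have new: "r \<in> M \<or> (\<exists>m \<phi>. \<phi> \<in> box_hom m n \<and> nonconst m n \<phi> \<and>
          r = (m, act (tgt i) m n \<phi> b, act (src p) m n \<phi> z))" if "r \<in> M'" for r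
        using that deg unfolding M'_def by blast
      have "good M'"
        unfolding good_def
      proof (intro conjI)
        show "\<forall>n b x. (n, b, x) \<in> M' \<longrightarrow> b \<in> cells (tgt i) n \<and> x \<in> cells (src p) n \<and> app p n x = app v n b"
          unfolding M'_def using g1[OF M] cset_act[OF B _ less.prems] cset_act[OF X _ zc]
            cmap_nat[OF p _ zc] cmap_nat[OF v(1)] v(2,3) less.prems z(2) by auto
        show "\<forall>k m \<psi> c y. \<psi> \<in> box_hom k m \<and> (m, c, y) \<in> M' \<longrightarrow> (k, act (tgt i) k m \<psi> c, act (src p) k m \<psi> y) \<in> M'"
        proof (intro allI impI, elim conjE)
          fix k m \<psi> c y assume \<psi>: "\<psi> \<in> box_hom k m" and "(m, c, y) \<in> M'"
          then consider "(m, c, y) \<in> M" | \<phi> where "\<phi> \<in> box_hom m n" "c = act (tgt i) m n \<phi> b" "y = act (src p) m n \<phi> z"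
            unfolding M'_def by blast
          then show "(k, act (tgt i) k m \<psi> c, act (src p) k m \<psi> y) \<in> M'"
          proof cases
            case 1 then show ?thesis using g2[OF M \<psi>] unfolding M'_def by blast
          next
            case 2
            then show ?thesis using cset_comp[OF B \<psi> 2(1) less.prems] cset_comp[OF X \<psi> 2(1) zc] comp_hom[OF 2(1) \<psi>]
              unfolding M'_def by auto
          qed
        qed
        \<comment> \<open>No conflict can arise: nonconstant operators move \<open>b\<close> to
          cells outside the old domain, and different ones to different cells.\<close>
        show "\<forall>m c y y'. (m, c, y) \<in> M' \<and> (m, c, y') \<in> M' \<longrightarrow> y = y'"
        proof (intro allI impI, elim conjE)
          fix m c y y' assume y: "(m, c, y) \<in> M'" and y': "(m, c, y') \<in> M'"
          show "y = y'"
            using new[OF y] new[OF y'] g3[OF M] mc.nonconst_notmem mc.nonconst_inj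
            by (elim disjE exE conjE) (simp, blast, blast, metis Pair_inject mc.nonconst_inj)
        qed
        show "\<forall>n a. a \<in> cells (src i) n \<longrightarrow> (n, app i n a, app u n a) \<in> M'"
          using g4[OF M] unfolding M'_def by blast
      qed
      then have "M' = M" by (rule max) (simp add: M'_def)
      moreover have "(n, b, z) \<in> M'"
        unfolding M'_def using less.prems zc B X box_id_hom[of n] cset_id[OF B less.prems] cset_id[OF X zc]
        by (smt (verit) UnCI mem_Collect_eq)
      ultimately show False using none by blast
    qed
  qed
  define H where "H n b = (THE x. (n, b, x) \<in> M)" for n b
  have H: "(n, b, H n b) \<in> M" if bc: "b \<in> cells (tgt i) n" for n b
  proof -
    obtain x where x: "(n, b, x) \<in> M" using tot[OF bc] by blast
    then show ?thesis unfolding H_def by (rule theI) (use g3[OF M] x in blast)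
  qed
  have Heq: "H n b = x" if "(n, b, x) \<in> M" for n b x
    using g3[OF M H[OF g1(1)[OF M that]] that] .
  obtain h where h: "is_cmap h" "src h = tgt i" "tgt h = src p" "\<And>n x. x \<in> cells (tgt i) n \<Longrightarrow> app h n x = H n x"
  proof (rule cmap_exE[of "tgt i" "src p" H])
    show "H m (act (tgt i) m n \<phi> x) = act (src p) m n \<phi> (H n x)" if "\<phi> \<in> box_hom m n" "x \<in> cells (tgt i) n" for m n \<phi> x
      by (rule Heq, rule g2[OF M that(1) H[OF that(2)]])
  qed (use ic p g1(2)[OF M H] in simp_all)
  have "h \<odot> i = u"
    by (rule cmap_eqI) (use h ic u cmap_app[OF ic] Heq[OF g4[OF M]] in \<open>auto intro: comp_cmap\<close>)
  moreover have "p \<odot> h = v"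
    by (rule cmap_eqI) (use h p v g1(3)[OF M H] in \<open>auto intro: comp_cmap\<close>)
  ultimately show "\<exists>h. is_cmap h \<and> src h = tgt i \<and> tgt h = src p \<and> h \<odot> i = u \<and> p \<odot> h = v"
    using h by blast
qed

section \<open>Unions of faces of a cube\<close>

lemma cube_sel [simp]: "cells (cube n) m = box_hom m n" "act (cube n) k m \<psi> \<phi> = compose (pow1 k) \<phi> \<psi>"
  by (simp_all add: cube_def)

lemma cube_cset [simp]: "is_cset (cube n)"
  unfolding is_cset_def by (auto simp: compose_id_op compose_assoc_op)

text \<open>For \<open>all_faces n\<close> this is the boundary of the cube, for
  \<open>horn n i e\<close> the open box; one construction serves both.\<close>

definition faces_cset :: "nat \<Rightarrow> (nat \<times> bool) set \<Rightarrow> op cset" where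
  "faces_cset n S = \<lparr>cells = (\<lambda>m. {compose (pow1 m) (face n j d) \<psi> | j d \<psi>. (j, d) \<in> S \<and> \<psi> \<in> box_hom m (n - 1)}),
     act = act (cube n)\<rparr>"

definition faces_incl :: "nat \<Rightarrow> (nat \<times> bool) set \<Rightarrow> (op, op) cmap" where
  "faces_incl n S = \<lparr>src = faces_cset n S, tgt = cube n,
     app = (\<lambda>m. \<lambda>\<phi>\<in>cells (faces_cset n S) m. \<phi>)\<rparr>"

lemma faces_act [simp]: "act (faces_cset n S) k m \<psi> \<phi> = compose (pow1 k) \<phi> \<psi>"
  by (simp add: faces_cset_def)

lemma faces_mem: "(j, d) \<in> S \<Longrightarrow> \<psi> \<in> box_hom m (n - 1) \<Longrightarrow>
    compose (pow1 m) (face n j d) \<psi> \<in> cells (faces_cset n S) m"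
  by (auto simp: faces_cset_def)

lemma facesE:
  assumes "\<phi> \<in> cells (faces_cset n S) m"
  obtains j d \<psi> where "(j, d) \<in> S" "\<psi> \<in> box_hom m (n - 1)" "\<phi> = compose (pow1 m) (face n j d) \<psi>"
  using assms by (auto simp: faces_cset_def)

lemma all_facesD: "S \<subseteq> all_faces n \<Longrightarrow> (j, d) \<in> S \<Longrightarrow> 1 \<le> j \<and> j \<le> n"
  by (auto simp: all_faces_def)

lemma face_mem:
  assumes "S \<subseteq> all_faces n" "(j, d) \<in> S"
  shows "face n j d \<in> cells (faces_cset n S) (n - 1)"
proof -
  have "compose (pow1 (n - 1)) (face n j d) (box_id (n - 1)) = face n j d"
    using all_facesD[OF assms] by (intro compose_id_op[OF face_hom]) auto
  then show ?thesis using faces_mem[OF assms(2) box_id_hom] by metis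
qed

lemma faces_sub:
  assumes "S \<subseteq> all_faces n" "\<phi> \<in> cells (faces_cset n S) m"
  shows "\<phi> \<in> box_hom m n"
  using facesE[OF assms(2)] all_facesD[OF assms(1)] comp_hom[OF face_hom] by metis

lemma faces_cset_cset [simp]:
  assumes S: "S \<subseteq> all_faces n"
  shows "is_cset (faces_cset n S)"
  unfolding is_cset_def
proof (intro conjI allI ballI)
  fix k m \<psi> \<phi> assume \<psi>: "\<psi> \<in> box_hom k m" and "\<phi> \<in> cells (faces_cset n S) m"
  then obtain j d \<chi> where "(j, d) \<in> S" "\<chi> \<in> box_hom m (n - 1)" "\<phi> = compose (pow1 m) (face n j d) \<chi>"
    by (elim facesE)
  then show "act (faces_cset n S) k m \<psi> \<phi> \<in> cells (faces_cset n S) k"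
    using \<psi> by (simp add: compose_assoc_op[OF \<psi>] faces_mem comp_hom)
qed (auto simp: compose_assoc_op compose_id_op dest: faces_sub[OF S])

lemma faces_incl_sel [simp]: "src (faces_incl n S) = faces_cset n S" "tgt (faces_incl n S) = cube n"
  "\<phi> \<in> cells (faces_cset n S) m \<Longrightarrow> app (faces_incl n S) m \<phi> = \<phi>"
  by (simp_all add: faces_incl_def)

lemma faces_incl_cmono:
  assumes S: "S \<subseteq> all_faces n"
  shows "cmono (faces_incl n S)"
proof -
  have "is_cmap (faces_incl n S)"
    unfolding faces_incl_def by (rule cmapI) (use S faces_sub[OF S] in auto)
  then show ?thesis by (simp add: cmono_def inj_on_def)
qed

text \<open>Two faces in different directions intersect in a common face of codimension two: a cell
  in both has the other prescribed coordinate constant, and that coordinate splits off.\<close>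

lemma face_face_eq:
  assumes jk: "1 \<le> j" "j < k" "k \<le> n" and \<psi>: "\<psi> \<in> box_hom m (n - 1)" "\<psi>' \<in> box_hom m (n - 1)"
    and eq: "compose (pow1 m) (face n j d) \<psi> = compose (pow1 m) (face n k d') \<psi>'"
  obtains \<chi> where "\<chi> \<in> box_hom m (n - 2)"
    "\<psi> = compose (pow1 m) (face (n - 1) (k - 1) d') \<chi>" "\<psi>' = compose (pow1 m) (face (n - 1) j d) \<chi>"
proof -
  have e: "face n j d (\<psi> xs) = face n k d' (\<psi>' xs)" if "length xs = m" for xs
    using fun_cong[OF eq, of xs] that by simp
  have l: "length (\<psi> xs) = n - 1" "length (\<psi>' xs) = n - 1" if "length xs = m" for xs
    using box_hom_length[OF \<psi>(1) that] box_hom_length[OF \<psi>(2) that] .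
  \<comment> \<open>Inside the face in direction \<open>j < k\<close>, direction \<open>k\<close>
    has index \<open>k - 1\<close>; the second subtraction passes to list positions.\<close>
  have "\<psi> xs ! (k - 1 - 1) = d'" if "length xs = m" for xs
    using arg_cong[OF e[OF that], of "\<lambda>zs. zs ! (k - 1)"] jk l[OF that] by (simp add: face_nth split: if_splits)
  note c = this
  obtain \<chi> where \<chi>: "\<chi> \<in> box_hom m (n - 1 - 1)" "\<psi> = compose (pow1 m) (face (n - 1) (k - 1) d') \<chi>"
    by (rule coordinate_factor[OF \<psi>(1), of "k - 1" d']) (use jk c in auto)
  have "n - 1 - 1 = n - 2" by simp
  with \<chi> have \<chi>h: "\<chi> \<in> box_hom m (n - 2)" by metis
  have f: "face (n - 1) j d \<in> box_hom (n - 2) (n - 1)" "face (n - 1) (k - 1) d' \<in> box_hom (n - 2) (n - 1)"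
    using jk by (auto intro!: face_hom2)
  have "compose (pow1 m) (face n k d') (compose (pow1 m) (face (n - 1) j d) \<chi>) =
      compose (pow1 m) (face n j d) (compose (pow1 m) (face (n - 1) (k - 1) d') \<chi>)"
    using face_face[OF jk, of d' d] by (simp flip: compose_assoc_op[OF \<chi>h])
  then have "compose (pow1 m) (face n k d') (compose (pow1 m) (face (n - 1) j d) \<chi>) =
      compose (pow1 m) (face n k d') \<psi>'"
    using \<chi>(2) eq by simp
  then have "compose (pow1 m) (face (n - 1) j d) \<chi> = \<psi>'"
    using face_cancel[of k n "compose (pow1 m) (face (n - 1) j d) \<chi>" m \<psi>' d'] jk comp_hom[OF f(1) \<chi>h] \<psi>(2) by simp
  then show ?thesis using that[OF \<chi>h \<chi>(2)] by simp
qed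

text \<open>In different directions the cell comes from the common codimension-two face, where
  compatibility applies; in equal directions opposite faces are disjoint and a face is a
  monomorphism.\<close>

lemma compat_well_defined:
  assumes X: "is_cset X" and S: "S \<subseteq> all_faces n" and x: "compat X n S x"
    and j: "(j, d) \<in> S" "(k, d') \<in> S" and \<psi>: "\<psi> \<in> box_hom m (n - 1)" "\<psi>' \<in> box_hom m (n - 1)"
    and eq: "compose (pow1 m) (face n j d) \<psi> = compose (pow1 m) (face n k d') \<psi>'"
  shows "act X m (n - 1) \<psi> (x j d) = act X m (n - 1) \<psi>' (x k d')"
proof -
  have *: "act X m (n - 1) \<psi> (x j d) = act X m (n - 1) \<psi>' (x k d')"
    if j: "(j, d) \<in> S" "(k, d') \<in> S" "j < k" and \<psi>: "\<psi> \<in> box_hom m (n - 1)" "\<psi>' \<in> box_hom m (n - 1)"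
    and eq: "compose (pow1 m) (face n j d) \<psi> = compose (pow1 m) (face n k d') \<psi>'" for j d k d' \<psi> \<psi>'
  proof -
    have jk: "1 \<le> j" "k \<le> n" using j all_facesD[OF S] by auto
    obtain \<chi> where \<chi>: "\<chi> \<in> box_hom m (n - 2)"
      "\<psi> = compose (pow1 m) (face (n - 1) (k - 1) d') \<chi>" "\<psi>' = compose (pow1 m) (face (n - 1) j d) \<chi>"
      using face_face_eq[OF jk(1) j(3) jk(2) \<psi> eq] .
    have f: "face (n - 1) j d \<in> box_hom (n - 2) (n - 1)" "face (n - 1) (k - 1) d' \<in> box_hom (n - 2) (n - 1)"
      using jk j(3) by (auto intro!: face_hom2)
    have "act X (n - 2) (n - 1) (face (n - 1) j d) (x k d') = act X (n - 2) (n - 1) (face (n - 1) (k - 1) d') (x j d)"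
      using x j unfolding compat_def by blast
    then show ?thesis
      using cset_comp[OF X \<chi>(1) f(2) compat_cells[OF x j(1)]] cset_comp[OF X \<chi>(1) f(1) compat_cells[OF x j(2)]] \<chi>(2,3)
      by simp
  qed
  consider "j < k" | "k < j" | "j = k" by linarith
  then show ?thesis
  proof cases
    case 1 then show ?thesis by (intro *[OF j _ \<psi> eq])
  next
    case 2 then show ?thesis using *[OF j(2,1) 2 \<psi>(2,1) eq[symmetric]] by simp
  next
    case 3
    have j1: "1 \<le> j" "j \<le> n" using j all_facesD[OF S] by auto
    \<comment> \<open>Any point separates opposite faces by its coordinate in direction
      \<open>j\<close>.\<close>
    let ?r = "replicate m False"
    have "face n j d (\<psi> ?r) ! (j - 1) = face n j d' (\<psi>' ?r) ! (j - 1)"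
      using fun_cong[OF eq, of ?r] 3 by simp
    then have "d = d'"
      using j1 box_hom_length[OF \<psi>(1), of ?r] box_hom_length[OF \<psi>(2), of ?r] by (simp add: face_nth)
    then have "\<psi> = \<psi>'" using face_cancel[OF j1 \<psi>] eq 3 by simp
    then show ?thesis using \<open>d = d'\<close> 3 by simp
  qed
qed

text \<open>A union of faces is glued from its faces along their pairwise intersections, so a
  compatible family extends to a map.\<close>

lemma family_map:
  assumes X: "is_cset X" and S: "S \<subseteq> all_faces n" and x: "compat X n S x"
  obtains g where "is_cmap g" "src g = faces_cset n S" "tgt g = X"
    "\<And>m j d \<psi>. (j, d) \<in> S \<Longrightarrow> \<psi> \<in> box_hom m (n - 1) \<Longrightarrow>
      app g m (compose (pow1 m) (face n j d) \<psi>) = act X m (n - 1) \<psi> (x j d)"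
proof -
  define P where "P m \<phi> y \<longleftrightarrow> (\<exists>j d \<psi>. (j, d) \<in> S \<and> \<psi> \<in> box_hom m (n - 1) \<and>
    \<phi> = compose (pow1 m) (face n j d) \<psi> \<and> y = act X m (n - 1) \<psi> (x j d))" for m \<phi> y
  \<comment> \<open>A cell may lie in several faces; the choice is harmless by
    \<open>compat_well_defined\<close>.\<close>
  define F where "F m \<phi> = (SOME y. P m \<phi> y)" for m \<phi>
  have F: "F m (compose (pow1 m) (face n j d) \<psi>) = act X m (n - 1) \<psi> (x j d)"
    if j: "(j, d) \<in> S" "\<psi> \<in> box_hom m (n - 1)" for m j d \<psi>
  proof -
    have "P m (compose (pow1 m) (face n j d) \<psi>) (act X m (n - 1) \<psi> (x j d))"
      unfolding P_def using j by blast
    then have "P m (compose (pow1 m) (face n j d) \<psi>) (F m (compose (pow1 m) (face n j d) \<psi>))"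
      unfolding F_def by (rule someI)
    then obtain k d' \<psi>' where k: "(k, d') \<in> S" "\<psi>' \<in> box_hom m (n - 1)"
      "compose (pow1 m) (face n j d) \<psi> = compose (pow1 m) (face n k d') \<psi>'"
      "F m (compose (pow1 m) (face n j d) \<psi>) = act X m (n - 1) \<psi>' (x k d')"
      unfolding P_def by blast
    show ?thesis using compat_well_defined[OF X S x j(1) k(1) j(2) k(2,3)] k(4) by simp
  qed
  show ?thesis
  proof (rule cmap_exE[of "faces_cset n S" X F])
    fix m \<phi> assume "\<phi> \<in> cells (faces_cset n S) m"
    then show "F m \<phi> \<in> cells X m"
      by (elim facesE) (use F cset_act[OF X _ compat_cells[OF x]] in simp)
  next
    fix k m \<theta> \<phi> assume \<theta>: "\<theta> \<in> box_hom k m" and "\<phi> \<in> cells (faces_cset n S) m"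
    then obtain j d \<psi> where j: "(j, d) \<in> S" "\<psi> \<in> box_hom m (n - 1)" "\<phi> = compose (pow1 m) (face n j d) \<psi>"
      by (elim facesE)
    then show "F k (act (faces_cset n S) k m \<theta> \<phi>) = act X k m \<theta> (F m \<phi>)"
      using cset_comp[OF X \<theta> j(2) compat_cells[OF x j(1)]]
      by (simp add: compose_assoc_op[OF \<theta>] F comp_hom[OF j(2) \<theta>])
  next
    fix g :: "(op, 'a) cmap"
    assume "is_cmap g" "src g = faces_cset n S" "tgt g = X"
      "\<And>m \<phi>. \<phi> \<in> cells (faces_cset n S) m \<Longrightarrow> app g m \<phi> = F m \<phi>"
    then show ?thesis using that[of g] F faces_mem by metis
  qed (use X S in auto)
qed

lemma map_family:
  assumes g: "is_cmap g" "src g = faces_cset n S" "tgt g = X" and S: "S \<subseteq> all_faces n"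
  shows "compat X n S (\<lambda>j d. app g (n - 1) (face n j d))"
    and "(j, d) \<in> S \<Longrightarrow> \<psi> \<in> box_hom m (n - 1) \<Longrightarrow>
      app g m (compose (pow1 m) (face n j d) \<psi>) = act X m (n - 1) \<psi> (app g (n - 1) (face n j d))"
proof -
  show *: "app g m (compose (pow1 m) (face n j d) \<psi>) = act X m (n - 1) \<psi> (app g (n - 1) (face n j d))"
    if "(j, d) \<in> S" "\<psi> \<in> box_hom m (n - 1)" for j d m \<psi>
    using cmap_nat[OF g(1) that(2), of "face n j d"] g face_mem[OF S that(1)] by simp
  show "compat X n S (\<lambda>j d. app g (n - 1) (face n j d))"
    unfolding compat_def
  proof (intro conjI allI impI)
    fix j d assume "(j, d) \<in> S"
    then show "app g (n - 1) (face n j d) \<in> cells X (n - 1)"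
      using cmap_app[OF g(1), of "face n j d"] g face_mem[OF S] by simp
  next
    fix j d k d' assume jk: "(j, d) \<in> S \<and> (k, d') \<in> S \<and> j < k"
    then have jk': "1 \<le> j" "j < k" "k \<le> n" using all_facesD[OF S] by auto
    then have f: "face (n - 1) j d \<in> box_hom (n - 2) (n - 1)" "face (n - 1) (k - 1) d' \<in> box_hom (n - 2) (n - 1)"
      by (auto intro!: face_hom2)
    show "act X (n - 2) (n - 1) (face (n - 1) j d) (app g (n - 1) (face n k d')) =
      act X (n - 2) (n - 1) (face (n - 1) (k - 1) d') (app g (n - 1) (face n j d))"
      using *[of k d' "face (n - 1) j d" "n - 2"] *[of j d "face (n - 1) (k - 1) d'" "n - 2"] jk f
        face_face[OF jk', of d' d] by simp
  qed
qed

section \<open>Lifting problems against unions of faces as filling problems\<close>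

lemma yoneda_map:
  assumes X: "is_cset X" and z: "z \<in> cells X n"
  obtains g where "is_cmap g" "src g = cube n" "tgt g = X" "\<And>m \<phi>. \<phi> \<in> box_hom m n \<Longrightarrow> app g m \<phi> = act X m n \<phi> z"
proof (rule cmap_exE[of "cube n" X "\<lambda>m \<phi>. act X m n \<phi> z"])
  fix k m \<theta> \<phi> assume "\<theta> \<in> box_hom k m" "\<phi> \<in> cells (cube n) m"
  then show "act X k n (act (cube n) k m \<theta> \<phi>) z = act X k m \<theta> (act X m n \<phi> z)"
    using cset_comp[OF X _ _ z] by simp
qed (use X z in \<open>auto intro: cset_act that\<close>)

lemma cube_map:
  assumes "is_cmap g" "src g = cube n" "\<phi> \<in> box_hom m n"
  shows "app g m \<phi> = act (tgt g) m n \<phi> (app g n (box_id n))"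
  using cmap_nat[OF assms(1,3), of "box_id n"] assms by (simp add: compose_id_op)

lemma cube_map_cell: "is_cmap g \<Longrightarrow> src g = cube n \<Longrightarrow> app g n (box_id n) \<in> cells (tgt g) n"
  using cmap_app[of g "box_id n" n] by simp

lemma family_nat:
  assumes p: "is_cmap p" and x: "compat (src p) n S x" and S: "S \<subseteq> all_faces n" and
    y: "has_faces (tgt p) n S (\<lambda>j d. app p (n - 1) (x j d)) y"
    and j: "(j, d) \<in> S" "\<psi> \<in> box_hom m (n - 1)"
  shows "app p m (act (src p) m (n - 1) \<psi> (x j d)) = act (tgt p) m n (compose (pow1 m) (face n j d) \<psi>) y"
  using cmap_nat[OF p j(2) compat_cells[OF x j(1)]] has_faces_face[OF y j(1)]
    cset_comp[OF cmap_tgt[OF p] j(2) face_hom has_faces_cell[OF y], of j d] all_facesD[OF S j(1)] by simp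

text \<open>The family becomes a map out of the union of faces and \<open>y\<close> a map out of the
  cube; the value of a lift at the identity operator is the filler.\<close>

lemma lifts_fills:
  assumes p: "is_cmap p" and S: "S \<subseteq> all_faces n" and l: "lifts (faces_incl n S) p"
  shows "fills p n S C"
  unfolding fills_def
proof (intro allI impI, elim conjE)
  fix x y assume x: "compat (src p) n S x" and y: "has_faces (tgt p) n S (\<lambda>j d. app p (n - 1) (x j d)) y"
  obtain u where u: "is_cmap u" "src u = faces_cset n S" "tgt u = src p"
    "\<And>m j d \<psi>. (j, d) \<in> S \<Longrightarrow> \<psi> \<in> box_hom m (n - 1) \<Longrightarrow>
      app u m (compose (pow1 m) (face n j d) \<psi>) = act (src p) m (n - 1) \<psi> (x j d)"
    by (rule family_map[OF cmap_src[OF p] S x]) blast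
  obtain v where v: "is_cmap v" "src v = cube n" "tgt v = tgt p"
    "\<And>m \<phi>. \<phi> \<in> box_hom m n \<Longrightarrow> app v m \<phi> = act (tgt p) m n \<phi> y"
    by (rule yoneda_map[OF cmap_tgt[OF p] has_faces_cell[OF y]]) blast
  have ic: "is_cmap (faces_incl n S)" using faces_incl_cmono[OF S] by (simp add: cmono_def)
  have "p \<odot> u = v \<odot> faces_incl n S"
  proof (rule cmap_eqI)
    fix m \<phi> assume "\<phi> \<in> cells (src (p \<odot> u)) m"
    then have \<phi>: "\<phi> \<in> cells (faces_cset n S) m" using u by simp
    then obtain j d \<psi> where j: "(j, d) \<in> S" "\<psi> \<in> box_hom m (n - 1)" "\<phi> = compose (pow1 m) (face n j d) \<psi>"
      by (elim facesE)
    then show "app (p \<odot> u) m \<phi> = app (v \<odot> faces_incl n S) m \<phi>"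
      using u v \<phi> faces_sub[OF S \<phi>] family_nat[OF p x S y j(1,2)] by simp
  qed (use u v p ic in \<open>auto intro: comp_cmap\<close>)
  then obtain h where h: "is_cmap h" "src h = cube n" "tgt h = src p" "h \<odot> faces_incl n S = u" "p \<odot> h = v"
    using liftsE[OF l u(1) _ u(3) v(1) _ v(3)] u(2) v(2) by (metis faces_incl_sel(1,2))
  let ?z = "app h n (box_id n)"
  have z: "?z \<in> cells (src p) n" using cube_map_cell[OF h(1,2)] h(3) by simp
  have "act (src p) (n - 1) n (face n j d) ?z = x j d" if "(j, d) \<in> S" for j d
  proof -
    have f: "face n j d \<in> box_hom (n - 1) n" using all_facesD[OF S that] by (auto intro: face_hom)
    have "app u (n - 1) (face n j d) = app h (n - 1) (face n j d)"
      using face_mem[OF S that] by (simp flip: h(4))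
    moreover have "app u (n - 1) (face n j d) = x j d"
      using u(4)[OF that box_id_hom] compose_id_op(2)[OF f] cset_id[OF cmap_src[OF p] compat_cells[OF x that]] by simp
    ultimately show ?thesis using cube_map[OF h(1,2) f] h(3) by simp
  qed
  moreover have "app p n ?z = y"
    using v(4)[OF box_id_hom] has_faces_cell[OF y] p by (simp add: h(2) flip: h(5))
  ultimately show "\<exists>z. has_faces (src p) n S x z \<and> app p n z = y"
    using z unfolding has_faces_def by blast
qed

lemma fills_lifts:
  assumes p: "is_cmap p" and S: "S \<subseteq> all_faces n" and fill: "fills p n S (\<lambda>_. True)"
  shows "lifts (faces_incl n S) p"
  unfolding lifts_def
proof (intro allI impI, elim conjE)
  fix u v assume u: "is_cmap u" "src u = src (faces_incl n S)" "tgt u = src p"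
    and v: "is_cmap v" "src v = tgt (faces_incl n S)" "tgt v = tgt p" and sq: "p \<odot> u = v \<odot> faces_incl n S"
  have ic: "is_cmap (faces_incl n S)" using faces_incl_cmono[OF S] by (simp add: cmono_def)
  have u': "src u = faces_cset n S" and v': "src v = cube n" using u v by simp_all
  define x where "x j d = app u (n - 1) (face n j d)" for j d
  define y where "y = app v n (box_id n)"
  have x: "compat (src p) n S x" unfolding x_def by (rule map_family(1)[OF u(1) u' u(3) S])
  have "has_faces (tgt p) n S (\<lambda>j d. app p (n - 1) (x j d)) y"
    unfolding has_faces_def
  proof (intro conjI allI impI)
    fix j d assume j: "(j, d) \<in> S"
    have f: "face n j d \<in> box_hom (n - 1) n" using all_facesD[OF S j] by (auto intro: face_hom)
    show "act (tgt p) (n - 1) n (face n j d) y = app p (n - 1) (x j d)"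
      using square_app[OF sq u(2), of "face n j d"] face_mem[OF S j] cube_map[OF v(1) v' f] v(3) by (simp add: x_def y_def)
  qed (use cube_map_cell[OF v(1) v'] v(3) y_def in simp)
  then obtain z where z: "has_faces (src p) n S x z" "app p n z = y"
    using fill x unfolding fills_def by blast
  obtain h where h: "is_cmap h" "src h = cube n" "tgt h = src p"
    "\<And>m \<phi>. \<phi> \<in> box_hom m n \<Longrightarrow> app h m \<phi> = act (src p) m n \<phi> z"
    by (rule yoneda_map[OF cmap_src[OF p] has_faces_cell[OF z(1)]]) blast
  have "h \<odot> faces_incl n S = u"
  proof (rule cmap_eqI)
    fix m \<phi> assume "\<phi> \<in> cells (src (h \<odot> faces_incl n S)) m"
    then have \<phi>: "\<phi> \<in> cells (faces_cset n S) m" by simp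
    then obtain j d \<psi> where j: "(j, d) \<in> S" "\<psi> \<in> box_hom m (n - 1)" "\<phi> = compose (pow1 m) (face n j d) \<psi>"
      by (elim facesE)
    then show "app (h \<odot> faces_incl n S) m \<phi> = app u m \<phi>"
      using h(4)[OF faces_sub[OF S \<phi>]] \<phi> map_family(2)[OF u(1) u' u(3) S j(1,2)] has_faces_face[OF z(1) j(1)]
        cset_comp[OF cmap_src[OF p] j(2) face_hom has_faces_cell[OF z(1)], of j d] all_facesD[OF S j(1)]
      by (simp add: x_def)
  qed (use u h ic in \<open>auto intro: comp_cmap\<close>)
  moreover have "p \<odot> h = v"
  proof (rule cmap_eqI)
    fix m \<phi> assume "\<phi> \<in> cells (src (p \<odot> h)) m"
    then have \<phi>: "\<phi> \<in> box_hom m n" using h by simp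
    then show "app (p \<odot> h) m \<phi> = app v m \<phi>"
      using h cube_map[OF v(1) v' \<phi>] v(3) cmap_nat[OF p \<phi> has_faces_cell[OF z(1)]] z(2) by (simp add: y_def)
  qed (use p v v' h in \<open>auto intro: comp_cmap\<close>)
  ultimately show "\<exists>h. is_cmap h \<and> src h = tgt (faces_incl n S) \<and> tgt h = src p \<and> h \<odot> faces_incl n S = u \<and> p \<odot> h = v"
    using h by auto
qed

definition horn :: "nat \<Rightarrow> nat \<Rightarrow> bool \<Rightarrow> (nat \<times> bool) set" where
  "horn n i e = all_faces n - {(i, e)}"

lemma horn_sub: "horn n i e \<subseteq> all_faces n"
  by (auto simp: horn_def)

lemma open_box_faces: "open_box n i e = faces_cset n (horn n i e)"
  by (auto simp: open_box_def faces_cset_def horn_def all_faces_def)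

lemma open_box_incl_faces: "open_box_incl n i e = faces_incl n (horn n i e)"
  by (simp add: open_box_incl_def faces_incl_def open_box_faces)

lemma kan_fibrationI:
  assumes "is_cmap p" "\<And>n i e. 1 \<le> i \<Longrightarrow> i \<le> n \<Longrightarrow> fills p n (horn n i e) (\<lambda>_. True)"
  shows "kan_fibration p"
  unfolding kan_fibration_def open_box_incl_faces using assms fills_lifts[OF assms(1) horn_sub] by simp

section \<open>Collapsing an edge\<close>

text \<open>This is the condition for a map to factor through the collapse of an edge that it sends
  to \<open>s\<close>.\<close>

definition degen_edge :: "'a cset \<Rightarrow> 'a \<Rightarrow> bool" where
  "degen_edge X s \<longleftrightarrow> (\<exists>w\<in>cells X 0. s = act X 1 0 (const_op 1) w)"

lemma degen_edge_act:
  assumes X: "is_cset X" and s: "degen_edge X s" and \<phi>: "\<phi> \<in> box_hom m 1" "\<phi>' \<in> box_hom m 1"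
  shows "act X m 1 \<phi> s = act X m 1 \<phi>' s"
proof -
  obtain w where w: "w \<in> cells X 0" "s = act X 1 0 (const_op 1) w" using s by (auto simp: degen_edge_def)
  show ?thesis
    using cset_comp[OF X \<phi>(1) const_op_hom w(1)] cset_comp[OF X \<phi>(2) const_op_hom w(1)] w(2)
    by (simp add: const_op_comp[OF \<phi>(1)] const_op_comp[OF \<phi>(2)])
qed

lemma degen_edge_map:
  assumes p: "is_cmap p" and s: "degen_edge (src p) s"
  shows "degen_edge (tgt p) (app p 1 s)"
proof -
  obtain w where w: "w \<in> cells (src p) 0" "s = act (src p) 1 0 (const_op 1) w" using s by (auto simp: degen_edge_def)
  then show ?thesis
    using cmap_nat[OF p const_op_hom w(1), of 1] cmap_app[OF p w(1)] unfolding degen_edge_def by blast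
qed

abbreviation cls :: "'a cset \<Rightarrow> 'a \<Rightarrow> nat \<Rightarrow> 'a \<Rightarrow> 'a set" where
  "cls A d m a \<equiv> edge_rel A d m `` {a}"

locale edge_collapse =
  fixes A :: "'a cset" and d :: 'a
  assumes A: "is_cset A" and d: "d \<in> cells A 1"
begin

lemma equiv: "equiv (cells A m) (edge_rel A d m)"
  by (rule equivI) (auto simp: edge_rel_def refl_on_def sym_def trans_def)

lemma rel_act:
  assumes r: "(a, a') \<in> edge_rel A d n" and \<phi>: "\<phi> \<in> box_hom m n"
  shows "(act A m n \<phi> a, act A m n \<phi> a') \<in> edge_rel A d m"
proof -
  have a: "a \<in> cells A n" "a' \<in> cells A n" using r by (auto simp: edge_rel_def)
  note ac = cset_act[OF A \<phi> a(1)] cset_act[OF A \<phi> a(2)]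
  have d\<phi>: "\<exists>\<psi>'\<in>box_hom m 1. act A m n \<phi> (act A n 1 \<psi> d) = act A m 1 \<psi>' d" if "\<psi> \<in> box_hom n 1" for \<psi>
    using cset_comp[OF A \<phi> that d] comp_hom[OF that \<phi>] by blast
  consider "a = a'" | \<psi> \<psi>' where "\<psi> \<in> box_hom n 1" "\<psi>' \<in> box_hom n 1" "a = act A n 1 \<psi> d" "a' = act A n 1 \<psi>' d"
    using r unfolding edge_rel_def by blast
  then show ?thesis
  proof cases
    case 1 then show ?thesis using ac by (simp add: edge_rel_def)
  next
    case 2
    then show ?thesis using ac d\<phi>[OF 2(1)] d\<phi>[OF 2(2)] unfolding edge_rel_def by blast
  qed
qed

lemma cls_eq_iff: "a \<in> cells A m \<Longrightarrow> a' \<in> cells A m \<Longrightarrow> cls A d m a = cls A d m a' \<longleftrightarrow> (a, a') \<in> edge_rel A d m"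
  by (rule eq_equiv_class_iff[OF equiv])

lemma collapse_cells: "cells (collapse A d) m = cls A d m ` cells A m"
  by (auto simp: collapse_def quotient_def)

lemma collapse_act:
  assumes "\<phi> \<in> box_hom m n" "a \<in> cells A n"
  shows "act (collapse A d) m n \<phi> (cls A d n a) = cls A d m (act A m n \<phi> a)"
proof -
  have "(\<lambda>x. cls A d m (act A m n \<phi> x)) respects (edge_rel A d n)"
    by (rule congruentI) (use rel_act assms(1) equiv_class_eq[OF equiv] in metis)
  from UN_equiv_class[OF equiv this assms(2)] show ?thesis by (simp add: collapse_def)
qed

lemma collapse_cset: "is_cset (collapse A d)"
  unfolding is_cset_def collapse_cells
  using A by (auto simp: collapse_act cset_act cset_comp comp_hom)

lemma projE:
  obtains q where "is_cmap q" "src q = A" "tgt q = collapse A d" "\<And>m a. a \<in> cells A m \<Longrightarrow> app q m a = cls A d m a"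
proof (rule cmap_exE[of A "collapse A d" "cls A d"])
  fix g :: "('a, 'a set) cmap"
  assume "is_cmap g" "src g = A" "tgt g = collapse A d" "\<And>m a. a \<in> cells A m \<Longrightarrow> app g m a = cls A d m a"
  then show thesis using that[of g] by blast
qed (auto simp: collapse_cset A collapse_cells collapse_act)

lemma collapse_degen: "degen_edge (collapse A d) (cls A d 1 d)"
proof -
  let ?v = "face 1 1 False"
  have v: "?v \<in> box_hom 0 1" using face_hom[of 1 1 False] by simp
  \<comment> \<open>The constant endomorphism of the interval at its initial vertex. All cells of
    one dimension in the image of \<open>d\<close> are identified, so \<open>d\<close> becomes a
    degeneracy of that vertex.\<close>
  let ?k = "compose (pow1 1) ?v (const_op 1)"
  have k: "?k \<in> box_hom 1 1" using comp_hom[OF v const_op_hom] .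
  have "(d, act A 1 1 ?k d) \<in> edge_rel A d 1"
    using d cset_act[OF A k d] k box_id_hom[of 1] cset_id[OF A d] unfolding edge_rel_def
    by (simp only: mem_Collect_eq prod.case) metis
  then have "cls A d 1 d = cls A d 1 (act A 1 1 ?k d)" using equiv_class_eq[OF equiv] by metis
  also have "act A 1 1 ?k d = act A 1 0 (const_op 1) (act A 0 1 ?v d)"
    using cset_comp[OF A const_op_hom v d, of 1] by simp
  also have "cls A d 1 (act A 1 0 (const_op 1) (act A 0 1 ?v d)) =
      act (collapse A d) 1 0 (const_op 1) (cls A d 0 (act A 0 1 ?v d))"
    using collapse_act[OF const_op_hom cset_act[OF A v d], of 1] by simp
  finally show ?thesis unfolding degen_edge_def collapse_cells using cset_act[OF A v d] by blast
qed

text \<open>Universal property of the pushout: a degenerate edge takes the same value under all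
  operators with a given source, so \<open>g\<close> is constant on classes.\<close>

lemma collapse_map:
  assumes g: "is_cmap g" "src g = A" and s: "degen_edge (tgt g) (app g 1 d)"
  obtains h where "is_cmap h" "src h = collapse A d" "tgt h = tgt g"
    "\<And>m a. a \<in> cells A m \<Longrightarrow> app h m (cls A d m a) = app g m a"
proof -
  have wd: "app g m a = app g m a'" if rel: "(a, a') \<in> edge_rel A d m" for m a a'
  proof -
    consider "a = a'" | \<psi> \<psi>' where "\<psi> \<in> box_hom m 1" "\<psi>' \<in> box_hom m 1" "a = act A m 1 \<psi> d" "a' = act A m 1 \<psi>' d"
      using rel unfolding edge_rel_def by blast
    then show ?thesis
    proof cases
      case 2
      then show ?thesis
        using cmap_nat[OF g(1) 2(1), of d] cmap_nat[OF g(1) 2(2), of d]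
          degen_edge_act[OF cmap_tgt[OF g(1)] s 2(1,2)] d g(2) by simp
    qed simp
  qed
  define F where "F m c = app g m (SOME a. a \<in> cells A m \<and> c = cls A d m a)" for m c
  have F: "F m (cls A d m a) = app g m a" if a: "a \<in> cells A m" for m a
  proof -
    have "\<exists>a'. a' \<in> cells A m \<and> cls A d m a = cls A d m a'" using a by blast
    from someI_ex[OF this] have "(a, SOME a'. a' \<in> cells A m \<and> cls A d m a = cls A d m a') \<in> edge_rel A d m"
      using cls_eq_iff[OF a] by blast
    from wd[OF this] show ?thesis by (simp add: F_def)
  qed
  show ?thesis
  proof (rule cmap_exE[of "collapse A d" "tgt g" F])
    fix m c assume "c \<in> cells (collapse A d) m"
    then show "F m c \<in> cells (tgt g) m" using F cmap_app[OF g(1)] g(2) by (auto simp: collapse_cells)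
  next
    fix m n \<phi> c assume \<phi>: "\<phi> \<in> box_hom m n" and "c \<in> cells (collapse A d) n"
    then obtain a where "a \<in> cells A n" "c = cls A d n a" by (auto simp: collapse_cells)
    then show "F m (act (collapse A d) m n \<phi> c) = act (tgt g) m n \<phi> (F n c)"
      using \<phi> cmap_nat[OF g(1) \<phi>] g(2) by (simp add: collapse_act F cset_act[OF A \<phi>])
  next
    fix h :: "('a set, 'b) cmap"
    assume "is_cmap h" "src h = collapse A d" "tgt h = tgt g"
      "\<And>m c. c \<in> cells (collapse A d) m \<Longrightarrow> app h m c = F m c"
    then show ?thesis using that[of h] F by (simp add: collapse_cells)
  qed (simp_all add: collapse_cset g(1))
qed

end

text \<open>Identifications involve only cells in the image of \<open>d\<close>, hence restrict to a
  sub-cubical set; this makes the collapsed box embed into the collapsed cube.\<close>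

lemma edge_rel_sub:
  assumes "\<And>m. cells B m \<subseteq> cells A m" "\<And>m n \<phi> x. act B m n \<phi> x = act A m n \<phi> x"
    and "a \<in> cells B m" "a' \<in> cells B m"
  shows "(a, a') \<in> edge_rel B d m \<longleftrightarrow> (a, a') \<in> edge_rel A d m"
  using assms by (auto simp: edge_rel_def)

section \<open>Inner open boxes\<close>

text \<open>Outside direction \<open>i\<close> the critical edge is constant at
  \<open>\<not> e\<close>, and a constant coordinate splits off as a face.\<close>

lemma critical_edge_face:
  assumes "1 \<le> i" "i \<le> n" "1 \<le> j" "j \<le> n" "j \<noteq> i"
  obtains \<psi> where "\<psi> \<in> box_hom 1 (n - 1)" "critical_edge n i e = compose (pow1 1) (face n j (\<not> e)) \<psi>"
proof -
  have "j - 1 \<noteq> i - 1" using assms by linarith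
  then have "critical_edge n i e xs ! (j - 1) = (\<not> e)" if "length xs = 1" for xs
    using assms that by (simp add: critical_edge_nth)
  then show ?thesis
    using coordinate_factor[OF critical_edge_hom[OF assms(1,2)] assms(3,4)] that by metis
qed

lemma critical_edge_mem:
  assumes "2 \<le> n" "1 \<le> i" "i \<le> n"
  obtains j \<psi> where "(j, \<not> e) \<in> horn n i e" "\<psi> \<in> box_hom 1 (n - 1)"
    "critical_edge n i e = compose (pow1 1) (face n j (\<not> e)) \<psi>"
proof -
  \<comment> \<open>As \<open>n\<close> is at least 2, there is a direction other than
    \<open>i\<close>.\<close>
  define j :: nat where "j = (if i = 1 then 2 else 1)"
  have j: "1 \<le> j" "j \<le> n" "j \<noteq> i" using assms by (auto simp: j_def)
  then have "(j, \<not> e) \<in> horn n i e" by (auto simp: horn_def all_faces_def)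
  then show ?thesis using critical_edge_face[OF assms(2,3) j] that by metis
qed

locale inner =
  fixes n i :: nat and e :: bool
  assumes n: "2 \<le> n" and i: "1 \<le> i" "i \<le> n"
begin

abbreviation "H \<equiv> horn n i e"
abbreviation "ce \<equiv> critical_edge n i e"

sublocale ob: edge_collapse "faces_cset n H" ce
proof
  show "is_cset (faces_cset n H)" using faces_cset_cset[OF horn_sub] .
  show "ce \<in> cells (faces_cset n H) 1" using critical_edge_mem[OF n i, of e] faces_mem by metis
qed

sublocale cu: edge_collapse "cube n" ce
  by unfold_locales (use critical_edge_hom[OF i] in simp_all)

lemma incl_sel [simp]: "src (inner_open_box_incl n i e) = collapse (faces_cset n H) ce"
  "tgt (inner_open_box_incl n i e) = collapse (cube n) ce"
  by (simp_all add: inner_open_box_incl_def inner_open_box_def inner_cube_def open_box_faces)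

lemma rel_iff: "a \<in> cells (faces_cset n H) m \<Longrightarrow> a' \<in> cells (faces_cset n H) m \<Longrightarrow>
    (a, a') \<in> edge_rel (faces_cset n H) ce m \<longleftrightarrow> (a, a') \<in> edge_rel (cube n) ce m"
  by (rule edge_rel_sub) (use faces_sub[OF horn_sub] in auto)

lemma incl_app [simp]:
  assumes a: "a \<in> cells (faces_cset n H) m"
  shows "app (inner_open_box_incl n i e) m (cls (faces_cset n H) ce m a) = cls (cube n) ce m a"
proof -
  have ac: "a \<in> cells (cube n) m" using faces_sub[OF horn_sub a] by simp
  have "cls (faces_cset n H) ce m a \<in> cells (collapse (faces_cset n H) ce) m"
    using a by (simp add: ob.collapse_cells)
  moreover have "edge_rel (cube n) ce m `` cls (faces_cset n H) ce m a = cls (cube n) ce m a"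
  proof (intro subset_antisym subsetI)
    fix b assume "b \<in> edge_rel (cube n) ce m `` cls (faces_cset n H) ce m a"
    then obtain a' where a': "(a, a') \<in> edge_rel (faces_cset n H) ce m" "(a', b) \<in> edge_rel (cube n) ce m" by auto
    then have "a' \<in> cells (faces_cset n H) m" by (auto simp: edge_rel_def)
    then have "(a, a') \<in> edge_rel (cube n) ce m" using a' rel_iff a by simp
    then show "b \<in> cls (cube n) ce m a" using a' cu.equiv equivE transE by (metis Image_singleton_iff)
  next
    fix b assume "b \<in> cls (cube n) ce m a"
    moreover have "(a, a) \<in> edge_rel (faces_cset n H) ce m" using a by (simp add: edge_rel_def)
    ultimately show "b \<in> edge_rel (cube n) ce m `` cls (faces_cset n H) ce m a" by blast
  qed
  ultimately show ?thesis by (simp add: inner_open_box_incl_def inner_open_box_def open_box_faces)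
qed

lemma incl_cmono: "cmono (inner_open_box_incl n i e)"
proof -
  obtain q where q: "is_cmap q" "src q = cube n" "tgt q = collapse (cube n) ce"
    "\<And>m a. a \<in> cells (cube n) m \<Longrightarrow> app q m a = cls (cube n) ce m a"
    by (rule cu.projE) blast
  have ic: "is_cmap (faces_incl n H)" using faces_incl_cmono[OF horn_sub] by (simp add: cmono_def)
  let ?g = "q \<odot> faces_incl n H"
  have g: "is_cmap ?g" using ic q by (auto intro: comp_cmap)
  have ga: "app ?g m a = cls (cube n) ce m a" if "a \<in> cells (faces_cset n H) m" for m a
    using that q(4)[of a m] faces_sub[OF horn_sub that] by simp
  have "degen_edge (tgt ?g) (app ?g 1 ce)" using ga[OF ob.d] q(3) cu.collapse_degen by simp
  then obtain h where h: "is_cmap h" "src h = collapse (faces_cset n H) ce" "tgt h = tgt ?g"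
    "\<And>m a. a \<in> cells (faces_cset n H) m \<Longrightarrow> app h m (cls (faces_cset n H) ce m a) = app ?g m a"
    using ob.collapse_map[OF g] by auto
  have ha: "app h m (cls (faces_cset n H) ce m a) = cls (cube n) ce m a" if "a \<in> cells (faces_cset n H) m" for m a
    using h(4)[OF that] ga[OF that] by (rule trans)
  \<comment> \<open>Saturating a class of the box in the cube agrees with the map induced by the
    universal property, and the latter is already known to commute with operators.\<close>
  have "inner_open_box_incl n i e = h"
  proof -
    have "app (inner_open_box_incl n i e) m = app h m" for m
    proof (rule extensionalityI)
      show "app (inner_open_box_incl n i e) m \<in> extensional (cells (collapse (faces_cset n H) ce) m)"
        by (simp add: inner_open_box_incl_def inner_open_box_def open_box_faces)
      show "app h m \<in> extensional (cells (collapse (faces_cset n H) ce) m)" using cmap_ext[OF h(1)] h(2) by simp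
    qed (auto simp: ob.collapse_cells ha)
    then have "app (inner_open_box_incl n i e) = app h" by (rule ext)
    then show ?thesis using h(2,3) q(3) by simp
  qed
  moreover have "inj_on (app h m) (cells (src h) m)" for m
    unfolding h(2) ob.collapse_cells
  proof (rule inj_onI, elim imageE)
    fix c c' a a' assume a: "a \<in> cells (faces_cset n H) m" "a' \<in> cells (faces_cset n H) m"
      "c = cls (faces_cset n H) ce m a" "c' = cls (faces_cset n H) ce m a'" "app h m c = app h m c'"
    then have "(a, a') \<in> edge_rel (cube n) ce m"
      using cu.cls_eq_iff[of a m a'] faces_sub[OF horn_sub a(1)] faces_sub[OF horn_sub a(2)] by (simp add: ha)
    then show "c = c'" using ob.cls_eq_iff[OF a(1,2)] rel_iff[OF a(1,2)] a(3,4) by simp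
  qed
  ultimately show ?thesis using h(1) by (simp add: cmono_def)
qed

end

text \<open>There is no filler yet to restrict, so the critical edge is evaluated inside a face of
  the open box that contains it. For a compatible family the result does not depend on the
  face.\<close>

definition crit :: "'a cset \<Rightarrow> nat \<Rightarrow> nat \<Rightarrow> bool \<Rightarrow> (nat \<Rightarrow> bool \<Rightarrow> 'a) \<Rightarrow> bool" where
  "crit X n i e x \<longleftrightarrow> (\<exists>j d \<psi>. (j, d) \<in> horn n i e \<and> \<psi> \<in> box_hom 1 (n - 1) \<and>
     critical_edge n i e = compose (pow1 1) (face n j d) \<psi> \<and> degen_edge X (act X 1 (n - 1) \<psi> (x j d)))"

definition inner_fills :: "('a, 'b) cmap \<Rightarrow> bool" where
  "inner_fills p \<longleftrightarrow> (\<forall>n i e. 2 \<le> n \<and> 1 \<le> i \<and> i \<le> n \<longrightarrow> fills p n (horn n i e) (crit (src p) n i e))"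

context inner
begin

lemma crit_face:
  assumes "is_cset X" "has_faces X n H x z" "crit X n i e x"
  shows "degen_edge X (act X 1 n ce z)"
proof -
  obtain j d \<psi> where j: "(j, d) \<in> H" "\<psi> \<in> box_hom 1 (n - 1)" "ce = compose (pow1 1) (face n j d) \<psi>"
    "degen_edge X (act X 1 (n - 1) \<psi> (x j d))" using assms(3) unfolding crit_def by blast
  have "act X 1 n ce z = act X 1 (n - 1) \<psi> (x j d)"
    using cset_comp[OF assms(1) j(2) face_hom has_faces_cell[OF assms(2)], of j d]
      has_faces_face[OF assms(2) j(1)] j(3) all_facesD[OF horn_sub j(1)] by simp
  then show ?thesis using j(4) by simp
qed

lemma crit_map:
  assumes p: "is_cmap p" and x: "compat (src p) n H x" and c: "crit (src p) n i e x"
  shows "crit (tgt p) n i e (\<lambda>j d. app p (n - 1) (x j d))"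
proof -
  obtain j d \<psi> where j: "(j, d) \<in> H" "\<psi> \<in> box_hom 1 (n - 1)" "ce = compose (pow1 1) (face n j d) \<psi>"
    "degen_edge (src p) (act (src p) 1 (n - 1) \<psi> (x j d))" using c unfolding crit_def by blast
  have "degen_edge (tgt p) (act (tgt p) 1 (n - 1) \<psi> (app p (n - 1) (x j d)))"
    using degen_edge_map[OF p j(4)] cmap_nat[OF p j(2) compat_cells[OF x j(1)]] by simp
  then show ?thesis unfolding crit_def using j(1-3) by blast
qed

text \<open>With a degenerate critical edge the maps classifying the family and the cube
  \<open>y\<close> both descend to the collapses; the filler is the value of a lift at the class of
  the identity.\<close>

lemma inner_lifts_fills:
  assumes p: "is_cmap p" and l: "lifts (inner_open_box_incl n i e) p"
  shows "fills p n H (crit (src p) n i e)"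
  unfolding fills_def
proof (intro allI impI, elim conjE)
  fix x y assume x: "compat (src p) n H x" and y: "has_faces (tgt p) n H (\<lambda>j d. app p (n - 1) (x j d)) y"
    and c: "crit (src p) n i e x"
  obtain u where u: "is_cmap u" "src u = faces_cset n H" "tgt u = src p"
    "\<And>m j d \<psi>. (j, d) \<in> H \<Longrightarrow> \<psi> \<in> box_hom m (n - 1) \<Longrightarrow>
      app u m (compose (pow1 m) (face n j d) \<psi>) = act (src p) m (n - 1) \<psi> (x j d)"
    by (rule family_map[OF cmap_src[OF p] horn_sub x]) blast
  obtain v where v: "is_cmap v" "src v = cube n" "tgt v = tgt p"
    "\<And>m \<phi>. \<phi> \<in> box_hom m n \<Longrightarrow> app v m \<phi> = act (tgt p) m n \<phi> y"
    by (rule yoneda_map[OF cmap_tgt[OF p] has_faces_cell[OF y]]) blast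
  have "degen_edge (tgt u) (app u 1 ce)"
    using c u(3,4) unfolding crit_def by force
  then obtain u' where u': "is_cmap u'" "src u' = collapse (faces_cset n H) ce" "tgt u' = src p"
    "\<And>m a. a \<in> cells (faces_cset n H) m \<Longrightarrow> app u' m (cls (faces_cset n H) ce m a) = app u m a"
    using ob.collapse_map[OF u(1,2)] u(3) by auto
  have "degen_edge (tgt v) (app v 1 ce)"
    using crit_face[OF cmap_tgt[OF p] y crit_map[OF p x c]] v(3,4) critical_edge_hom[OF i] by simp
  then obtain v' where v': "is_cmap v'" "src v' = collapse (cube n) ce" "tgt v' = tgt p"
    "\<And>m a. a \<in> cells (cube n) m \<Longrightarrow> app v' m (cls (cube n) ce m a) = app v m a"
    using cu.collapse_map[OF v(1,2)] v(3) by auto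
  have ic: "is_cmap (inner_open_box_incl n i e)" using incl_cmono by (simp add: cmono_def)
  have "p \<odot> u' = v' \<odot> inner_open_box_incl n i e"
  proof (rule cmap_eqI)
    fix m c assume "c \<in> cells (src (p \<odot> u')) m"
    then obtain \<phi> where \<phi>: "\<phi> \<in> cells (faces_cset n H) m" and c: "c = cls (faces_cset n H) ce m \<phi>"
      using u' by (auto simp: ob.collapse_cells)
    then obtain j d \<psi> where j: "(j, d) \<in> H" "\<psi> \<in> box_hom m (n - 1)" "\<phi> = compose (pow1 m) (face n j d) \<psi>"
      by (elim facesE)
    have \<phi>h: "\<phi> \<in> box_hom m n" using faces_sub[OF horn_sub \<phi>] .
    have "c \<in> cells (collapse (faces_cset n H) ce) m" using \<phi> c by (simp add: ob.collapse_cells)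
    then show "app (p \<odot> u') m c = app (v' \<odot> inner_open_box_incl n i e) m c"
      using u'(2) u'(4)[OF \<phi>] v'(4)[of \<phi> m] \<phi>h u(4)[OF j(1,2)] v(4)[OF \<phi>h] incl_app[OF \<phi>]
        family_nat[OF p x horn_sub y j(1,2)] c j(3) by simp
  qed (use u' v' p ic in \<open>auto intro: comp_cmap\<close>)
  then obtain h where h: "is_cmap h" "src h = collapse (cube n) ce" "tgt h = src p"
      "h \<odot> inner_open_box_incl n i e = u'" "p \<odot> h = v'"
    using liftsE[OF l u'(1) _ u'(3) v'(1) _ v'(3)] u'(2) v'(2) by (metis incl_sel)
  let ?id = "cls (cube n) ce n (box_id n)"
  let ?z = "app h n ?id"
  have idc: "?id \<in> cells (collapse (cube n) ce) n" by (simp add: cu.collapse_cells)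
  have z: "?z \<in> cells (src p) n" using cmap_app[OF h(1), of ?id n] idc h(2,3) by simp
  have "act (src p) (n - 1) n (face n j d) ?z = x j d" if j: "(j, d) \<in> H" for j d
  proof -
    have f: "face n j d \<in> box_hom (n - 1) n" using all_facesD[OF horn_sub j] by (auto intro: face_hom)
    have fm: "face n j d \<in> cells (faces_cset n H) (n - 1)" using face_mem[OF horn_sub j] .
    let ?f = "cls (faces_cset n H) ce (n - 1) (face n j d)"
    have "?f \<in> cells (collapse (faces_cset n H) ce) (n - 1)" using fm by (simp add: ob.collapse_cells)
    then have "app u' (n - 1) ?f = app h (n - 1) (cls (cube n) ce (n - 1) (face n j d))"
      using incl_app[OF fm] by (simp flip: h(4))
    also have "cls (cube n) ce (n - 1) (face n j d) = act (collapse (cube n) ce) (n - 1) n (face n j d) ?id"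
      using cu.collapse_act[OF f, of "box_id n"] by (simp add: compose_id_op(1)[OF f])
    also have "app h (n - 1) \<dots> = act (src p) (n - 1) n (face n j d) ?z"
      using cmap_nat[OF h(1) f, of ?id] idc h(2,3) by simp
    finally have "app u' (n - 1) ?f = act (src p) (n - 1) n (face n j d) ?z" .
    moreover have "app u (n - 1) (face n j d) = x j d"
      using u(4)[OF j box_id_hom] compose_id_op(2)[OF f] cset_id[OF cmap_src[OF p] compat_cells[OF x j]] by simp
    ultimately show ?thesis using u'(4)[OF fm] by simp
  qed
  moreover have "app p n ?z = app v' n ?id" using idc h(2) by (simp flip: h(5))
  moreover have "app v' n ?id = y"
    using v'(4)[of "box_id n" n] v(4)[OF box_id_hom] has_faces_cell[OF y] p by simp
  ultimately show "\<exists>z. has_faces (src p) n H x z \<and> app p n z = y"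
    using z unfolding has_faces_def by auto
qed

text \<open>The square is pulled back along the two collapse projections. The critical edge is
  degenerate in the collapsed box, so the resulting family has an admissible filler, whose
  classifying map descends again.\<close>

lemma inner_fills_lifts:
  assumes p: "is_cmap p" and fill: "fills p n H (crit (src p) n i e)"
  shows "lifts (inner_open_box_incl n i e) p"
  unfolding lifts_def
proof (intro allI impI, elim conjE)
  fix u v assume u: "is_cmap u" "src u = src (inner_open_box_incl n i e)" "tgt u = src p"
    and v: "is_cmap v" "src v = tgt (inner_open_box_incl n i e)" "tgt v = tgt p"
    and sq: "p \<odot> u = v \<odot> inner_open_box_incl n i e"
  have ic: "is_cmap (inner_open_box_incl n i e)" using incl_cmono by (simp add: cmono_def)
  obtain q where q: "is_cmap q" "src q = faces_cset n H" "tgt q = collapse (faces_cset n H) ce"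
    "\<And>m a. a \<in> cells (faces_cset n H) m \<Longrightarrow> app q m a = cls (faces_cset n H) ce m a"
    by (rule ob.projE) blast
  obtain r where r: "is_cmap r" "src r = cube n" "tgt r = collapse (cube n) ce"
    "\<And>m a. a \<in> cells (cube n) m \<Longrightarrow> app r m a = cls (cube n) ce m a"
    by (rule cu.projE) blast
  have uq: "is_cmap (u \<odot> q)" "src (u \<odot> q) = faces_cset n H" "tgt (u \<odot> q) = src p"
    using u q by (auto intro: comp_cmap)
  have vr: "is_cmap (v \<odot> r)" "src (v \<odot> r) = cube n" "tgt (v \<odot> r) = tgt p"
    using v r by (auto intro: comp_cmap)
  define x where "x j d = app (u \<odot> q) (n - 1) (face n j d)" for j d
  define y where "y = app (v \<odot> r) n (box_id n)"
  have x: "compat (src p) n H x" unfolding x_def by (rule map_family(1)[OF uq horn_sub])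
  have xa: "app (u \<odot> q) m (compose (pow1 m) (face n j d) \<psi>) = act (src p) m (n - 1) \<psi> (x j d)"
    if "(j, d) \<in> H" "\<psi> \<in> box_hom m (n - 1)" for m j d \<psi>
    unfolding x_def using map_family(2)[OF uq horn_sub that] .
  have uv: "app p m (app (u \<odot> q) m a) = app (v \<odot> r) m a" if a: "a \<in> cells (faces_cset n H) m" for m a
  proof -
    have "cls (faces_cset n H) ce m a \<in> cells (src (inner_open_box_incl n i e)) m"
      using a by (simp add: ob.collapse_cells)
    from square_app[OF sq u(2) this] show ?thesis
      using a q r faces_sub[OF horn_sub a] by simp
  qed
  have y: "has_faces (tgt p) n H (\<lambda>j d. app p (n - 1) (x j d)) y"
    unfolding has_faces_def
  proof (intro conjI allI impI)
    fix j d assume j: "(j, d) \<in> H"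
    have f: "face n j d \<in> box_hom (n - 1) n" using all_facesD[OF horn_sub j] by (auto intro: face_hom)
    show "act (tgt p) (n - 1) n (face n j d) y = app p (n - 1) (x j d)"
      unfolding x_def uv[OF face_mem[OF horn_sub j]] cube_map[OF vr(1,2) f] y_def vr(3) ..
  qed (use cube_map_cell[OF vr(1,2)] vr(3) y_def in simp)
  have "crit (src p) n i e x"
  proof -
    obtain j \<psi> where j: "(j, \<not> e) \<in> H" "\<psi> \<in> box_hom 1 (n - 1)" "ce = compose (pow1 1) (face n j (\<not> e)) \<psi>"
      by (rule critical_edge_mem[OF n i, of e]) blast
    have "degen_edge (tgt u) (app u 1 (cls (faces_cset n H) ce 1 ce))"
      by (rule degen_edge_map[OF u(1)]) (simp add: u(2) ob.collapse_degen)
    then have "degen_edge (src p) (app (u \<odot> q) 1 ce)"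
      using u(3) q(2,4) ob.d by simp
    then have "degen_edge (src p) (act (src p) 1 (n - 1) \<psi> (x j (\<not> e)))"
      using xa[OF j(1,2)] j(3) by simp
    then show ?thesis unfolding crit_def using j by blast
  qed
  then obtain z where z: "has_faces (src p) n H x z" "app p n z = y"
    using fill x y unfolding fills_def by blast
  obtain g where g: "is_cmap g" "src g = cube n" "tgt g = src p"
    "\<And>m \<phi>. \<phi> \<in> box_hom m n \<Longrightarrow> app g m \<phi> = act (src p) m n \<phi> z"
    by (rule yoneda_map[OF cmap_src[OF p] has_faces_cell[OF z(1)]]) blast
  have "degen_edge (tgt g) (app g 1 ce)"
    using crit_face[OF cmap_src[OF p] z(1) \<open>crit (src p) n i e x\<close>] g(3,4) critical_edge_hom[OF i] by simp
  then obtain h where h: "is_cmap h" "src h = collapse (cube n) ce" "tgt h = src p"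
    "\<And>m a. a \<in> cells (cube n) m \<Longrightarrow> app h m (cls (cube n) ce m a) = app g m a"
    using cu.collapse_map[OF g(1,2)] g(3) by auto
  have "h \<odot> inner_open_box_incl n i e = u"
  proof (rule cmap_eqI)
    fix m c assume "c \<in> cells (src (h \<odot> inner_open_box_incl n i e)) m"
    then obtain \<phi> where \<phi>: "\<phi> \<in> cells (faces_cset n H) m" and c: "c = cls (faces_cset n H) ce m \<phi>"
      by (auto simp: ob.collapse_cells)
    then obtain j d \<psi> where j: "(j, d) \<in> H" "\<psi> \<in> box_hom m (n - 1)" "\<phi> = compose (pow1 m) (face n j d) \<psi>"
      by (elim facesE)
    have \<phi>h: "\<phi> \<in> box_hom m n" using faces_sub[OF horn_sub \<phi>] .
    have "c \<in> cells (collapse (faces_cset n H) ce) m" using \<phi> c by (simp add: ob.collapse_cells)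
    then have "app (h \<odot> inner_open_box_incl n i e) m c = act (src p) m n \<phi> z"
      using incl_app[OF \<phi>] c h(4)[of \<phi> m] g(4)[OF \<phi>h] \<phi>h by simp
    also have "\<dots> = act (src p) m (n - 1) \<psi> (x j d)"
      using cset_comp[OF cmap_src[OF p] j(2) face_hom has_faces_cell[OF z(1)], of j d]
        has_faces_face[OF z(1) j(1)] all_facesD[OF horn_sub j(1)] j(3) by simp
    also have "\<dots> = app u m c" using xa[OF j(1,2)] j(3) \<phi> q(2,4) c by simp
    finally show "app (h \<odot> inner_open_box_incl n i e) m c = app u m c" .
  qed (use u h ic in \<open>auto intro: comp_cmap\<close>)
  moreover have "p \<odot> h = v"
  proof (rule cmap_eqI)
    fix m c assume "c \<in> cells (src (p \<odot> h)) m"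
    then obtain \<phi> where \<phi>: "\<phi> \<in> box_hom m n" and c: "c = cls (cube n) ce m \<phi>"
      using h(2) by (auto simp: cu.collapse_cells)
    have "c \<in> cells (collapse (cube n) ce) m" using \<phi> c by (simp add: cu.collapse_cells)
    then have "app (p \<odot> h) m c = app p m (act (src p) m n \<phi> z)"
      using h(2) h(4)[of \<phi> m] g(4)[OF \<phi>] \<phi> c by simp
    also have "\<dots> = app (v \<odot> r) m \<phi>"
      using cmap_nat[OF p \<phi> has_faces_cell[OF z(1)]] z(2) cube_map[OF vr(1,2) \<phi>] vr(3) y_def by simp
    also have "\<dots> = app v m c" using r(2,4) \<phi> c by simp
    finally show "app (p \<odot> h) m c = app v m c" .
  qed (use p v h in \<open>auto intro: comp_cmap\<close>)
  ultimately show "\<exists>h. is_cmap h \<and> src h = tgt (inner_open_box_incl n i e) \<and> tgt h = src p \<and>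
      h \<odot> inner_open_box_incl n i e = u \<and> p \<odot> h = v"
    using h by auto
qed

end

section \<open>Maps to the point\<close>

lemma pt_sel [simp]: "cells pt n = {undefined}" "act pt m n \<phi> x = x"
  by (simp_all add: pt_def)

lemma pt_cset [simp]: "is_cset pt"
  by (simp add: is_cset_def)

lemma to_pt_sel [simp]: "src (to_pt X) = X" "tgt (to_pt X) = pt" "x \<in> cells X n \<Longrightarrow> app (to_pt X) n x = undefined"
  by (simp_all add: to_pt_def)

lemma to_pt_cmap [simp]: "is_cset X \<Longrightarrow> is_cmap (to_pt X)"
  unfolding to_pt_def by (rule cmapI) auto

lemma to_pt_unique:
  assumes "is_cmap f" "tgt f = pt"
  shows "f = to_pt (src f)"
  by (rule cmap_eqI) (use assms cmap_app[OF assms(1)] in auto)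

section \<open>Mapping spaces\<close>

lemma const_vertex_act: "const_vertex X n x = act X n 0 (const_op n) x"
  by (simp add: const_vertex_def const_op_def)

lemma const_vertex_cell: "is_cset X \<Longrightarrow> x \<in> cells X 0 \<Longrightarrow> const_vertex X n x \<in> cells X n"
  unfolding const_vertex_act by (rule cset_act) auto

lemma act_const_vertex:
  "is_cset X \<Longrightarrow> x \<in> cells X 0 \<Longrightarrow> \<phi> \<in> box_hom m n \<Longrightarrow> act X m n \<phi> (const_vertex X n x) = const_vertex X m x"
  unfolding const_vertex_act using cset_comp[of X \<phi> m n "const_op n" 0 x] const_op_comp[of \<phi> m n] by simp

lemma map_const_vertex:
  "is_cmap f \<Longrightarrow> x \<in> cells (src f) 0 \<Longrightarrow> app f n (const_vertex (src f) n x) = const_vertex (tgt f) n (app f 0 x)"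
  unfolding const_vertex_act using cmap_nat[of f "const_op n" n 0 x] by simp

lemma degen_edge_const_vertex: "x \<in> cells X 0 \<Longrightarrow> degen_edge X (const_vertex X 1 x)"
  unfolding const_vertex_act degen_edge_def by blast

lemma mapping_space_cells:
  "s \<in> cells (mapping_space X x0 x1) n \<longleftrightarrow> s \<in> cells X (Suc n) \<and>
    (\<forall>d. act X n (Suc n) (face (Suc n) (Suc n) d) s = const_vertex X n (if d then x1 else x0))"
  by (auto simp: mapping_space_def all_bool_eq simp flip: Suc_eq_plus1)

lemma mapping_space_act:
  "act (mapping_space X x0 x1) m n \<phi> s = act X (Suc m) (Suc n) (op_times_id m \<phi>) s"
  by (simp add: mapping_space_def flip: Suc_eq_plus1)

lemma mapping_space_cset [simp]:
  assumes X: "is_cset X" and x: "x0 \<in> cells X 0" "x1 \<in> cells X 0"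
  shows "is_cset (mapping_space X x0 x1)"
  unfolding is_cset_def mapping_space_act
proof (intro conjI allI ballI)
  fix m n \<phi> s assume \<phi>: "\<phi> \<in> box_hom m n" and s: "s \<in> cells (mapping_space X x0 x1) n"
  have sc: "s \<in> cells X (Suc n)" using s by (simp add: mapping_space_cells)
  have f: "face (Suc k) (Suc k) d \<in> box_hom k (Suc k)" for k d using face_hom[of "Suc k" "Suc k" d] by simp
  have "act X m (Suc m) (face (Suc m) (Suc m) d) (act X (Suc m) (Suc n) (op_times_id m \<phi>) s) =
      const_vertex X m (if d then x1 else x0)" for d
  proof -
    have "act X m (Suc m) (face (Suc m) (Suc m) d) (act X (Suc m) (Suc n) (op_times_id m \<phi>) s) =
        act X m n \<phi> (act X n (Suc n) (face (Suc n) (Suc n) d) s)"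
      using cset_comp[OF X f op_times_id_hom[OF \<phi>] sc, of d] cset_comp[OF X \<phi> f sc, of d]
      by (simp add: face_last_natural[OF \<phi>])
    then show ?thesis using s x act_const_vertex[OF X _ \<phi>] by (simp add: mapping_space_cells)
  qed
  then show "act X (Suc m) (Suc n) (op_times_id m \<phi>) s \<in> cells (mapping_space X x0 x1) m"
    using cset_act[OF X op_times_id_hom[OF \<phi>] sc] by (simp add: mapping_space_cells)
next
  fix n s assume "s \<in> cells (mapping_space X x0 x1) n"
  then show "act X (Suc n) (Suc n) (op_times_id n (box_id n)) s = s"
    using X by (simp add: op_times_id_id mapping_space_cells)
next
  fix k m n \<psi> \<phi> s assume "\<psi> \<in> box_hom k m" "\<phi> \<in> box_hom m n" "s \<in> cells (mapping_space X x0 x1) n"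
  then show "act X (Suc k) (Suc m) (op_times_id k \<psi>) (act X (Suc m) (Suc n) (op_times_id m \<phi>) s) =
      act X (Suc k) (Suc n) (op_times_id k (compose (pow1 k) \<phi> \<psi>)) s"
    using cset_comp[OF X op_times_id_hom op_times_id_hom] by (simp add: op_times_id_comp mapping_space_cells)
qed

lemma mapping_space_map_sel [simp]:
  "src (mapping_space_map f x0 x1) = mapping_space (src f) x0 x1"
  "tgt (mapping_space_map f x0 x1) = mapping_space (tgt f) (app f 0 x0) (app f 0 x1)"
  "s \<in> cells (mapping_space (src f) x0 x1) n \<Longrightarrow> app (mapping_space_map f x0 x1) n s = app f (Suc n) s"
  by (simp_all add: mapping_space_map_def flip: Suc_eq_plus1)

lemma mapping_space_map_cmap:
  assumes f: "is_cmap f" and x: "x0 \<in> cells (src f) 0" "x1 \<in> cells (src f) 0"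
  shows "is_cmap (mapping_space_map f x0 x1)"
  unfolding mapping_space_map_def Suc_eq_plus1[symmetric]
proof (rule cmapI)
  fix n s assume s: "s \<in> cells (mapping_space (src f) x0 x1) n"
  have "face (Suc n) (Suc n) d \<in> box_hom n (Suc n)" for d using face_hom[of "Suc n" "Suc n" d] by simp
  then show "app f (Suc n) s \<in> cells (mapping_space (tgt f) (app f 0 x0) (app f 0 x1)) n"
    using s x cmap_app[OF f] cmap_nat[OF f, of _ n "Suc n" s, symmetric] map_const_vertex[OF f]
    by (simp add: mapping_space_cells)
next
  fix m n \<phi> s assume "\<phi> \<in> box_hom m n" "s \<in> cells (mapping_space (src f) x0 x1) n"
  then show "app f (Suc m) (act (mapping_space (src f) x0 x1) m n \<phi> s) =
      act (mapping_space (tgt f) (app f 0 x0) (app f 0 x1)) m n \<phi> (app f (Suc n) s)"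
    using cmap_nat[OF f op_times_id_hom, of \<phi> m n s] by (simp add: mapping_space_act mapping_space_cells)
qed (use f x cmap_app[OF f] in simp_all)

section \<open>Transposition of filling problems into one dimension higher\<close>

definition with_ends :: "nat \<Rightarrow> 'a \<Rightarrow> 'a \<Rightarrow> (nat \<Rightarrow> bool \<Rightarrow> 'a) \<Rightarrow> nat \<Rightarrow> bool \<Rightarrow> 'a" where
  "with_ends n c0 c1 x j d = (if j = Suc n then (if d then c1 else c0) else x j d)"

lemma mapping_space_face:
  "1 \<le> j \<Longrightarrow> j \<le> n \<Longrightarrow>
    act (mapping_space X x0 x1) (n - 1) n (face n j d) s = act X n (Suc n) (face (Suc n) j d) s"
  by (simp add: mapping_space_act op_times_id_face)

lemma op_times_id_face2:
  assumes "1 \<le> j" "j \<le> n - 1"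
  shows "op_times_id (n - 2) (face (n - 1) j d) = face n j d"
  using op_times_id_face[OF assms, of d] assms by (metis Suc_diff_1 diff_diff_left le_trans nat_1_add_1 not_one_le_zero neq0_conv diff_0_eq_0)

text \<open>\<open>E\<close> selects the last faces that belong to the family: both of them when the
  ends of a path are fixed, only the initial one when a path is to be constructed from its
  start.\<close>

lemma with_ends_compat:
  assumes S: "S \<subseteq> all_faces n" and E: "E \<subseteq> {Suc n} \<times> UNIV"
    and c: "\<And>d. (Suc n, d) \<in> E \<Longrightarrow> (if d then c1 else c0) \<in> cells X n"
    and x: "\<And>j d. (j, d) \<in> S \<Longrightarrow> x j d \<in> cells X n"
    and xx: "\<And>j d k d'. (j, d) \<in> S \<Longrightarrow> (k, d') \<in> S \<Longrightarrow> j < k \<Longrightarrow>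
      act X (n - 1) n (face n j d) (x k d') = act X (n - 1) n (face n (k - 1) d') (x j d)"
    and xc: "\<And>j d d'. (j, d) \<in> S \<Longrightarrow> (Suc n, d') \<in> E \<Longrightarrow>
      act X (n - 1) n (face n j d) (if d' then c1 else c0) = act X (n - 1) n (face n n d') (x j d)"
  shows "compat X (Suc n) (S \<union> E) (with_ends n c0 c1 x)"
proof -
  have jn: "1 \<le> j \<and> j \<le> n" if "(j, d) \<in> S" for j d using all_facesD[OF S that] .
  have jS: "j \<noteq> Suc n" if "(j, d) \<in> S" for j d using jn[OF that] by simp
  have e: "Suc n - 2 = n - 1" "Suc n - 1 = n" by simp_all
  show ?thesis
    unfolding compat_def e
  proof (intro conjI allI impI)
    fix j d assume "(j, d) \<in> S \<union> E"
    then show "with_ends n c0 c1 x j d \<in> cells X n"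
      using x[of j d] c[of d] jS[of j d] E by (auto simp: with_ends_def split: if_splits)
  next
    fix j d k d' assume jk: "(j, d) \<in> S \<union> E \<and> (k, d') \<in> S \<union> E \<and> j < k"
    have "k \<le> Suc n" using jk jn[of k d'] E by auto
    then have j: "(j, d) \<in> S" using jk E by auto
    show "act X (n - 1) n (face n j d) (with_ends n c0 c1 x k d') =
        act X (n - 1) n (face n (k - 1) d') (with_ends n c0 c1 x j d)"
    proof (cases "(k, d') \<in> S")
      case True
      then show ?thesis using xx[OF j True] jk jS[OF j] jS[OF True] by (simp add: with_ends_def)
    next
      case False
      then have "(Suc n, d') \<in> E" "k = Suc n" using jk E by auto
      then show ?thesis using xc[OF j] jS[OF j] by (simp add: with_ends_def)
    qed
  qed
qed

lemma mapping_space_compat: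
  assumes X: "is_cset X" and v: "x0 \<in> cells X 0" "x1 \<in> cells X 0" and S: "S \<subseteq> all_faces n"
    and x: "compat (mapping_space X x0 x1) n S x"
  shows "compat X (Suc n) (S \<union> {Suc n} \<times> UNIV) (with_ends n (const_vertex X n x0) (const_vertex X n x1) x)"
proof (rule with_ends_compat[OF S])
  have jn: "1 \<le> j \<and> j \<le> n" if "(j, d) \<in> S" for j d using all_facesD[OF S that] .
  have xc: "x j d \<in> cells X n" "act X (n - 1) n (face n n d') (x j d) = const_vertex X (n - 1) (if d' then x1 else x0)"
    if "(j, d) \<in> S" for j d d'
    using compat_cells[OF x that] jn[OF that] by (simp_all add: mapping_space_cells)
  show "x j d \<in> cells X n" if "(j, d) \<in> S" for j d using xc(1)[OF that] .
  show "act X (n - 1) n (face n j d) (if d' then const_vertex X n x1 else const_vertex X n x0) =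
      act X (n - 1) n (face n n d') (x j d)" if j: "(j, d) \<in> S" for j d d'
    using act_const_vertex[OF X _ face_hom, of _ j n d] jn[OF j] v xc(2)[OF j, of d'] by simp
  show "act X (n - 1) n (face n j d) (x k d') = act X (n - 1) n (face n (k - 1) d') (x j d)"
    if jk: "(j, d) \<in> S" "(k, d') \<in> S" "j < k" for j d k d'
  proof -
    have "act (mapping_space X x0 x1) (n - 2) (n - 1) (face (n - 1) j d) (x k d') =
        act (mapping_space X x0 x1) (n - 2) (n - 1) (face (n - 1) (k - 1) d') (x j d)"
      using x jk unfolding compat_def by blast
    moreover have "j \<le> n - 1" "1 \<le> j" "1 \<le> k - 1" "k - 1 \<le> n - 1" "Suc (n - 2) = n - 1" "Suc (n - 1) = n"
      using jn[OF jk(1)] jn[OF jk(2)] jk(3) by linarith+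
    ultimately show ?thesis by (simp add: mapping_space_act op_times_id_face2)
  qed
qed (use const_vertex_cell[OF X] v in auto)

text \<open>The general \<open>S\<close> and \<open>C\<close> cover open boxes and boundaries at
  once. The condition \<open>C\<close> must hold whatever \<open>x\<close> is, since for open boxes
  it is witnessed in the constant last faces alone.\<close>

lemma mapping_space_fills:
  assumes f: "is_cmap f" and v: "x0 \<in> cells (src f) 0" "x1 \<in> cells (src f) 0" and S: "S \<subseteq> all_faces n"
    and fill: "fills f (Suc n) (S \<union> {Suc n} \<times> UNIV) C"
    and C: "\<And>x. C (with_ends n (const_vertex (src f) n x0) (const_vertex (src f) n x1) x)"
  shows "fills (mapping_space_map f x0 x1) n S (\<lambda>_. True)"
  unfolding fills_def
proof (intro allI impI, elim conjE)
  let ?p = "mapping_space_map f x0 x1"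
  let ?S = "S \<union> {Suc n} \<times> UNIV"
  fix x y assume x: "compat (src ?p) n S x" and y: "has_faces (tgt ?p) n S (\<lambda>j d. app ?p (n - 1) (x j d)) y"
  let ?x = "with_ends n (const_vertex (src f) n x0) (const_vertex (src f) n x1) x"
  have jn: "1 \<le> j \<and> j \<le> n" if "(j, d) \<in> S" for j d using all_facesD[OF S that] .
  have yc: "y \<in> cells (tgt f) (Suc n)"
    "act (tgt f) n (Suc n) (face (Suc n) (Suc n) d) y = const_vertex (tgt f) n (if d then app f 0 x1 else app f 0 x0)" for d
    using has_faces_cell[OF y] by (simp_all add: mapping_space_cells)
  have "compat (src f) (Suc n) ?S ?x"
    by (rule mapping_space_compat[OF cmap_src[OF f] v S]) (use x in simp)
  moreover have "has_faces (tgt f) (Suc n) ?S (\<lambda>j d. app f (Suc n - 1) (?x j d)) y"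
    unfolding has_faces_def
  proof (intro conjI allI impI)
    fix j d assume jd: "(j, d) \<in> ?S"
    show "act (tgt f) (Suc n - 1) (Suc n) (face (Suc n) j d) y = app f (Suc n - 1) (?x j d)"
    proof (cases "(j, d) \<in> S")
      case True
      have "x j d \<in> cells (mapping_space (src f) x0 x1) (n - 1)" using compat_cells[OF x True] by simp
      then show ?thesis
        using has_faces_face[OF y True] jn[OF True] by (simp add: mapping_space_face with_ends_def)
    next
      case False
      then have "j = Suc n" using jd by auto
      then show ?thesis using yc(2)[of d] map_const_vertex[OF f] v by (simp add: with_ends_def)
    qed
  qed (rule yc(1))
  ultimately obtain z where z: "has_faces (src f) (Suc n) ?S ?x z" "app f (Suc n) z = y"
    using fill C unfolding fills_def by blast
  have zm: "z \<in> cells (mapping_space (src f) x0 x1) n"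
    using has_faces_cell[OF z(1)] has_faces_face[OF z(1), of "Suc n"] by (simp add: mapping_space_cells with_ends_def)
  moreover have "act (mapping_space (src f) x0 x1) (n - 1) n (face n j d) z = x j d" if "(j, d) \<in> S" for j d
    using has_faces_face[OF z(1), of j d] that jn[OF that] by (simp add: mapping_space_face with_ends_def)
  ultimately show "\<exists>z. has_faces (src ?p) n S x z \<and> app ?p n z = y"
    using z(2) unfolding has_faces_def by auto
qed

lemma all_faces_Suc: "all_faces (Suc n) = all_faces n \<union> {Suc n} \<times> UNIV"
  by (auto simp: all_faces_def)

lemma horn_Suc: "i \<le> n \<Longrightarrow> horn (Suc n) i e = horn n i e \<union> {Suc n} \<times> UNIV"
  by (auto simp: horn_def all_faces_Suc)

lemma mapping_space_kan:
  assumes f: "is_cmap f" and v: "x0 \<in> cells (src f) 0" "x1 \<in> cells (src f) 0" and fill: "inner_fills f"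
  shows "kan_fibration (mapping_space_map f x0 x1)"
proof (rule kan_fibrationI)
  fix n i :: nat and e assume i: "1 \<le> i" "i \<le> n"
  show "fills (mapping_space_map f x0 x1) n (horn n i e) (\<lambda>_. True)"
  proof (rule mapping_space_fills[OF f v horn_sub])
    show "fills f (Suc n) (horn n i e \<union> {Suc n} \<times> UNIV) (crit (src f) (Suc n) i e)"
      using fill[unfolded inner_fills_def, rule_format, of "Suc n" i e] i horn_Suc[OF i(2)] by simp
    fix x
    \<comment> \<open>Direction \<open>i\<close> differs from the last one, so the critical edge
      lies in the last face at \<open>\<not> e\<close>, and this face is constant at a
      vertex.\<close>
    obtain \<psi> where \<psi>: "\<psi> \<in> box_hom 1 (Suc n - 1)"
      "critical_edge (Suc n) i e = compose (pow1 1) (face (Suc n) (Suc n) (\<not> e)) \<psi>"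
      by (rule critical_edge_face[of i "Suc n" "Suc n" e]) (use i in auto)
    have "degen_edge (src f) (act (src f) 1 (Suc n - 1) \<psi>
        (with_ends n (const_vertex (src f) n x0) (const_vertex (src f) n x1) x (Suc n) (\<not> e)))"
      using act_const_vertex[OF cmap_src[OF f] _ \<psi>(1)] degen_edge_const_vertex v
      by (cases e) (simp_all add: with_ends_def)
    then show "crit (src f) (Suc n) i e (with_ends n (const_vertex (src f) n x0) (const_vertex (src f) n x1) x)"
      unfolding crit_def horn_Suc[OF i(2)] using \<psi> by blast
  qed
qed (rule mapping_space_map_cmap[OF f v])

lemma mapping_space_boundary_fills:
  assumes f: "is_cmap f" and v: "x0 \<in> cells (src f) 0" "x1 \<in> cells (src f) 0"
    and fill: "fills f (Suc n) (all_faces (Suc n)) (\<lambda>_. True)"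
  shows "fills (mapping_space_map f x0 x1) n (all_faces n) (\<lambda>_. True)"
  by (rule mapping_space_fills[OF f v _ fill[unfolded all_faces_Suc]]) auto

text \<open>A mapping space of the point is the point, so the statement on quasicategories is the
  relative one for the map to the point.\<close>

lemma mapping_space_to_pt:
  assumes "is_cset X" "x0 \<in> cells X 0" "x1 \<in> cells X 0"
  shows "mapping_space_map (to_pt X) x0 x1 = to_pt (mapping_space X x0 x1)"
proof -
  have "tgt (mapping_space_map (to_pt X) x0 x1) = pt"
    using assms by (simp add: mapping_space_def const_vertex_def) (simp add: pt_def)
  then show ?thesis
    using to_pt_unique[OF mapping_space_map_cmap[of "to_pt X" x0 x1]] assms by simp
qed

lemma inner_lifts_fills_all:
  assumes "is_cmap p" "\<And>n i e. 2 \<le> n \<Longrightarrow> 1 \<le> i \<Longrightarrow> i \<le> n \<Longrightarrow> lifts (inner_open_box_incl n i e) p"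
  shows "inner_fills p"
  unfolding inner_fills_def using assms inner.inner_lifts_fills[OF inner.intro] by blast

lemma quasicategory_inner_fills:
  fixes X :: "'a cset"
  assumes "cubical_quasicategory X"
  shows "inner_fills (to_pt X :: ('a, 'a) cmap)"
  by (rule inner_lifts_fills_all) (use assms in \<open>auto simp: cubical_quasicategory_def\<close>)

lemma quasicategory_mapping_space:
  fixes X :: "'a cset"
  assumes X: "cubical_quasicategory X" and v: "x0 \<in> cells X 0" "x1 \<in> cells X 0"
  shows "cubical_kan_complex (mapping_space X x0 x1)"
proof -
  have c: "is_cset X" using X by (simp add: cubical_quasicategory_def)
  have "kan_fibration (mapping_space_map (to_pt X :: ('a, 'a) cmap) x0 x1)"
    by (rule mapping_space_kan) (use c v quasicategory_inner_fills[OF X] in simp_all)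
  then show ?thesis using c v by (simp add: cubical_kan_complex_def mapping_space_to_pt)
qed

section \<open>Paths that are constant on vertices\<close>

lemma op_times_id_vertex:
  assumes "v \<in> box_hom 0 n"
  shows "op_times_id 0 v \<in> box_hom 1 (Suc n)"
  using op_times_id_hom[OF assms] by (simp add: One_nat_def)

lemma op_times_id_vertex_comp:
  assumes "v \<in> box_hom 0 m"
  shows "compose (pow1 1) (op_times_id m \<phi>) (op_times_id 0 v) = op_times_id 0 (compose (pow1 0) \<phi> v)"
  using op_times_id_comp[OF assms, of \<phi>] by (simp add: One_nat_def)

lemma face_last_hom: "face (Suc n) (Suc n) d \<in> box_hom n (Suc n)"
  using face_hom[of "Suc n" "Suc n" d] by simp

lemma degen_last_hom: "degen (Suc n) (Suc n) \<in> box_hom (Suc n) n"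
  using degen_hom[of "Suc n" "Suc n"] by simp

lemma face_Suc_hom: "1 \<le> j \<Longrightarrow> j \<le> n \<Longrightarrow> face (Suc n) j d \<in> box_hom n (Suc n)"
  using face_hom[of j "Suc n" d] by simp

text \<open>The edges in the path direction over the vertices; among them are the critical edges of
  the boxes that lack an end of the path.\<close>

definition vertex_const :: "'a cset \<Rightarrow> nat \<Rightarrow> 'a \<Rightarrow> bool" where
  "vertex_const Y n \<gamma> \<longleftrightarrow> (\<forall>v\<in>box_hom 0 n. degen_edge Y (act Y 1 (Suc n) (op_times_id 0 v) \<gamma>))"

lemma vertex_const_act:
  assumes Y: "is_cset Y" and g: "\<gamma> \<in> cells Y (Suc n)" "vertex_const Y n \<gamma>" and \<phi>: "\<phi> \<in> box_hom m n"
  shows "vertex_const Y m (act Y (Suc m) (Suc n) (op_times_id m \<phi>) \<gamma>)"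
  unfolding vertex_const_def
proof
  fix v assume v: "v \<in> box_hom 0 m"
  have "act Y 1 (Suc m) (op_times_id 0 v) (act Y (Suc m) (Suc n) (op_times_id m \<phi>) \<gamma>) =
      act Y 1 (Suc n) (op_times_id 0 (compose (pow1 0) \<phi> v)) \<gamma>"
    using cset_comp[OF Y op_times_id_vertex[OF v] op_times_id_hom[OF \<phi>] g(1)] op_times_id_vertex_comp[OF v] by simp
  then show "degen_edge Y (act Y 1 (Suc m) (op_times_id 0 v) (act Y (Suc m) (Suc n) (op_times_id m \<phi>) \<gamma>))"
    using g(2) comp_hom[OF \<phi> v] unfolding vertex_const_def by simp
qed

text \<open>The edge over a vertex lies in every face through that vertex, so one good face through
  each vertex is enough.\<close>

lemma vertex_const_faces:
  assumes Y: "is_cset Y" and g: "\<gamma> \<in> cells Y (Suc n)"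
    and f: "\<And>v. v \<in> box_hom 0 n \<Longrightarrow> \<exists>j d. 1 \<le> j \<and> j \<le> n \<and> v [] ! (j - 1) = d \<and>
      vertex_const Y (n - 1) (act Y n (Suc n) (face (Suc n) j d) \<gamma>)"
  shows "vertex_const Y n \<gamma>"
  unfolding vertex_const_def
proof
  fix v assume v: "v \<in> box_hom 0 n"
  obtain j d where j: "1 \<le> j" "j \<le> n" "v [] ! (j - 1) = d"
    "vertex_const Y (n - 1) (act Y n (Suc n) (face (Suc n) j d) \<gamma>)" using f[OF v] by blast
  obtain w where w: "w \<in> box_hom 0 (n - 1)" "v = compose (pow1 0) (face n j d) w"
    by (rule coordinate_factor[OF v j(1,2), of d]) (use j(3) in auto)
  have n: "Suc (n - 1) = n" using j by simp
  have "act Y 1 (Suc n) (op_times_id 0 v) \<gamma> = act Y 1 n (op_times_id 0 w) (act Y n (Suc n) (face (Suc n) j d) \<gamma>)"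
    using cset_comp[OF Y op_times_id_vertex[OF w(1)] _ g, of "face (Suc n) j d"] face_Suc_hom[OF j(1,2)]
      op_times_id_vertex_comp[OF w(1), of "face n j d"] op_times_id_face[OF j(1,2), of d] w(2) n by simp
  moreover have "degen_edge Y (act Y 1 n (op_times_id 0 w) (act Y n (Suc n) (face (Suc n) j d) \<gamma>))"
    using j(4) w(1) n unfolding vertex_const_def by metis
  ultimately show "degen_edge Y (act Y 1 (Suc n) (op_times_id 0 v) \<gamma>)" by simp
qed

definition const_path :: "'a cset \<Rightarrow> nat \<Rightarrow> 'a \<Rightarrow> 'a" where
  "const_path Y n y = act Y (Suc n) n (degen (Suc n) (Suc n)) y"

lemma const_path_cell: "is_cset Y \<Longrightarrow> y \<in> cells Y n \<Longrightarrow> const_path Y n y \<in> cells Y (Suc n)"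
  unfolding const_path_def by (rule cset_act[OF _ degen_last_hom])

lemma const_path_face: "is_cset Y \<Longrightarrow> y \<in> cells Y n \<Longrightarrow>
    act Y n (Suc n) (face (Suc n) (Suc n) d) (const_path Y n y) = y"
  unfolding const_path_def by (simp add: cset_comp[OF _ face_last_hom degen_last_hom] degen_last_face)

lemma const_path_act: "is_cset Y \<Longrightarrow> y \<in> cells Y n \<Longrightarrow> \<phi> \<in> box_hom m n \<Longrightarrow>
    act Y (Suc m) (Suc n) (op_times_id m \<phi>) (const_path Y n y) = const_path Y m (act Y m n \<phi> y)"
  unfolding const_path_def
  by (simp add: cset_comp[OF _ op_times_id_hom degen_last_hom] cset_comp[OF _ degen_last_hom] degen_last_natural)

lemma const_path_vertex_const:
  assumes Y: "is_cset Y" and y: "y \<in> cells Y n"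
  shows "vertex_const Y n (const_path Y n y)"
  unfolding vertex_const_def
proof
  fix v assume v: "v \<in> box_hom 0 n"
  have "degen (Suc 0) (Suc 0) = const_op (Suc 0)"
    by (rule op_eqI[where m = "Suc 0"]) (auto simp: degen_apply)
  then have "act Y 1 (Suc n) (op_times_id 0 v) (const_path Y n y) = act Y 1 0 (const_op 1) (act Y 0 n v y)"
    using const_path_act[OF Y y v] by (simp add: const_path_def One_nat_def)
  then show "degen_edge Y (act Y 1 (Suc n) (op_times_id 0 v) (const_path Y n y))"
    using cset_act[OF Y v y] unfolding degen_edge_def by blast
qed

definition vertex_op :: "nat \<Rightarrow> bool \<Rightarrow> op" where
  "vertex_op n b = restrict (\<lambda>_. replicate n b) (pow1 0)"

lemma vertex_op_hom: "vertex_op n b \<in> box_hom 0 n"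
proof -
  obtain s where s: "s \<in> box_hom 0 n" "\<And>k. k < n \<Longrightarrow> s [] ! k = b"
    using coordinate_op[of 0 id n "replicate n b"] by auto
  have "vertex_op n b = s"
    by (rule op_nth_eqI[where m = 0 and n = n])
      (use s box_hom_ext[OF s(1)] box_hom_length[OF s(1)] in \<open>auto simp: vertex_op_def\<close>)
  then show ?thesis using s by simp
qed

text \<open>In the path direction the critical edge runs over the vertex with all coordinates
  \<open>\<not> e\<close>, and for positive \<open>n\<close> this vertex lies in the face
  \<open>(1, \<not> e)\<close>.\<close>

lemma critical_edge_last:
  assumes "1 \<le> n"
  shows "critical_edge (Suc n) (Suc n) e =
    compose (pow1 1) (face (Suc n) 1 (\<not> e)) (op_times_id 0 (vertex_op (n - 1) (\<not> e)))"
proof -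
  have "compose (pow1 1) (face (Suc n) 1 (\<not> e)) (op_times_id 0 (vertex_op (n - 1) (\<not> e))) =
      op_times_id 0 (compose (pow1 0) (face n 1 (\<not> e)) (vertex_op (n - 1) (\<not> e)))"
    using op_times_id_vertex_comp[OF vertex_op_hom, of "n - 1" "face n 1 (\<not> e)" "\<not> e"] op_times_id_face[of 1 n "\<not> e"] assms by simp
  also have "\<dots> = critical_edge (Suc n) (Suc n) e"
  proof (rule op_eqI[where m = 1])
    fix xs :: "bool list" assume "length xs = 1"
    then obtain a where a: "xs = [a]" by (auto simp: length_Suc_conv One_nat_def)
    have "replicate n (\<not> e) = (\<not> e) # replicate (n - 1) (\<not> e)" using assms by (cases n) auto
    moreover have "(replicate (Suc n) (\<not> e))[n := a] = replicate n (\<not> e) @ [a]"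
      using replicate_append_same[of n "\<not> e"] by (simp add: list_update_append flip: replicate_append_same)
    ultimately show "op_times_id 0 (compose (pow1 0) (face n 1 (\<not> e)) (vertex_op (n - 1) (\<not> e))) xs =
        critical_edge (Suc n) (Suc n) e xs"
      by (simp add: a critical_edge_def vertex_op_def face_apply del: replicate_Suc)
  qed (simp_all add: op_times_id_def)
  finally show ?thesis ..
qed

lemma quasi_fill:
  fixes Y :: "'a cset"
  assumes Y: "is_cset Y" "inner_fills (to_pt Y :: ('a, 'b) cmap)" and n: "2 \<le> n" "1 \<le> i" "i \<le> n"
    and x: "compat Y n (horn n i e) x" "crit Y n i e x"
  obtains z where "has_faces Y n (horn n i e) x z"
proof -
  have "fills (to_pt Y :: ('a, 'b) cmap) n (horn n i e) (crit Y n i e)"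
    using Y(2) n by (simp add: inner_fills_def)
  moreover have "has_faces (pt :: 'b cset) n (horn n i e) (\<lambda>j d. app (to_pt Y :: ('a, 'b) cmap) (n - 1) (x j d)) undefined"
    using compat_cells[OF x(1)] by (auto simp: has_faces_def)
  ultimately show ?thesis using x that unfolding fills_def by auto
qed

section \<open>The mapping path space\<close>

text \<open>For a map \<open>p\<close> with inner fillers in its target, the mapping path space is built from the paths
  constant on vertices, so that all critical edges that occur are degenerate.\<close>

definition path_cset :: "('a, 'b) cmap \<Rightarrow> ('a \<times> 'b) cset" where
  "path_cset p = \<lparr>cells = (\<lambda>n. {(x, \<gamma>). x \<in> cells (src p) n \<and> \<gamma> \<in> cells (tgt p) (Suc n) \<and>
       act (tgt p) n (Suc n) (face (Suc n) (Suc n) False) \<gamma> = app p n x \<and> vertex_const (tgt p) n \<gamma>}),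
     act = (\<lambda>m n \<phi> (x, \<gamma>). (act (src p) m n \<phi> x, act (tgt p) (Suc m) (Suc n) (op_times_id m \<phi>) \<gamma>))\<rparr>"

lemma path_cells: "(x, \<gamma>) \<in> cells (path_cset p) n \<longleftrightarrow> x \<in> cells (src p) n \<and> \<gamma> \<in> cells (tgt p) (Suc n) \<and>
    act (tgt p) n (Suc n) (face (Suc n) (Suc n) False) \<gamma> = app p n x \<and> vertex_const (tgt p) n \<gamma>"
  by (simp add: path_cset_def)

lemma path_act [simp]: "act (path_cset p) m n \<phi> (x, \<gamma>) =
    (act (src p) m n \<phi> x, act (tgt p) (Suc m) (Suc n) (op_times_id m \<phi>) \<gamma>)"
  by (simp add: path_cset_def)

lemma face_last_act:
  assumes Y: "is_cset Y" and g: "\<gamma> \<in> cells Y (Suc n)" and \<phi>: "\<phi> \<in> box_hom m n"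
  shows "act Y m (Suc m) (face (Suc m) (Suc m) d) (act Y (Suc m) (Suc n) (op_times_id m \<phi>) \<gamma>) =
    act Y m n \<phi> (act Y n (Suc n) (face (Suc n) (Suc n) d) \<gamma>)"
  using cset_comp[OF Y face_last_hom op_times_id_hom[OF \<phi>] g] cset_comp[OF Y \<phi> face_last_hom g]
  by (simp add: face_last_natural[OF \<phi>])

context
  fixes p :: "('a, 'b) cmap"
  assumes p: "is_cmap p"
begin

lemma path_cset_cset: "is_cset (path_cset p)"
  unfolding is_cset_def
proof (intro conjI allI ballI; clarify)
  fix m n \<phi> x \<gamma> assume \<phi>: "\<phi> \<in> box_hom m n" and "(x, \<gamma>) \<in> cells (path_cset p) n"
  then show "act (path_cset p) m n \<phi> (x, \<gamma>) \<in> cells (path_cset p) m"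
    using cset_act[OF cmap_src[OF p] \<phi>] cset_act[OF cmap_tgt[OF p] op_times_id_hom[OF \<phi>]]
      vertex_const_act[OF cmap_tgt[OF p] _ _ \<phi>] face_last_act[OF cmap_tgt[OF p] _ \<phi>] cmap_nat[OF p \<phi>]
    by (simp add: path_cells)
next
  fix n x \<gamma> assume "(x, \<gamma>) \<in> cells (path_cset p) n"
  then show "act (path_cset p) n n (box_id n) (x, \<gamma>) = (x, \<gamma>)"
    using p by (simp add: path_cells op_times_id_id)
next
  fix k m n \<psi> \<phi> x \<gamma> assume \<psi>: "\<psi> \<in> box_hom k m" and \<phi>: "\<phi> \<in> box_hom m n" and "(x, \<gamma>) \<in> cells (path_cset p) n"
  then show "act (path_cset p) k m \<psi> (act (path_cset p) m n \<phi> (x, \<gamma>)) =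
      act (path_cset p) k n (compose (pow1 k) \<phi> \<psi>) (x, \<gamma>)"
    using cset_comp[OF cmap_src[OF p] \<psi> \<phi>] cset_comp[OF cmap_tgt[OF p] op_times_id_hom[OF \<psi>] op_times_id_hom[OF \<phi>]]
    by (simp add: path_cells op_times_id_comp[OF \<psi>])
qed

lemma path_start:
  obtains q where "is_cmap q" "src q = path_cset p" "tgt q = src p"
    "\<And>n x \<gamma>. (x, \<gamma>) \<in> cells (path_cset p) n \<Longrightarrow> app q n (x, \<gamma>) = x"
proof (rule cmap_exE[of "path_cset p" "src p" "\<lambda>_. fst"])
  fix q :: "('a \<times> 'b, 'a) cmap"
  assume "is_cmap q" "src q = path_cset p" "tgt q = src p"
    "\<And>n x. x \<in> cells (path_cset p) n \<Longrightarrow> app q n x = fst x"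
  then show ?thesis using that[of q] by simp
qed (use path_cset_cset p in \<open>auto simp: path_cells\<close>)

lemma path_end:
  obtains q where "is_cmap q" "src q = path_cset p" "tgt q = tgt p"
    "\<And>n x \<gamma>. (x, \<gamma>) \<in> cells (path_cset p) n \<Longrightarrow> app q n (x, \<gamma>) = act (tgt p) n (Suc n) (face (Suc n) (Suc n) True) \<gamma>"
proof (rule cmap_exE[of "path_cset p" "tgt p" "\<lambda>n x. act (tgt p) n (Suc n) (face (Suc n) (Suc n) True) (snd x)"])
  fix q :: "('a \<times> 'b, 'b) cmap"
  assume "is_cmap q" "src q = path_cset p" "tgt q = tgt p"
    "\<And>n x. x \<in> cells (path_cset p) n \<Longrightarrow> app q n x = act (tgt p) n (Suc n) (face (Suc n) (Suc n) True) (snd x)"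
  then show ?thesis using that[of q] by simp
next
  fix m n \<phi> x assume "\<phi> \<in> box_hom m n" "x \<in> cells (path_cset p) n"
  then show "act (tgt p) m (Suc m) (face (Suc m) (Suc m) True) (snd (act (path_cset p) m n \<phi> x)) =
      act (tgt p) m n \<phi> (act (tgt p) n (Suc n) (face (Suc n) (Suc n) True) (snd x))"
    using face_last_act[OF cmap_tgt[OF p]] by (cases x) (simp add: path_cells)
qed (use path_cset_cset p cset_act[OF cmap_tgt[OF p] face_last_hom] in \<open>auto simp: path_cells\<close>)

lemma path_const:
  obtains c where "is_cmap c" "src c = src p" "tgt c = path_cset p"
    "\<And>n x. x \<in> cells (src p) n \<Longrightarrow> app c n x = (x, const_path (tgt p) n (app p n x))"
proof (rule cmap_exE[of "src p" "path_cset p" "\<lambda>n x. (x, const_path (tgt p) n (app p n x))"])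
  fix n x assume "x \<in> cells (src p) n"
  then show "(x, const_path (tgt p) n (app p n x)) \<in> cells (path_cset p) n"
    using cmap_app[OF p] const_path_cell[OF cmap_tgt[OF p]] const_path_face[OF cmap_tgt[OF p]]
      const_path_vertex_const[OF cmap_tgt[OF p]] by (simp add: path_cells)
next
  fix m n \<phi> x assume "\<phi> \<in> box_hom m n" "x \<in> cells (src p) n"
  then show "(act (src p) m n \<phi> x, const_path (tgt p) m (app p m (act (src p) m n \<phi> x))) =
      act (path_cset p) m n \<phi> (x, const_path (tgt p) n (app p n x))"
    using cmap_app[OF p] cmap_nat[OF p] const_path_act[OF cmap_tgt[OF p]] by simp
qed (use path_cset_cset p that in auto)

text \<open>A boundary in the path space over a fixed cube \<open>y\<close> transposes to an open
  box that lacks only the far end of the path. Its critical edge runs in the path direction, hence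
  is degenerate.\<close>

lemma path_start_fills:
  assumes Y: "inner_fills (to_pt (tgt p) :: ('b, 'c) cmap)"
    and q: "is_cmap q" "src q = path_cset p" "tgt q = src p"
      "\<And>n x \<gamma>. (x, \<gamma>) \<in> cells (path_cset p) n \<Longrightarrow> app q n (x, \<gamma>) = x"
  shows "fills q n (all_faces n) (\<lambda>_. True)"
  unfolding fills_def
proof (intro allI impI, elim conjE)
  fix w y assume w: "compat (src q) n (all_faces n) w" and y: "has_faces (tgt q) n (all_faces n) (\<lambda>j d. app q (n - 1) (w j d)) y"
  have Yc: "is_cset (tgt p)" using p by simp
  have yc: "y \<in> cells (src p) n" using has_faces_cell[OF y] q(3) by simp
  define x g where "x j d = fst (w j d)" and "g j d = snd (w j d)" for j d
  have wc: "(x j d, g j d) \<in> cells (path_cset p) (n - 1)" if "(j, d) \<in> all_faces n" for j d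
    using compat_cells[OF w that] q(2) by (simp add: x_def g_def)
  have jn: "1 \<le> j \<and> j \<le> n" if "(j, d) \<in> all_faces n" for j d using that by (auto simp: all_faces_def)
  have gc: "g j d \<in> cells (tgt p) n" "act (tgt p) (n - 1) n (face n n False) (g j d) = app p (n - 1) (x j d)"
    "vertex_const (tgt p) (n - 1) (g j d)" if "(j, d) \<in> all_faces n" for j d
    using wc[OF that] jn[OF that] by (simp_all add: path_cells)
  have yf: "act (src p) (n - 1) n (face n j d) y = x j d" if "(j, d) \<in> all_faces n" for j d
    using has_faces_face[OF y that] q(3) q(4)[OF wc[OF that]] by (simp add: x_def g_def)
  have "\<exists>\<gamma>. \<gamma> \<in> cells (tgt p) (Suc n) \<and> act (tgt p) n (Suc n) (face (Suc n) (Suc n) False) \<gamma> = app p n y \<and>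
     vertex_const (tgt p) n \<gamma> \<and> (\<forall>j d. (j, d) \<in> all_faces n \<longrightarrow> act (tgt p) n (Suc n) (face (Suc n) j d) \<gamma> = g j d)"
  proof (cases "n = 0")
    \<comment> \<open>In dimension 0 the transposed box has dimension 1 and is not inner; the
      constant path takes the place of a filler.\<close>
    case True
    then show ?thesis
      using const_path_cell[OF Yc cmap_app[OF p yc]] const_path_face[OF Yc cmap_app[OF p yc]]
        const_path_vertex_const[OF Yc cmap_app[OF p yc]] by (intro exI[of _ "const_path (tgt p) n (app p n y)"]) (simp add: all_faces_def)
  next
    case False
    let ?g = "with_ends n (app p n y) (app p n y) g"
    have H: "horn (Suc n) (Suc n) True = all_faces n \<union> {(Suc n, False)}"
      by (auto simp: horn_def all_faces_def)
    have "compat (tgt p) (Suc n) (all_faces n \<union> {(Suc n, False)}) ?g"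
    proof (rule with_ends_compat)
      fix j d d' assume j: "(j, d) \<in> all_faces n" and "(Suc n, d') \<in> {(Suc n, False)}"
      then show "act (tgt p) (n - 1) n (face n j d) (if d' then app p n y else app p n y) =
          act (tgt p) (n - 1) n (face n n d') (g j d)"
        using gc(2)[OF j] yf[OF j] cmap_nat[OF p face_hom yc, of j d] jn[OF j] by simp
    next
      fix j d k d' assume jk: "(j, d) \<in> all_faces n" "(k, d') \<in> all_faces n" "j < k"
      then have "act (path_cset p) (n - 2) (n - 1) (face (n - 1) j d) (w k d') =
          act (path_cset p) (n - 2) (n - 1) (face (n - 1) (k - 1) d') (w j d)"
        using w q(2) unfolding compat_def by metis
      then have "act (path_cset p) (n - 2) (n - 1) (face (n - 1) j d) (x k d', g k d') =
          act (path_cset p) (n - 2) (n - 1) (face (n - 1) (k - 1) d') (x j d, g j d)"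
        by (simp only: x_def g_def prod.collapse)
      moreover have "j \<le> n - 1" "1 \<le> j" "1 \<le> k - 1" "k - 1 \<le> n - 1" "Suc (n - 2) = n - 1" "Suc (n - 1) = n"
        using jn[OF jk(1)] jn[OF jk(2)] jk(3) by linarith+
      ultimately show "act (tgt p) (n - 1) n (face n j d) (g k d') = act (tgt p) (n - 1) n (face n (k - 1) d') (g j d)"
        by (simp add: op_times_id_face2)
    qed (use gc cmap_app[OF p yc] in auto)
    then have c1: "compat (tgt p) (Suc n) (horn (Suc n) (Suc n) True) ?g" unfolding H .
    let ?v = "op_times_id 0 (vertex_op (n - 1) False)"
    have 1: "(1, False) \<in> all_faces n" using False by (auto simp: all_faces_def)
    have n1: "Suc (n - 1) = n" using False by simp
    have v: "?v \<in> box_hom 1 (Suc n - 1)" using op_times_id_vertex[OF vertex_op_hom, of "n - 1" False] n1 by simp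
    have "critical_edge (Suc n) (Suc n) True = compose (pow1 1) (face (Suc n) 1 False) ?v"
      using critical_edge_last[of n True] False by simp
    moreover have "degen_edge (tgt p) (act (tgt p) 1 (Suc n - 1) ?v (?g 1 False))"
      using gc(3)[OF 1] vertex_op_hom[of "n - 1" False] n1 False unfolding vertex_const_def with_ends_def by simp
    ultimately have c2: "crit (tgt p) (Suc n) (Suc n) True ?g"
      unfolding crit_def H using 1 v by blast
    obtain \<gamma> where \<gamma>: "has_faces (tgt p) (Suc n) (horn (Suc n) (Suc n) True) ?g \<gamma>"
      by (rule quasi_fill[OF Yc Y _ _ _ c1 c2]) (use False in auto)
    have \<gamma>f: "act (tgt p) n (Suc n) (face (Suc n) j d) \<gamma> = g j d" if "(j, d) \<in> all_faces n" for j d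
      using has_faces_face[OF \<gamma>, of j d] that jn[OF that] unfolding H by (simp add: with_ends_def)
    moreover have "act (tgt p) n (Suc n) (face (Suc n) (Suc n) False) \<gamma> = app p n y"
      using has_faces_face[OF \<gamma>, of "Suc n" False] unfolding H by (simp add: with_ends_def)
    \<comment> \<open>Each vertex lies in one of the two faces in direction 1, over which
      \<open>\<gamma>\<close> is a given path.\<close>
    moreover have "vertex_const (tgt p) n \<gamma>"
    proof (rule vertex_const_faces[OF Yc has_faces_cell[OF \<gamma>]])
      fix v assume "v \<in> box_hom 0 n"
      have "(1, v [] ! (1 - 1)) \<in> all_faces n" using False by (auto simp: all_faces_def)
      then show "\<exists>j d. 1 \<le> j \<and> j \<le> n \<and> v [] ! (j - 1) = d \<and> vertex_const (tgt p) (n - 1) (act (tgt p) n (Suc n) (face (Suc n) j d) \<gamma>)"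
        using gc(3) \<gamma>f jn by (intro exI[of _ 1] exI[of _ "v [] ! (1 - 1)"]) simp
    qed
    ultimately show ?thesis using has_faces_cell[OF \<gamma>] by blast
  qed
  then obtain \<gamma> where \<gamma>: "\<gamma> \<in> cells (tgt p) (Suc n)" "act (tgt p) n (Suc n) (face (Suc n) (Suc n) False) \<gamma> = app p n y"
     "vertex_const (tgt p) n \<gamma>" "\<And>j d. (j, d) \<in> all_faces n \<Longrightarrow> act (tgt p) n (Suc n) (face (Suc n) j d) \<gamma> = g j d" by blast
  have z: "(y, \<gamma>) \<in> cells (path_cset p) n" using \<gamma> yc by (simp add: path_cells)
  have "act (path_cset p) (n - 1) n (face n j d) (y, \<gamma>) = w j d" if "(j, d) \<in> all_faces n" for j d
    using \<gamma>(4)[OF that] yf[OF that] jn[OF that] by (simp add: op_times_id_face x_def g_def)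
  then show "\<exists>z. has_faces (src q) n (all_faces n) w z \<and> app q n z = y"
    using z q by (intro exI[of _ "(y, \<gamma>)"]) (simp add: has_faces_def)
qed

text \<open>A filler in the source is corrected by transport along a path in the target, relative to the open box,
  from the image of the filler to the prescribed cube.\<close>

lemma path_transport_inner_fills:
  assumes X: "inner_fills (to_pt (src p) :: ('a, 'c) cmap)" and Y: "inner_fills (to_pt (tgt p) :: ('b, 'd) cmap)"
    and t: "is_cmap t" "src t = path_cset p" "tgt t = src p"
    and t_const: "\<And>n x. x \<in> cells (src p) n \<Longrightarrow> app t n (x, const_path (tgt p) n (app p n x)) = x"
    and t_end: "\<And>n x \<gamma>. (x, \<gamma>) \<in> cells (path_cset p) n \<Longrightarrow>
      app p n (app t n (x, \<gamma>)) = act (tgt p) n (Suc n) (face (Suc n) (Suc n) True) \<gamma>"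
  shows "inner_fills p"
  unfolding inner_fills_def fills_def
proof (intro allI impI, elim conjE)
  fix n i :: nat and e x y
  assume n: "2 \<le> n" "1 \<le> i" "i \<le> n"
    and x: "compat (src p) n (horn n i e) x" and y: "has_faces (tgt p) n (horn n i e) (\<lambda>j d. app p (n - 1) (x j d)) y"
    and c: "crit (src p) n i e x"
  let ?H = "horn n i e"
  have Xc: "is_cset (src p)" and Yc: "is_cset (tgt p)" using p by simp_all
  have jn: "1 \<le> j \<and> j \<le> n" if "(j, d) \<in> ?H" for j d using all_facesD[OF horn_sub that] .
  have n1: "Suc (n - 1) = n" using n by simp
  obtain h where h: "has_faces (src p) n ?H x h" by (rule quasi_fill[OF Xc X n x c])
  have hc: "h \<in> cells (src p) n" using has_faces_cell[OF h] .
  have yc: "y \<in> cells (tgt p) n" using has_faces_cell[OF y] .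
  have xc: "x j d \<in> cells (src p) (n - 1)" if "(j, d) \<in> ?H" for j d using compat_cells[OF x that] .
  have pxc: "app p (n - 1) (x j d) \<in> cells (tgt p) (n - 1)" if "(j, d) \<in> ?H" for j d using cmap_app[OF p xc[OF that]] .
  \<comment> \<open>Over the open box the path from the image of \<open>h\<close> to
    \<open>y\<close> is required to be constant.\<close>
  define g where "g j d = const_path (tgt p) (n - 1) (app p (n - 1) (x j d))" for j d
  let ?g = "with_ends n (app p n h) y g"
  have gc: "g j d \<in> cells (tgt p) n" if "(j, d) \<in> ?H" for j d
    using const_path_cell[OF Yc pxc[OF that]] n1 by (simp add: g_def)
  have c1: "compat (tgt p) (Suc n) (horn (Suc n) i e) ?g"
    unfolding horn_Suc[OF n(3)]
  proof (rule with_ends_compat[OF horn_sub])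
    fix j d d' assume j: "(j, d) \<in> ?H"
    have "act (tgt p) (n - 1) n (face n j d) (app p n h) = app p (n - 1) (x j d)"
      using cmap_nat[OF p face_hom hc, of j d] jn[OF j] has_faces_face[OF h j] by simp
    moreover have "act (tgt p) (n - 1) n (face n n d') (g j d) = app p (n - 1) (x j d)"
      using const_path_face[OF Yc pxc[OF j], of d'] n1 by (simp add: g_def)
    ultimately show "act (tgt p) (n - 1) n (face n j d) (if d' then y else app p n h) =
        act (tgt p) (n - 1) n (face n n d') (g j d)"
      using has_faces_face[OF y j] by simp
  next
    fix j d k d' assume jk: "(j, d) \<in> ?H" "(k, d') \<in> ?H" "j < k"
    have le: "j \<le> n - 1" "1 \<le> j" "1 \<le> k - 1" "k - 1 \<le> n - 1" "Suc (n - 2) = n - 1"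
      using jn[OF jk(1)] jn[OF jk(2)] jk(3) by linarith+
    have f: "face (n - 1) j d \<in> box_hom (n - 2) (n - 1)" "face (n - 1) (k - 1) d' \<in> box_hom (n - 2) (n - 1)"
      using le by (auto intro: face_hom2)
    have "act (src p) (n - 2) (n - 1) (face (n - 1) j d) (x k d') =
        act (src p) (n - 2) (n - 1) (face (n - 1) (k - 1) d') (x j d)"
      using x jk unfolding compat_def by blast
    then have "act (tgt p) (n - 2) (n - 1) (face (n - 1) j d) (app p (n - 1) (x k d')) =
        act (tgt p) (n - 2) (n - 1) (face (n - 1) (k - 1) d') (app p (n - 1) (x j d))"
      using cmap_nat[OF p f(1) xc[OF jk(2)]] cmap_nat[OF p f(2) xc[OF jk(1)]] by simp
    then show "act (tgt p) (n - 1) n (face n j d) (g k d') = act (tgt p) (n - 1) n (face n (k - 1) d') (g j d)"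
      using const_path_act[OF Yc pxc[OF jk(2)] f(1)] const_path_act[OF Yc pxc[OF jk(1)] f(2)] le n1
      by (simp add: g_def op_times_id_face2)
  qed (use gc yc cmap_app[OF p hc] in auto)
  interpret box: inner n i e by unfold_locales (use n in auto)
  \<comment> \<open>The critical edge of the new box lies in its end at \<open>\<not> e\<close>;
    depending on \<open>e\<close> it is the one of the image of \<open>h\<close> or the one of
    \<open>y\<close>.\<close>
  have dh: "degen_edge (tgt p) (act (tgt p) 1 n (critical_edge n i e) (app p n h))" "degen_edge (tgt p) (act (tgt p) 1 n (critical_edge n i e) y)"
    using degen_edge_map[OF p box.crit_face[OF Xc h c]] cmap_nat[OF p critical_edge_hom[OF n(2,3)] hc]
      box.crit_face[OF Yc y box.crit_map[OF p x c]] by simp_all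
  have "critical_edge (Suc n) i e = compose (pow1 1) (face (Suc n) (Suc n) (\<not> e)) (critical_edge n i e)"
  proof (rule op_nth_eqI[where m = 1 and n = "Suc n"])
    fix xs :: "bool list" and k assume l: "length xs = 1" and k: "k < Suc n"
    have "length (critical_edge n i e xs) = n" using l by (simp add: critical_edge_def)
    then show "critical_edge (Suc n) i e xs ! k = compose (pow1 1) (face (Suc n) (Suc n) (\<not> e)) (critical_edge n i e) xs ! k"
      using l k n by (cases "k = n") (auto simp: critical_edge_nth face_nth)
  qed (use n box_hom_length[OF critical_edge_hom[OF n(2), of "Suc n" e]]
      box_hom_length[OF critical_edge_hom[OF n(2,3), of e]] in simp_all)
  moreover have "degen_edge (tgt p) (act (tgt p) 1 (Suc n - 1) (critical_edge n i e) (?g (Suc n) (\<not> e)))"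
    using dh by (cases e) (simp_all add: with_ends_def)
  ultimately have c2: "crit (tgt p) (Suc n) i e ?g"
    unfolding crit_def horn_Suc[OF n(3)] using critical_edge_hom[OF n(2,3)] by force
  obtain \<gamma> where \<gamma>: "has_faces (tgt p) (Suc n) (horn (Suc n) i e) ?g \<gamma>"
    by (rule quasi_fill[OF Yc Y _ _ _ c1 c2]) (use n in auto)
  have \<gamma>c: "\<gamma> \<in> cells (tgt p) (Suc n)" using has_faces_cell[OF \<gamma>] .
  have \<gamma>f: "act (tgt p) n (Suc n) (face (Suc n) j d) \<gamma> = g j d" if "(j, d) \<in> ?H" for j d
    using has_faces_face[OF \<gamma>, of j d] that jn[OF that] unfolding horn_Suc[OF n(3)] by (simp add: with_ends_def)
  have \<gamma>e: "act (tgt p) n (Suc n) (face (Suc n) (Suc n) d) \<gamma> = (if d then y else app p n h)" for d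
    using has_faces_face[OF \<gamma>, of "Suc n" d] unfolding horn_Suc[OF n(3)] by (simp add: with_ends_def)
  have "vertex_const (tgt p) n \<gamma>"
  proof (rule vertex_const_faces[OF Yc \<gamma>c])
    fix v assume "v \<in> box_hom 0 n"
    \<comment> \<open>In a direction other than \<open>i\<close> both faces belong to the box, and
      every vertex lies in one of them.\<close>
    define j :: nat where "j = (if i = 1 then 2 else 1)"
    have j: "(j, v [] ! (j - 1)) \<in> ?H" using n by (auto simp: j_def horn_def all_faces_def)
    have "vertex_const (tgt p) (n - 1) (g j (v [] ! (j - 1)))"
      unfolding g_def by (rule const_path_vertex_const[OF Yc pxc[OF j]])
    then show "\<exists>j d. 1 \<le> j \<and> j \<le> n \<and> v [] ! (j - 1) = d \<and> vertex_const (tgt p) (n - 1) (act (tgt p) n (Suc n) (face (Suc n) j d) \<gamma>)"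
      using \<gamma>f[OF j] jn[OF j] by (intro exI[of _ j] exI[of _ "v [] ! (j - 1)"]) simp
  qed
  then have z: "(h, \<gamma>) \<in> cells (path_cset p) n" using hc \<gamma>c \<gamma>e[of False] by (simp add: path_cells)
  \<comment> \<open>Transport of \<open>h\<close> along \<open>\<gamma>\<close>: it fixes the box,
    over which the path is constant, and its image is the end point \<open>y\<close>.\<close>
  let ?z = "app t n (h, \<gamma>)"
  have "?z \<in> cells (src p) n" using cmap_app[OF t(1), of "(h, \<gamma>)" n] z t by simp
  moreover have "act (src p) (n - 1) n (face n j d) ?z = x j d" if j: "(j, d) \<in> ?H" for j d
  proof -
    have f: "face n j d \<in> box_hom (n - 1) n" using jn[OF j] by (auto intro: face_hom)
    have "act (src p) (n - 1) n (face n j d) ?z = app t (n - 1) (act (path_cset p) (n - 1) n (face n j d) (h, \<gamma>))"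
      using cmap_nat[OF t(1) f, of "(h, \<gamma>)"] z t by simp
    also have "act (path_cset p) (n - 1) n (face n j d) (h, \<gamma>) = (x j d, g j d)"
      using has_faces_face[OF h j] \<gamma>f[OF j] jn[OF j] n1 by (simp add: op_times_id_face)
    also have "app t (n - 1) (x j d, g j d) = x j d" unfolding g_def by (rule t_const[OF xc[OF j]])
    finally show ?thesis .
  qed
  moreover have "app p n ?z = y" using t_end[OF z] \<gamma>e[of True] by simp
  ultimately show "\<exists>z. has_faces (src p) n ?H x z \<and> app p n z = y"
    unfolding has_faces_def by blast
qed

end

section \<open>Copies of cubical sets in another universe\<close>

lemma comp_app_eq: "g \<odot> f = k \<Longrightarrow> x \<in> cells (src f) n \<Longrightarrow> app g n (app f n x) = app k n x"
  by auto

text \<open>Transport of structure. The injections may vary with the dimension, so each set of cells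
  is embedded on its own and may overlap the others.\<close>

lemma cset_copy:
  fixes X :: "'b cset" and e :: "nat \<Rightarrow> 'b \<Rightarrow> 'a"
  assumes X: "is_cset X" and e: "\<And>n. inj_on (e n) (cells X n)"
  obtains X' :: "'a cset" and f f' where "is_cmap f" "src f = X" "tgt f = X'" "is_cmap f'" "src f' = X'" "tgt f' = X"
    "\<And>n x. x \<in> cells X n \<Longrightarrow> app f' n (app f n x) = x"
    "\<And>n x. x \<in> cells X' n \<Longrightarrow> app f n (app f' n x) = x"
proof -
  define d where "d n = inv_into (cells X n) (e n)" for n
  have d: "d n (e n x) = x" if "x \<in> cells X n" for n x
    using e that by (simp add: d_def)
  define X' where "X' = \<lparr>cells = (\<lambda>n. e n ` cells X n), act = (\<lambda>m n \<phi> y. e m (act X m n \<phi> (d n y)))\<rparr>"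
  have X'c: "cells X' n = e n ` cells X n" for n by (simp add: X'_def)
  have X'a: "act X' m n \<phi> (e n x) = e m (act X m n \<phi> x)" if "x \<in> cells X n" for m n \<phi> x
    using d[OF that] by (simp add: X'_def)
  have X': "is_cset X'"
    unfolding is_cset_def X'c using X by (auto simp: X'a cset_act cset_comp)
  obtain f where f: "is_cmap f" "src f = X" "tgt f = X'" "\<And>n x. x \<in> cells X n \<Longrightarrow> app f n x = e n x"
    by (rule cmap_exE[of X X' e]) (use X X' in \<open>auto simp: X'c X'a\<close>)
  obtain f' where f': "is_cmap f'" "src f' = X'" "tgt f' = X" "\<And>n x. x \<in> cells X' n \<Longrightarrow> app f' n x = d n x"
    by (rule cmap_exE[of X' X d]) (use X X' in \<open>auto simp: X'c X'a d cset_act\<close>)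
  show ?thesis
    by (rule that[OF f(1-3) f'(1-3)]) (auto simp: f(4) f'(4) X'c d)
qed

lemma finite_inj_exists:
  assumes "finite (S :: 'b set)" "infinite (UNIV :: 'a set)"
  shows "\<exists>e :: 'b \<Rightarrow> 'a. inj_on e S"
proof -
  obtain B :: "'a set" where "finite B" "card B = card S"
    using infinite_arbitrarily_large[OF assms(2)] by blast
  then show ?thesis using finite_same_card_bij[OF assms(1)] by (metis bij_betw_imp_inj_on)
qed

lemma finite_cset_copy:
  fixes X :: "'b cset"
  assumes X: "is_cset X" and fin: "\<And>n. finite (cells X n)" and inf: "infinite (UNIV :: 'a set)"
  obtains X' :: "'a cset" and f f' where "is_cmap f" "src f = X" "tgt f = X'" "is_cmap f'" "src f' = X'" "tgt f' = X"
    "\<And>n x. x \<in> cells X n \<Longrightarrow> app f' n (app f n x) = x"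
    "\<And>n x. x \<in> cells X' n \<Longrightarrow> app f n (app f' n x) = x"
proof -
  define e :: "nat \<Rightarrow> 'b \<Rightarrow> 'a" where "e n = (SOME e. inj_on e (cells X n))" for n
  have "inj_on (e n) (cells X n)" for n
    unfolding e_def by (rule someI_ex[OF finite_inj_exists[OF fin inf]])
  then show ?thesis by (rule cset_copy[OF X]) (rule that)
qed

text \<open>The assumptions exhibit \<open>i'\<close> as a retract of \<open>i\<close>, possibly in
  a different universe, and lifting properties pass to retracts.\<close>

lemma lifts_iso:
  fixes i :: "('c, 'd) cmap" and i' :: "('e, 'f) cmap" and p :: "('g, 'h) cmap"
  assumes i: "is_cmap i" and i': "is_cmap i'"
    and a: "is_cmap a" "src a = src i" "tgt a = src i'" and a': "is_cmap a'" "src a' = src i'" "tgt a' = src i"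
    and aa: "\<And>n x. x \<in> cells (src i') n \<Longrightarrow> app a n (app a' n x) = x"
    and b: "is_cmap b" "src b = tgt i" "tgt b = tgt i'" and b': "is_cmap b'" "src b' = tgt i'" "tgt b' = tgt i"
    and bb: "\<And>n x. x \<in> cells (tgt i') n \<Longrightarrow> app b n (app b' n x) = x"
    and ia: "\<And>n x. x \<in> cells (src i) n \<Longrightarrow> app i' n (app a n x) = app b n (app i n x)"
    and ia': "\<And>n x. x \<in> cells (src i') n \<Longrightarrow> app b' n (app i' n x) = app i n (app a' n x)"
    and p: "is_cmap p" and l: "lifts i p"
  shows "lifts i' p"
  unfolding lifts_def
proof (intro allI impI, elim conjE)
  fix u :: "('e, 'g) cmap" and v :: "('f, 'h) cmap"
  assume u: "is_cmap u" "src u = src i'" "tgt u = src p" and v: "is_cmap v" "src v = tgt i'" "tgt v = tgt p"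
    and sq: "p \<odot> u = v \<odot> i'"
  have ua: "is_cmap (u \<odot> a)" using u a by (auto intro: comp_cmap)
  have vb: "is_cmap (v \<odot> b)" using v b by (auto intro: comp_cmap)
  have ac: "app a n x \<in> cells (src i') n" if "x \<in> cells (src i) n" for n x using cmap_app[OF a(1)] a that by simp
  have ac': "app a' n x \<in> cells (src i) n" if "x \<in> cells (src i') n" for n x using cmap_app[OF a'(1)] a' that by simp
  have bc': "app b' n x \<in> cells (tgt i) n" if "x \<in> cells (tgt i') n" for n x using cmap_app[OF b'(1)] b' that by simp
  have ic: "app i n x \<in> cells (tgt i) n" if "x \<in> cells (src i) n" for n x using cmap_app[OF i] that .
  have ic': "app i' n x \<in> cells (tgt i') n" if "x \<in> cells (src i') n" for n x using cmap_app[OF i'] that .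
  have "p \<odot> (u \<odot> a) = (v \<odot> b) \<odot> i"
  proof (rule cmap_eqI)
    fix n x assume "x \<in> cells (src (p \<odot> (u \<odot> a))) n"
    then have x: "x \<in> cells (src i) n" using a by simp
    show "app (p \<odot> (u \<odot> a)) n x = app ((v \<odot> b) \<odot> i) n x"
      using x ac[OF x] ic[OF x] a u b ia[OF x] square_app[OF sq u(2) ac[OF x]] by simp
  qed (use p ua vb u v i a b in \<open>auto intro: comp_cmap\<close>)
  then obtain h where h: "is_cmap h" "src h = tgt i" "tgt h = src p" "h \<odot> i = u \<odot> a" "p \<odot> h = v \<odot> b"
    using liftsE[OF l ua _ _ vb] a u v b by (metis comp_sel(1,2))
  have hb: "is_cmap (h \<odot> b')" using h b' by (auto intro: comp_cmap)
  have "(h \<odot> b') \<odot> i' = u"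
  proof (rule cmap_eqI)
    fix n x assume "x \<in> cells (src ((h \<odot> b') \<odot> i')) n"
    then have x: "x \<in> cells (src i') n" by simp
    have "app ((h \<odot> b') \<odot> i') n x = app h n (app i n (app a' n x))"
      using x ic'[OF x] b' ia'[OF x] by simp
    also have "\<dots> = app u n x"
      using comp_app_eq[OF h(4), of "app a' n x" n] ac'[OF x] a(2) aa[OF x] by simp
    finally show "app ((h \<odot> b') \<odot> i') n x = app u n x" .
  qed (use hb i' h u b' in \<open>auto intro: comp_cmap\<close>)
  moreover have "p \<odot> (h \<odot> b') = v"
  proof (rule cmap_eqI)
    fix n x assume "x \<in> cells (src (p \<odot> (h \<odot> b'))) n"
    then have x: "x \<in> cells (tgt i') n" using b' by simp
    show "app (p \<odot> (h \<odot> b')) n x = app v n x"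
      using x b' comp_app_eq[OF h(5), of "app b' n x" n] h(2) bc'[OF x] b(2) bb[OF x] by simp
  qed (use hb p h v b' in \<open>auto intro: comp_cmap\<close>)
  ultimately show "\<exists>h. is_cmap h \<and> src h = tgt i' \<and> tgt h = src p \<and> h \<odot> i' = u \<and> p \<odot> h = v"
    using hb h b' by (intro exI[of _ "h \<odot> b'"]) simp
qed

text \<open>The box inclusions live on operators or sets of operators, whereas a model structure
  sees only maps in its own universe; levelwise finiteness permits a copy there.\<close>

lemma cmono_copy:
  fixes i :: "('c, 'd) cmap"
  assumes i: "cmono i" and fin: "\<And>n. finite (cells (src i) n)" "\<And>n. finite (cells (tgt i) n)"
    and inf: "infinite (UNIV :: 'a set)"
  obtains i' :: "('a, 'a) cmap" where "cmono i'"
    "\<And>p :: ('g, 'h) cmap. is_cmap p \<Longrightarrow> lifts i p \<longleftrightarrow> lifts i' p"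
proof -
  have ic: "is_cmap i" and inj: "\<And>n. inj_on (app i n) (cells (src i) n)" using i by (simp_all add: cmono_def)
  obtain A and a a' :: "(_, _) cmap" where a: "is_cmap a" "src a = src i" "tgt a = (A :: 'a cset)"
    and a': "is_cmap a'" "src a' = A" "tgt a' = src i"
    and aa: "\<And>n x. x \<in> cells (src i) n \<Longrightarrow> app a' n (app a n x) = x" "\<And>n x. x \<in> cells A n \<Longrightarrow> app a n (app a' n x) = x"
    by (rule finite_cset_copy[OF cmap_src[OF ic] fin(1) inf]) blast
  obtain B and b b' :: "(_, _) cmap" where b: "is_cmap b" "src b = tgt i" "tgt b = (B :: 'a cset)"
    and b': "is_cmap b'" "src b' = B" "tgt b' = tgt i"
    and bb: "\<And>n x. x \<in> cells (tgt i) n \<Longrightarrow> app b' n (app b n x) = x" "\<And>n x. x \<in> cells B n \<Longrightarrow> app b n (app b' n x) = x"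
    by (rule finite_cset_copy[OF cmap_tgt[OF ic] fin(2) inf]) blast
  define i' where "i' = b \<odot> (i \<odot> a')"
  have i's: "src i' = A" "tgt i' = B" using a' b by (simp_all add: i'_def)
  have i'c: "is_cmap i'" unfolding i'_def using ic a' b by (auto intro!: comp_cmap)
  have ac': "app a' n x \<in> cells (src i) n" if "x \<in> cells A n" for n x using cmap_app[OF a'(1)] a' that by simp
  have i'a: "app i' n x = app b n (app i n (app a' n x))" if "x \<in> cells A n" for n x
    using that ac'[OF that] a'(2) by (simp add: i'_def)
  have ac: "app a n x \<in> cells A n" if "x \<in> cells (src i) n" for n x using cmap_app[OF a(1)] a that by simp
  have iic: "app i n x \<in> cells (tgt i) n" if "x \<in> cells (src i) n" for n x using cmap_app[OF ic] that .
  have e1: "app i' n (app a n x) = app b n (app i n x)" if "x \<in> cells (src i) n" for n x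
    using i'a[OF ac[OF that]] aa(1)[OF that] by simp
  have e2: "app b' n (app i' n x) = app i n (app a' n x)" if "x \<in> cells A n" for n x
    using i'a[OF that] bb(1)[OF iic[OF ac'[OF that]]] by simp
  have "inj_on (app i' n) (cells A n)" for n
  proof (rule inj_onI)
    fix x y assume xy: "x \<in> cells A n" "y \<in> cells A n" "app i' n x = app i' n y"
    then have "app i n (app a' n x) = app i n (app a' n y)" using e2 by metis
    then have "app a' n x = app a' n y" using inj ac' xy by (metis inj_onD)
    then show "x = y" using aa(2) xy by metis
  qed
  then have "cmono i'" using i'c i's by (simp add: cmono_def)
  moreover have "lifts i p \<longleftrightarrow> lifts i' p" if p: "is_cmap p" for p :: "('g, 'h) cmap"
  proof
    assume "lifts i p"
    show "lifts i' p"
      by (rule lifts_iso[where i = i and a = a and a' = a' and b = b and b' = b'])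
        (use ic i'c a a' aa b b' bb p \<open>lifts i p\<close> e1 e2 i's in simp_all)
  next
    assume "lifts i' p"
    show "lifts i p"
      by (rule lifts_iso[where i = i' and a = a' and a' = a and b = b' and b' = b])
        (use ic i'c a a' aa b b' bb p \<open>lifts i' p\<close> e1 e2 i's in simp_all)
  qed
  ultimately show ?thesis using that by blast
qed

section \<open>Fibrations in model structures with monomorphisms as cofibrations\<close>

lemma lifts_comp:
  assumes i: "is_cmap i" and p: "is_cmap p" and q: "is_cmap q" "src q = tgt p" and l: "lifts i p" "lifts i q"
  shows "lifts i (q \<odot> p)"
  unfolding lifts_def
proof (intro allI impI, elim conjE)
  fix u v assume u: "is_cmap u" "src u = src i" "tgt u = src (q \<odot> p)"
    and v: "is_cmap v" "src v = tgt i" "tgt v = tgt (q \<odot> p)" and sq: "(q \<odot> p) \<odot> u = v \<odot> i"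
  have pu: "is_cmap (p \<odot> u)" using p u by (auto intro: comp_cmap)
  have "q \<odot> (p \<odot> u) = v \<odot> i" using sq comp_assoc[OF u(1) p q(1)] u(3) q(2) by simp
  then obtain g where g: "is_cmap g" "src g = tgt i" "tgt g = src q" "g \<odot> i = p \<odot> u" "q \<odot> g = v"
    using liftsE[OF l(2) pu _ _ v(1,2)] u v q by (metis comp_sel(1,2))
  obtain h where h: "is_cmap h" "src h = tgt i" "tgt h = src p" "h \<odot> i = u" "p \<odot> h = g"
    using liftsE[OF l(1) u(1,2) _ g(1,2)] u g q by (metis comp_sel(1,2))
  have "(q \<odot> p) \<odot> h = v" using comp_assoc[OF h(1) p q(1)] h(3,5) q(2) g(5) by simp
  then show "\<exists>h. is_cmap h \<and> src h = tgt i \<and> tgt h = src (q \<odot> p) \<and> h \<odot> i = u \<and> (q \<odot> p) \<odot> h = v"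
    using h by auto
qed

lemma lifts_split_epi:
  assumes i: "is_cmap i" and f: "is_cmap f" "is_cmap f'" "src f = tgt f'" "tgt f = src f'"
    and ff: "\<And>n x. x \<in> cells (src f') n \<Longrightarrow> app f n (app f' n x) = x"
      "\<And>n x. x \<in> cells (src f) n \<Longrightarrow> app f' n (app f n x) = x"
  shows "lifts i f"
  unfolding lifts_def
proof (intro allI impI, elim conjE)
  fix u v assume u: "is_cmap u" "src u = src i" "tgt u = src f"
    and v: "is_cmap v" "src v = tgt i" "tgt v = tgt f" and sq: "f \<odot> u = v \<odot> i"
  have h: "is_cmap (f' \<odot> v)" using f v by (auto intro: comp_cmap)
  have uc: "app u n x \<in> cells (src f) n" if "x \<in> cells (src i) n" for n x using cmap_app[OF u(1)] u that by simp
  have vc: "app v n x \<in> cells (src f') n" if "x \<in> cells (tgt i) n" for n x using cmap_app[OF v(1)] v f that by simp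
  have "(f' \<odot> v) \<odot> i = u"
    by (rule cmap_eqI) (use h i u v f ff(2) uc square_app[OF sq u(2), symmetric] cmap_app[OF i] in \<open>auto intro: comp_cmap\<close>)
  moreover have "f \<odot> (f' \<odot> v) = v"
    by (rule cmap_eqI) (use h f v ff(1) vc in \<open>auto intro: comp_cmap\<close>)
  ultimately show "\<exists>h. is_cmap h \<and> src h = tgt i \<and> tgt h = src f \<and> h \<odot> i = u \<and> f \<odot> h = v"
    using h f v by (intro exI[of _ "f' \<odot> v"]) simp
qed

locale mono_model =
  fixes M :: "'a model"
  assumes model: "model_structure M" and cofs: "cofs M = Collect cmono"
begin

lemma trivial_fib_iff: "p \<in> trivial_fibs M \<longleftrightarrow> is_cmap p \<and> (\<forall>i :: ('a, 'a) cmap. cmono i \<longrightarrow> lifts i p)"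
proof -
  have "trivial_fibs M = {p. is_cmap p \<and> (\<forall>i\<in>cofs M. lifts i p)}"
    using model unfolding model_structure_def wfs_def by blast
  then show ?thesis by (auto simp: cofs)
qed

lemma fib_iff: "p \<in> fibs M \<longleftrightarrow> is_cmap p \<and> (\<forall>i\<in>cofs M \<inter> weqs M. lifts i p)"
  using model unfolding model_structure_def wfs_def by blast

lemma trivial_cof_iff: "i \<in> cofs M \<inter> weqs M \<longleftrightarrow> is_cmap i \<and> (\<forall>p\<in>fibs M. lifts i p)"
  using model unfolding model_structure_def wfs_def by blast

lemma trivial_cof_factor:
  assumes "is_cmap f"
  obtains j q where "j \<in> cofs M \<inter> weqs M" "q \<in> fibs M" "tgt j = src q" "f = q \<odot> j"
  using assms model unfolding model_structure_def wfs_def by blast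

lemma weq_cancel_left: "is_cmap f \<Longrightarrow> is_cmap g \<Longrightarrow> tgt f = src g \<Longrightarrow> g \<in> weqs M \<Longrightarrow> g \<odot> f \<in> weqs M \<Longrightarrow> f \<in> weqs M"
  using model unfolding model_structure_def by blast

lemma cof_cmap: "i \<in> cofs M \<Longrightarrow> is_cmap i"
  by (simp add: cofs cmono_def)

text \<open>Two-out-of-three applied to the identity as the composite of \<open>s\<close> and
  \<open>r\<close>; a section is moreover a monomorphism.\<close>

lemma section_trivial_cof:
  assumes s: "is_cmap s" and r: "r \<in> trivial_fibs M" "tgt s = src r" "tgt r = src s"
    and rs: "\<And>n x. x \<in> cells (src s) n \<Longrightarrow> app r n (app s n x) = x"
  shows "s \<in> cofs M \<inter> weqs M"
proof -
  have rc: "is_cmap r" using r by (simp add: trivial_fib_iff)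
  have sx: "is_cset (src s)" using s by simp
  have "r \<odot> s = idm (src s)"
    by (rule cmap_eqI) (use s rc r rs sx in \<open>auto intro: comp_cmap\<close>)
  moreover have "idm (src s) \<in> trivial_fibs M"
    unfolding trivial_fib_iff using sx
    by (auto intro!: lifts_split_epi[where f' = "idm (src s)"] simp: cmono_def)
  ultimately have "s \<in> weqs M"
    using weq_cancel_left[OF s rc r(2)] r(1) by (simp add: trivial_fibs_def)
  moreover have "cmono s"
    unfolding cmono_def inj_on_def using s rs by metis
  ultimately show ?thesis by (simp add: cofs)
qed

text \<open>A monomorphism with the left lifting property against fibrations with fibrant target is a
  trivial cofibration: after composition with a fibrant replacement of its target it becomes a retract of one.\<close>

lemma trivial_cof_if_lifts_fibrant:
  assumes i: "cmono i" and l: "\<And>p. p \<in> fibs M \<Longrightarrow> to_pt (tgt p) \<in> fibs M \<Longrightarrow> lifts i p"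
  shows "i \<in> cofs M \<inter> weqs M"
proof -
  have ic: "is_cmap i" using i by (simp add: cmono_def)
  obtain j q where j: "j \<in> cofs M \<inter> weqs M" and q: "q \<in> fibs M" "tgt j = src q" "to_pt (tgt i) = q \<odot> j"
    by (rule trivial_cof_factor[OF to_pt_cmap[OF cmap_tgt[OF ic]]])
  have jc: "is_cmap j" using j cof_cmap by simp
  have qc: "is_cmap q" using q by (simp add: fib_iff)
  have js: "src j = tgt i" using arg_cong[OF q(3), of src] by simp
  have "tgt q = pt" using arg_cong[OF q(3), of tgt] by simp
  then have fibrant: "to_pt (tgt j) \<in> fibs M" using to_pt_unique[OF qc] q by simp
  have ji: "is_cmap (j \<odot> i)" using ic jc js by (auto intro: comp_cmap)
  obtain a p where a: "a \<in> cofs M \<inter> weqs M" and p: "p \<in> fibs M" "tgt a = src p" "j \<odot> i = p \<odot> a"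
    by (rule trivial_cof_factor[OF ji])
  have ac: "is_cmap a" using a cof_cmap by simp
  have pc: "is_cmap p" using p by (simp add: fib_iff)
  have as: "src a = src i" using arg_cong[OF p(3), of src] by simp
  have pt: "tgt p = tgt j" using arg_cong[OF p(3), of tgt] by simp
  \<comment> \<open>The target of \<open>p\<close> is the fibrant replacement of the target of
    \<open>i\<close>, so the assumption on \<open>i\<close> applies to \<open>p\<close>.\<close>
  have "lifts i p" using l[OF p(1)] fibrant pt by simp
  then obtain h where h: "is_cmap h" "src h = tgt i" "tgt h = src p" "h \<odot> i = a" "p \<odot> h = j"
    using liftsE[of i p a j] ac as p jc js pt by metis
  have tj: "is_cset (tgt j)" using jc by simp
  \<comment> \<open>Extending \<open>h\<close> along the trivial cofibration \<open>j\<close>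
    produces a section \<open>s\<close> of \<open>p\<close>.\<close>
  have "lifts j p" using p j by (simp add: fib_iff)
  moreover have "p \<odot> h = idm (tgt j) \<odot> j" using h(5) jc by simp
  ultimately obtain s where s: "is_cmap s" "src s = tgt j" "tgt s = src p" "s \<odot> j = h" "p \<odot> s = idm (tgt j)"
    using liftsE[of j p h "idm (tgt j)"] h js tj pt by (metis idm_cmap idm_sel(1,2))
  \<comment> \<open>The section \<open>s\<close> exhibits \<open>j \<odot> i\<close> as a retract of
    the trivial cofibration \<open>a\<close>; lifts are found against \<open>a\<close> and
    restricted along \<open>s\<close>.\<close>
  have "lifts (j \<odot> i) r" if r: "r \<in> fibs M" for r
    unfolding lifts_def
  proof (intro allI impI, elim conjE)
    fix u v assume u: "is_cmap u" "src u = src (j \<odot> i)" "tgt u = src r"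
      and v: "is_cmap v" "src v = tgt (j \<odot> i)" "tgt v = tgt r" and sq: "r \<odot> u = v \<odot> (j \<odot> i)"
    have rc: "is_cmap r" using r by (simp add: fib_iff)
    have vp: "is_cmap (v \<odot> p)" using v pc pt by (auto intro: comp_cmap)
    have "r \<odot> u = (v \<odot> p) \<odot> a"
      using sq p(3) comp_assoc[OF ac pc v(1) p(2)] pt v(2) by simp
    moreover have "lifts a r" using r a by (simp add: fib_iff)
    ultimately obtain k where k: "is_cmap k" "src k = tgt a" "tgt k = src r" "k \<odot> a = u" "r \<odot> k = v \<odot> p"
      using liftsE[of a r u "v \<odot> p"] u v vp as p(2) by (metis comp_sel(1,2))
    have ks: "is_cmap (k \<odot> s)" using k s p(2) by (auto intro: comp_cmap)
    have "(k \<odot> s) \<odot> (j \<odot> i) = u"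
    proof (rule cmap_eqI)
      fix n x assume "x \<in> cells (src ((k \<odot> s) \<odot> (j \<odot> i))) n"
      then have x: "x \<in> cells (src i) n" by simp
      have ix: "app i n x \<in> cells (src j) n" using cmap_app[OF ic x] js by simp
      have jx: "app j n (app i n x) \<in> cells (src s) n" using cmap_app[OF jc ix] s by simp
      show "app ((k \<odot> s) \<odot> (j \<odot> i)) n x = app u n x"
        using x ix jx comp_app_eq[OF s(4) ix] comp_app_eq[OF h(4) x] comp_app_eq[OF k(4), of x n] as by simp
    qed (use ks ji u k s in \<open>auto intro: comp_cmap\<close>)
    moreover have "r \<odot> (k \<odot> s) = v"
    proof (rule cmap_eqI)
      fix n x assume "x \<in> cells (src (r \<odot> (k \<odot> s))) n"
      then have x: "x \<in> cells (src s) n" by simp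
      have sx: "app s n x \<in> cells (src k) n" using cmap_app[OF s(1) x] s k p by simp
      show "app (r \<odot> (k \<odot> s)) n x = app v n x"
        using x sx comp_app_eq[OF k(5) sx] comp_app_eq[OF s(5) x] s k p by simp
    qed (use ks rc v k s in \<open>auto intro: comp_cmap\<close>)
    ultimately show "\<exists>h. is_cmap h \<and> src h = tgt (j \<odot> i) \<and> tgt h = src r \<and> h \<odot> (j \<odot> i) = u \<and> r \<odot> h = v"
      using ks s k by (intro exI[of _ "k \<odot> s"]) simp
  qed
  then have "j \<odot> i \<in> weqs M" using trivial_cof_iff[of "j \<odot> i"] ji by simp
  then have "i \<in> weqs M" using weq_cancel_left[OF ic jc js[symmetric]] j by simp
  then show ?thesis using i by (simp add: cofs)
qed

end

section \<open>Joyal fibrations have inner fillers\<close>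

lemma infinite_Pair_inj:
  assumes "infinite (UNIV :: 'a set)"
  obtains e :: "'a \<times> 'a \<Rightarrow> 'a" where "inj e"
proof -
  obtain e :: "'a \<times> 'a \<Rightarrow> 'a" where "bij_betw e (UNIV \<times> UNIV) UNIV"
    using card_of_Times_same_infinite[OF assms] unfolding card_of_ordIso[symmetric] by blast
  then show ?thesis using that[of e] by (simp add: bij_betw_def)
qed

locale joyal =
  fixes J :: "'a model"
  assumes joyal: "cubical_joyal J" and inf: "infinite (UNIV :: 'a set)"
begin

sublocale mono_model J
  by unfold_locales (use joyal in \<open>auto simp: cubical_joyal_def\<close>)

lemma fibrant_iff: "is_cset X \<Longrightarrow> to_pt X \<in> fibs J \<longleftrightarrow> cubical_quasicategory X"
  using joyal by (simp add: cubical_joyal_def)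

lemma fib_fibrant_inner_fills:
  assumes p: "p \<in> fibs J" and Y: "to_pt (tgt p) \<in> fibs J"
  shows "inner_fills p"
proof -
  have pc: "is_cmap p" using p by (simp add: fib_iff)
  have Xc: "is_cset (src p)" and Yc: "is_cset (tgt p)" using pc by simp_all
  \<comment> \<open>Fibrations compose, so the source is fibrant as well and both ends of
    \<open>p\<close> have inner fillers.\<close>
  have "to_pt (tgt p) \<odot> p = (to_pt (src p) :: ('a, 'a) cmap)"
    using to_pt_unique[of "to_pt (tgt p) \<odot> p"] comp_cmap[OF pc to_pt_cmap[OF Yc]] by simp
  moreover have "lifts i ((to_pt (tgt p) :: ('a, 'a) cmap) \<odot> p)" if "i \<in> cofs J \<inter> weqs J" for i
    by (rule lifts_comp) (use that p Y Yc pc cof_cmap fib_iff in auto)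
  ultimately have "to_pt (src p) \<in> fibs J" using fib_iff Xc by (simp add: fib_iff)
  then have Xf: "inner_fills (to_pt (src p) :: ('a, 'a) cmap)"
    using fibrant_iff[OF Xc] quasicategory_inner_fills by blast
  have Yf: "inner_fills (to_pt (tgt p) :: ('a, 'a) cmap)"
    using Y fibrant_iff[OF Yc] quasicategory_inner_fills by blast
  obtain q where q: "is_cmap q" "src q = path_cset p" "tgt q = src p"
    "\<And>n x \<gamma>. (x, \<gamma>) \<in> cells (path_cset p) n \<Longrightarrow> app q n (x, \<gamma>) = x"
    by (rule path_start[OF pc]) blast
  obtain r where r: "is_cmap r" "src r = path_cset p" "tgt r = tgt p"
    "\<And>n x \<gamma>. (x, \<gamma>) \<in> cells (path_cset p) n \<Longrightarrow> app r n (x, \<gamma>) = act (tgt p) n (Suc n) (face (Suc n) (Suc n) True) \<gamma>"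
    by (rule path_end[OF pc]) blast
  obtain c where c: "is_cmap c" "src c = src p" "tgt c = path_cset p"
    "\<And>n x. x \<in> cells (src p) n \<Longrightarrow> app c n x = (x, const_path (tgt p) n (app p n x))"
    by (rule path_const[OF pc]) blast
  \<comment> \<open>Cells of the path space are pairs; an injective pairing of the infinite universe
    brings them back into it.\<close>
  obtain e :: "'a \<times> 'a \<Rightarrow> 'a" where e: "inj e" by (rule infinite_Pair_inj[OF inf])
  then have "inj_on e (cells (path_cset p) n)" for n by (rule inj_on_subset) simp
  then obtain Z :: "'a cset" and f f' where f: "is_cmap f" "src f = path_cset p" "tgt f = Z"
    and f': "is_cmap f'" "src f' = Z" "tgt f' = path_cset p"
    and ff: "\<And>n x. x \<in> cells (path_cset p) n \<Longrightarrow> app f' n (app f n x) = x"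
      "\<And>n x. x \<in> cells Z n \<Longrightarrow> app f n (app f' n x) = x"
    by (rule cset_copy[OF path_cset_cset[OF pc], where e = "\<lambda>_. e"]) blast
  define c' q' r' where "c' = f \<odot> c" and "q' = q \<odot> f'" and "r' = r \<odot> f'"
  have c': "is_cmap c'" "src c' = src p" "tgt c' = Z" and q': "is_cmap q'" "src q' = Z" "tgt q' = src p"
    and r': "is_cmap r'" "src r' = Z" "tgt r' = tgt p"
    using c f f' q r by (auto simp: c'_def q'_def r'_def intro: comp_cmap)
  have cc: "(x, const_path (tgt p) n (app p n x)) \<in> cells (path_cset p) n" if "x \<in> cells (src p) n" for n x
    using cmap_app[OF c(1), of x n] c that by simp
  have ffc: "app f' n (app c' n x) = (x, const_path (tgt p) n (app p n x))" if "x \<in> cells (src p) n" for n x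
    using that c cc[OF that] ff(1) by (simp add: c'_def)
  have c'c: "app c' n x \<in> cells Z n" if "x \<in> cells (src p) n" for n x
    using cmap_app[OF c'(1)] c' that by simp
  have "lifts i q'" if i: "cmono i" for i :: "('a, 'a) cmap"
  proof -
    have ic: "is_cmap i" using i by (simp add: cmono_def)
    have "lifts i q" by (rule lifts_mono[OF q(1) path_start_fills[OF pc Yf q] i])
    moreover have "lifts i f'" by (rule lifts_split_epi[OF ic f'(1) f(1)]) (use f f' ff in auto)
    ultimately show ?thesis unfolding q'_def using lifts_comp[OF ic f'(1) q(1)] q(2) f'(3) by simp
  qed
  then have "q' \<in> trivial_fibs J" using q'(1) by (simp add: trivial_fib_iff)
  moreover have "app q' n (app c' n x) = x" if "x \<in> cells (src c') n" for n x
    using that c'(2) ffc[of x n] c'c[of x n] f'(2) q(4)[OF cc] by (simp add: q'_def)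
  ultimately have "c' \<in> cofs J \<inter> weqs J"
    using section_trivial_cof[OF c'(1)] c' q' by simp
  then have l: "lifts c' p" using p by (simp add: fib_iff)
  \<comment> \<open>A lift in this square is the transport: it sends constant paths to their
    starting cell and covers the end point map.\<close>
  have "p \<odot> idm (src p) = r' \<odot> c'"
  proof (rule cmap_eqI)
    fix n x assume "x \<in> cells (src (p \<odot> idm (src p))) n"
    then have x: "x \<in> cells (src p) n" by simp
    show "app (p \<odot> idm (src p)) n x = app (r' \<odot> c') n x"
      using x c'(2) c'c[OF x] f'(2) ffc[OF x] r(4)[OF cc[OF x]] const_path_face[OF Yc cmap_app[OF pc x]]
      by (simp add: r'_def)
  qed (use pc Xc c' r' in \<open>auto intro: comp_cmap\<close>)
  then obtain h where h: "is_cmap h" "src h = Z" "tgt h = src p" "h \<odot> c' = idm (src p)" "p \<odot> h = r'"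
    using liftsE[OF l idm_cmap[OF Xc] _ _ r'(1)] c' r' by (metis idm_sel(1,2))
  have fc: "app f n x \<in> cells Z n" if "x \<in> cells (path_cset p) n" for n x using cmap_app[OF f(1)] f that by simp
  show ?thesis
  proof (rule path_transport_inner_fills[OF pc Xf Yf, of "h \<odot> f"])
    show "is_cmap (h \<odot> f)" using h f by (auto intro: comp_cmap)
    fix n x assume x: "x \<in> cells (src p) n"
    have "app c' n x = app f n (x, const_path (tgt p) n (app p n x))" using x c by (simp add: c'_def)
    then show "app (h \<odot> f) n (x, const_path (tgt p) n (app p n x)) = x"
      using cc[OF x] f(2) comp_app_eq[OF h(4), of x n] c'(2) x by simp
  next
    fix n x \<gamma> assume z: "(x, \<gamma>) \<in> cells (path_cset p) n"
    show "app p n (app (h \<odot> f) n (x, \<gamma>)) = act (tgt p) n (Suc n) (face (Suc n) (Suc n) True) \<gamma>"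
      using z f(2) comp_app_eq[OF h(5), of "app f n (x, \<gamma>)" n] h(2) fc[OF z] f'(2) ff(1)[OF z] r(4)[OF z]
      by (simp add: r'_def)
  qed (use h f in simp_all)
qed

text \<open>Fillers for fibrations with fibrant target make a copy of the inner box inclusion a
  trivial cofibration, against which every fibration lifts.\<close>

lemma fib_inner_fills:
  assumes p: "p \<in> fibs J"
  shows "inner_fills p"
proof (rule inner_lifts_fills_all)
  show pc: "is_cmap p" using p by (simp add: fib_iff)
  fix n i :: nat and e assume n: "2 \<le> n" "1 \<le> i" "i \<le> n"
  interpret box: inner n i e by unfold_locales (use n in auto)
  have "finite (cells (faces_cset n (horn n i e)) m)" for m
    by (rule finite_subset[OF _ finite_box_hom[of m n]]) (use faces_sub[OF horn_sub] in blast)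
  then obtain i' :: "('a, 'a) cmap" where i': "cmono i'"
    "\<And>p :: ('a, 'a) cmap. is_cmap p \<Longrightarrow> lifts (inner_open_box_incl n i e) p \<longleftrightarrow> lifts i' p"
    using cmono_copy[OF box.incl_cmono _ _ inf] by (auto simp: box.ob.collapse_cells box.cu.collapse_cells finite_box_hom)
  have "lifts i' q" if q: "q \<in> fibs J" "to_pt (tgt q) \<in> fibs J" for q
  proof -
    have qc: "is_cmap q" using q by (simp add: fib_iff)
    have "fills q n (horn n i e) (crit (src q) n i e)"
      using fib_fibrant_inner_fills[OF q] n unfolding inner_fills_def by blast
    from box.inner_fills_lifts[OF qc this] show ?thesis using i'(2)[OF qc] by simp
  qed
  then have "i' \<in> cofs J \<inter> weqs J" using trivial_cof_if_lifts_fibrant[OF i'(1)] by blast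
  then have "lifts i' p" using p by (simp add: fib_iff)
  then show "lifts (inner_open_box_incl n i e) p" using i'(2)[OF pc] by simp
qed

lemma trivial_fib_boundary_fills:
  assumes p: "p \<in> trivial_fibs J"
  shows "fills p n (all_faces n) (\<lambda>_. True)"
proof -
  have pc: "is_cmap p" using p by (simp add: trivial_fib_iff)
  have "finite (cells (faces_cset n (all_faces n)) m)" for m
    by (rule finite_subset[OF _ finite_box_hom[of m n]]) (use faces_sub[of "all_faces n"] in blast)
  then obtain i :: "('a, 'a) cmap" where "cmono i"
    "\<And>p :: ('a, 'a) cmap. is_cmap p \<Longrightarrow> lifts (faces_incl n (all_faces n)) p \<longleftrightarrow> lifts i p"
    using cmono_copy[OF faces_incl_cmono[OF subset_refl, of n] _ _ inf] by (auto simp: finite_box_hom)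
  then show ?thesis using lifts_fills[OF pc] p trivial_fib_iff by blast
qed

end

section \<open>Finite universes\<close>

text \<open>Coordinates outside the window are removed by degeneracies, from the front as long as
  \<open>k\<close> is positive and then from the back.\<close>

lemma projection_op:
  assumes "k + n \<le> m"
  shows "\<exists>\<phi>\<in>box_hom m n. \<forall>xs. length xs = m \<longrightarrow> \<phi> xs = take n (drop k xs)"
  using assms
proof (induction m arbitrary: k)
  case 0
  then show ?case by (intro bexI[of _ "box_id 0"]) auto
next
  case (Suc m)
  consider "k + n = Suc m" "k = 0" | "k \<noteq> 0" | "k + n \<le> m" "k = 0" using Suc.prems by linarith
  then show ?case
  proof cases
    case 1
    then show ?thesis by (intro bexI[of _ "box_id (Suc m)"]) auto
  next
    case 2
    then have "k - 1 + n \<le> m" using Suc.prems by simp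
    then obtain \<phi> where \<phi>: "\<phi> \<in> box_hom m n" "\<And>xs. length xs = m \<Longrightarrow> \<phi> xs = take n (drop (k - 1) xs)"
      using Suc.IH[of "k - 1"] by blast
    have d: "degen (Suc m) 1 \<in> box_hom (Suc m) m" using degen_hom[of 1 "Suc m"] by simp
    have "compose (pow1 (Suc m)) \<phi> (degen (Suc m) 1) xs = take n (drop k xs)" if "length xs = Suc m" for xs
      using that \<phi>(2)[of "drop 1 xs"] 2 by (simp add: degen_apply)
    then show ?thesis using comp_hom[OF \<phi>(1) d] by blast
  next
    case 3
    then obtain \<phi> where \<phi>: "\<phi> \<in> box_hom m n" "\<And>xs. length xs = m \<Longrightarrow> \<phi> xs = take n (drop k xs)"
      using Suc.IH[of k] by blast
    have "compose (pow1 (Suc m)) \<phi> (degen (Suc m) (Suc m)) xs = take n (drop k xs)" if "length xs = Suc m" for xs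
      using that \<phi>(2)[of "take m xs"] 3 by (simp add: degen_apply min_def)
    then show ?thesis using comp_hom[OF \<phi>(1) degen_last_hom] by blast
  qed
qed

text \<open>There are \<open>N + 1\<close> windows of \<open>n\<close> consecutive coordinates among
  \<open>n + N\<close>; a positive width makes the corresponding projections distinct.\<close>

lemma many_nonconst:
  assumes "1 \<le> n"
  obtains P where "P \<subseteq> {\<phi> \<in> box_hom (n + N) n. nonconst (n + N) n \<phi>}" "finite P" "N < card P"
proof -
  let ?m = "n + N"
  have "\<forall>k. \<exists>\<phi>. k \<le> N \<longrightarrow> \<phi> \<in> box_hom ?m n \<and> (\<forall>xs. length xs = ?m \<longrightarrow> \<phi> xs = take n (drop k xs))"
    using projection_op[of _ n ?m] by (metis add.commute add_le_cancel_left)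
  then obtain \<pi> where \<pi>: "\<And>k. k \<le> N \<Longrightarrow> \<pi> k \<in> box_hom ?m n"
    "\<And>k xs. k \<le> N \<Longrightarrow> length xs = ?m \<Longrightarrow> \<pi> k xs = take n (drop k xs)" by metis
  let ?r = "replicate ?m False"
  \<comment> \<open>A list with at most one true entry, at position \<open>a\<close>, shows which
    input each output of the window reads.\<close>
  have e: "\<pi> k (?r[a := b]) ! j = (a = k + j \<and> b)" if "k \<le> N" "j < n" for k a b j
    using that \<pi>(2)[OF that(1), of "?r[a := b]"] by (cases "a = k + j") simp_all
  have "nonconst ?m n (\<pi> k)" if k: "k \<le> N" for k
    unfolding nonconst_def
  proof (intro allI impI)
    fix j assume j: "j < n"
    show "\<exists>a. dep ?m (\<pi> k) j a"
      unfolding dep_def using e[OF k j, of "k + j"] k j by (intro exI[of _ "k + j"] conjI exI[of _ ?r]) auto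
  qed
  moreover have "inj_on \<pi> {..N}"
  proof (rule inj_onI)
    fix k k' assume "k \<in> {..N}" "k' \<in> {..N}" "\<pi> k = \<pi> k'"
    then show "k = k'" using e[of k 0 k True] e[of k' 0 k True] assms by simp
  qed
  then have "card (\<pi> ` {..N}) = Suc N" by (simp add: card_image)
  ultimately show ?thesis using that[of "\<pi> ` {..N}"] \<pi>(1) by auto
qed

text \<open>A nondegenerate cell of positive dimension has more and more degeneracies in high dimensions.\<close>

lemma finite_universe_discrete:
  fixes X :: "'a cset"
  assumes X: "is_cset X" and fin: "finite (UNIV :: 'a set)" and b: "b \<in> cells X n"
  shows "b \<in> const_vertex X n ` cells X 0"
  using b
proof (induction n arbitrary: b rule: less_induct)
  case (less n)
  let ?D = "\<lambda>n. const_vertex X n ` cells X 0"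
  show ?case
  proof (cases "n = 0")
    case True
    have "const_op 0 = box_id 0" by (rule op_eqI[where m = 0]) auto
    then have "const_vertex X 0 b = b" using less.prems X True by (simp add: const_vertex_act)
    then show ?thesis using less.prems True by (metis imageI)
  next
    case False
    show ?thesis
    proof (rule ccontr)
      assume nb: "b \<notin> ?D n"
      \<comment> \<open>By induction all faces of \<open>b\<close> are constant, so a nonconstant
        \<open>b\<close> is minimal outside the constant cells.\<close>
      interpret mc: minimal_cell X ?D n b
      proof
        show "act X m k \<phi> x \<in> ?D m" if "\<phi> \<in> box_hom m k" "x \<in> ?D k" for m k \<phi> x
          using that act_const_vertex[OF X] by auto
        show "act X (n - 1) n (face n j d) b \<in> ?D (n - 1)" if "1 \<le> j" "j \<le> n" for j d
          using less.IH[of "n - 1"] cset_act[OF X face_hom[OF that] less.prems] False by simp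
      qed (use X less.prems nb in auto)
      \<comment> \<open>This number of additional dimensions gives more distinct degeneracies of
        \<open>b\<close> than the universe has elements.\<close>
      let ?N = "card (UNIV :: 'a set)"
      obtain P where P: "P \<subseteq> {\<phi> \<in> box_hom (n + ?N) n. nonconst (n + ?N) n \<phi>}" "finite P" "?N < card P"
        by (rule many_nonconst[of n ?N]) (use False in auto)
      have "inj_on (\<lambda>\<phi>. act X (n + ?N) n \<phi> b) P"
        by (rule inj_onI) (use P(1) mc.nonconst_inj in blast)
      then have "card P \<le> ?N" using card_inj_on_le[of _ P UNIV] fin by auto
      then show False using P(3) by simp
    qed
  qed
qed

definition discrete :: "'a set \<Rightarrow> 'a cset" where
  "discrete S = \<lparr>cells = (\<lambda>_. S), act = (\<lambda>_ _ _ x. x)\<rparr>"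

lemma discrete_sel [simp]: "cells (discrete S) n = S" "act (discrete S) m n \<phi> x = x"
  by (simp_all add: discrete_def)

lemma discrete_cset [simp]: "is_cset (discrete S)"
  by (simp add: is_cset_def)

text \<open>If the universe is finite and contains \<open>a \<noteq> b\<close>, every cubical set in it is discrete, so the surjection
  of \<open>{a, b}\<close> onto \<open>{a}\<close> is a trivial fibration; its section would be both a trivial cofibration and a
  Kan fibration.\<close>

lemma finite_universe_trivial:
  fixes G :: "'a model" and a b :: 'a
  assumes G: "grothendieck G" and fin: "finite (UNIV :: 'a set)"
  shows "a = b"
proof (rule ccontr)
  assume ab: "a \<noteq> b"
  interpret mono_model G by unfold_locales (use G in \<open>auto simp: grothendieck_def\<close>)
  let ?A = "discrete {a}" and ?B = "discrete {a, b}"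
  obtain s where s: "is_cmap s" "src s = ?A" "tgt s = ?B" "\<And>n x. x \<in> cells ?A n \<Longrightarrow> app s n x = x"
    by (rule cmap_exE[of ?A ?B "\<lambda>_ x. x"]) auto
  obtain r where r: "is_cmap r" "src r = ?B" "tgt r = ?A" "\<And>n x. x \<in> cells ?B n \<Longrightarrow> app r n x = a"
    by (rule cmap_exE[of ?B ?A "\<lambda>_ _. a"]) auto
  have "lifts i r" if i: "cmono i" for i :: "('a, 'a) cmap"
    unfolding lifts_def
  proof (intro allI impI, elim conjE)
    fix u v assume u: "is_cmap u" "src u = src i" "tgt u = src r"
      and v: "is_cmap v" "src v = tgt i" "tgt v = tgt r" and sq: "r \<odot> u = v \<odot> i"
    have ic: "is_cmap i" and inj: "\<And>n. inj_on (app i n) (cells (src i) n)" using i by (simp_all add: cmono_def)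
    have Bc: "is_cset (tgt i)" using ic by simp
    \<comment> \<open>All vertices of a constant cell coincide, so evaluating at a fixed corner is
      compatible with every operator.\<close>
    define \<tau> where "\<tau> n = vertex_op n False" for n
    have \<tau>: "\<tau> n \<in> box_hom 0 n" for n unfolding \<tau>_def by (rule vertex_op_hom)
    \<comment> \<open>Outside the image of \<open>i\<close> the value \<open>a\<close> is an
      arbitrary default: \<open>r\<close> is constant, so any extension of \<open>u\<close> lifts
      \<open>v\<close>.\<close>
    define H where "H w = (if w \<in> app i 0 ` cells (src i) 0 then app u 0 (inv_into (cells (src i) 0) (app i 0) w) else a)" for w
    have H: "H (app i 0 x) = app u 0 x" if "x \<in> cells (src i) 0" for x
      using that inj by (simp add: H_def)
    have Hc: "H w \<in> {a, b}" for w
    proof -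
      have "app u 0 x \<in> {a, b}" if "x \<in> cells (src i) 0" for x using cmap_app[OF u(1), of x 0] u r that by simp
      then show ?thesis by (auto simp: H_def inv_into_into)
    qed
    have vert: "act (tgt i) 0 m (\<tau> m) (act (tgt i) m n \<phi> c) = act (tgt i) 0 n (\<tau> n) c"
      if \<phi>: "\<phi> \<in> box_hom m n" and c: "c \<in> cells (tgt i) n" for m n \<phi> c
    proof -
      obtain w where w: "w \<in> cells (tgt i) 0" "c = const_vertex (tgt i) n w"
        using finite_universe_discrete[OF Bc fin c] by blast
      show ?thesis using act_const_vertex[OF Bc w(1)] w(2) \<phi> \<tau> by simp
    qed
    obtain h where h: "is_cmap h" "src h = tgt i" "tgt h = ?B"
      "\<And>n c. c \<in> cells (tgt i) n \<Longrightarrow> app h n c = H (act (tgt i) 0 n (\<tau> n) c)"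
      by (rule cmap_exE[of "tgt i" ?B "\<lambda>n c. H (act (tgt i) 0 n (\<tau> n) c)"]) (use Bc Hc vert in auto)
    have "h \<odot> i = u"
    proof (rule cmap_eqI)
      fix n x assume "x \<in> cells (src (h \<odot> i)) n"
      then have x: "x \<in> cells (src i) n" by simp
      have "app (h \<odot> i) n x = H (app i 0 (act (src i) 0 n (\<tau> n) x))"
        using x h(4)[OF cmap_app[OF ic x]] cmap_nat[OF ic \<tau> x] by simp
      also have "\<dots> = app u 0 (act (src i) 0 n (\<tau> n) x)"
        using H cset_act[OF cmap_src[OF ic] \<tau> x] by simp
      also have "\<dots> = app u n x" using cmap_nat[OF u(1) \<tau>, of x n] u x r by simp
      finally show "app (h \<odot> i) n x = app u n x" .
    qed (use h ic u r in \<open>auto intro: comp_cmap\<close>)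
    moreover have "r \<odot> h = v"
    proof (rule cmap_eqI)
      fix n x assume "x \<in> cells (src (r \<odot> h)) n"
      then have x: "x \<in> cells (tgt i) n" using h by simp
      have "app v n x = a" using cmap_app[OF v(1), of x n] v r x by simp
      moreover have "app h n x \<in> {a, b}" using cmap_app[OF h(1), of x n] h x by simp
      ultimately show "app (r \<odot> h) n x = app v n x" using x h(2) r(4) by simp
    qed (use h r v in \<open>auto intro: comp_cmap\<close>)
    ultimately show "\<exists>h. is_cmap h \<and> src h = tgt i \<and> tgt h = src r \<and> h \<odot> i = u \<and> r \<odot> h = v"
      using h r by auto
  qed
  then have "r \<in> trivial_fibs G" using r(1) by (simp add: trivial_fib_iff)
  then have st: "s \<in> cofs G \<inter> weqs G"
    using section_trivial_cof[OF s(1)] r s by simp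
  \<comment> \<open>An open box of positive dimension contains the face opposite to the missing one;
    its value \<open>a\<close> forces \<open>y = a\<close>.\<close>
  have "fills s n (horn n i e) (\<lambda>_. True)" if "1 \<le> i" "i \<le> n" for n i e
    unfolding fills_def
  proof (intro allI impI, elim conjE)
    fix x y assume x: "compat (src s) n (horn n i e) x" and y: "has_faces (tgt s) n (horn n i e) (\<lambda>j d. app s (n - 1) (x j d)) y"
    have 1: "(i, \<not> e) \<in> horn n i e" using that by (auto simp: horn_def all_faces_def)
    have xa: "x j d = a" if "(j, d) \<in> horn n i e" for j d using compat_cells[OF x that] s by simp
    have "y = a" using has_faces_face[OF y 1] xa[OF 1] s by simp
    then show "\<exists>z. has_faces (src s) n (horn n i e) x z \<and> app s n z = y"
      using s xa by (intro exI[of _ a]) (simp add: has_faces_def)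
  qed
  then have "kan_fibration s" by (rule kan_fibrationI[OF s(1)])
  then have "s \<in> fibs G" using G by (simp add: grothendieck_def)
  \<comment> \<open>A lift of \<open>s\<close> against itself is an inverse of the inclusion of
    \<open>{a}\<close> into \<open>{a, b}\<close>.\<close>
  then have "lifts s s" using st fib_iff by blast
  moreover have "s \<odot> idm ?A = idm ?B \<odot> s" using s by simp
  ultimately obtain h where h: "is_cmap h" "src h = ?B" "tgt h = ?A" "s \<odot> h = idm ?B"
    using liftsE[of s s "idm ?A" "idm ?B"] s by (metis discrete_cset idm_cmap idm_sel(1,2))
  have "app h 0 b = a" using cmap_app[OF h(1), of b 0] h by simp
  then show False using comp_app_eq[OF h(4), of b 0] h(2) s ab by simp
qed

text \<open>In a one-element universe every equation between cells holds, and a degeneracy of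
  \<open>x0\<close> supplies the cell itself.\<close>

lemma singleton_fills:
  fixes f :: "('a, 'a) cmap"
  assumes eq: "\<And>a b :: 'a. a = b" and f: "is_cmap f" and x0: "x0 \<in> cells (src f) 0"
  shows "fills f n S C"
  unfolding fills_def has_faces_def
  using const_vertex_cell[OF cmap_src[OF f] x0, of n] eq by blast

section \<open>Mapping spaces of Joyal fibrations\<close>

theorem corollary7p7:
  fixes X Y :: "'a cset" and f :: "('a, 'a) cmap" and J G :: "'a model" and Q :: "'b cset"
  shows "(cubical_joyal J \<and> grothendieck G \<and> is_cmap f \<and> src f = X \<and> tgt f = Y \<longrightarrow>
      (f \<in> fibs J \<longrightarrow> (\<forall>x0\<in>cells X 0. \<forall>x1\<in>cells X 0. mapping_space_map f x0 x1 \<in> fibs G)) \<and>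
      (f \<in> trivial_fibs J \<longrightarrow>
        (\<forall>x0\<in>cells X 0. \<forall>x1\<in>cells X 0. mapping_space_map f x0 x1 \<in> trivial_fibs G)))
    \<and> (cubical_quasicategory Q \<longrightarrow>
      (\<forall>x0\<in>cells Q 0. \<forall>x1\<in>cells Q 0. cubical_kan_complex (mapping_space Q x0 x1)))"
proof (intro conjI impI ballI; (elim conjE)?)
  fix x0 x1
  assume J: "cubical_joyal J" and G: "grothendieck G" and f: "is_cmap f" "src f = X" "tgt f = Y"
    and x: "x0 \<in> cells X 0" "x1 \<in> cells X 0" and fib: "f \<in> fibs J"
  have "inner_fills f"
  proof (cases "finite (UNIV :: 'a set)")
    \<comment> \<open>A finite universe that carries the Grothendieck model structure has a single
      element.\<close>
    case True
    then show ?thesis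
      unfolding inner_fills_def using singleton_fills[OF finite_universe_trivial[OF G] f(1), of x0] x f by blast
  next
    case False
    interpret joyal J by unfold_locales (use J False in auto)
    show ?thesis using fib by (rule fib_inner_fills)
  qed
  then have "kan_fibration (mapping_space_map f x0 x1)"
    using mapping_space_kan[OF f(1)] x f by simp
  then show "mapping_space_map f x0 x1 \<in> fibs G" using G by (simp add: grothendieck_def)
next
  fix x0 x1
  assume J: "cubical_joyal J" and G: "grothendieck G" and f: "is_cmap f" "src f = X" "tgt f = Y"
    and x: "x0 \<in> cells X 0" "x1 \<in> cells X 0" and fib: "f \<in> trivial_fibs J"
  interpret G: mono_model G by unfold_locales (use G in \<open>auto simp: grothendieck_def\<close>)
  have "fills f n (all_faces n) (\<lambda>_. True)" for n
  proof (cases "finite (UNIV :: 'a set)")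
    case True
    then show ?thesis
      using singleton_fills[OF finite_universe_trivial[OF G] f(1), of x0] x f by blast
  next
    case False
    interpret joyal J by unfold_locales (use J False in auto)
    show ?thesis using fib by (rule trivial_fib_boundary_fills)
  qed
  then have fill: "fills (mapping_space_map f x0 x1) n (all_faces n) (\<lambda>_. True)" for n
    using mapping_space_boundary_fills[OF f(1)] x f by simp
  have "is_cmap (mapping_space_map f x0 x1)" using mapping_space_map_cmap[OF f(1)] x f by simp
  then show "mapping_space_map f x0 x1 \<in> trivial_fibs G"
    unfolding G.trivial_fib_iff using lifts_mono[OF _ fill] by blast
next
  fix x0 x1 assume "cubical_quasicategory Q" "x0 \<in> cells Q 0" "x1 \<in> cells Q 0"
  then show "cubical_kan_complex (mapping_space Q x0 x1)" by (rule quasicategory_mapping_space)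
qed

end
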